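(* Suppose that $\theta$ is a homeomorphism on a compact metric space $\Omega$, that $\phi$ is Anosov on fibers, and that there exists an $f$-invariant Borel probability measure $\nu$ on $M$ with full support ($\mathrm{supp}\,\nu=M$). Then $\phi$ is topological mixing on fibers.
   Context: Setting: $M$ is a connected compact smooth Riemannian manifold without boundary; $\mathrm{Diff}^2(M)$ is the space of $C^2$ diffeomorphisms of $M$ with the $C^2$ topology; $f:\Omega\to \mathrm{Diff}^2(M)$, $\omega\mapsto f_\omega$, is continuous; $\phi:M\times\Omega\to M\times\Omega$ is the skew product $\phi(x,\omega)=(f_\omega x,\theta\omega)$. Write $M_\omega=M\times\{\omega\}$. Anosov on fibers: for every $(x,\omega)$ there is a splitting $T_xM_\omega=E^u_{(x,\omega)}\oplus E^s_{(x,\omega)}$ depending continuously on $(x,\omega)\in M\times\Omega$, with $\dim E^u_{(x,\omega)},\dim E^s_{(x,\omega)}>0$, $Df_\omega(x)E^\tau_{(x,\omega)}=E^\tau_{\phi(x,\omega)}$ for $\tau=u,s$, and a constant $\lambda_0>0$ such that for all $(x,\omega)$: $|Df_\omega(x)\xi|\ge e^{\lambda_0}|\xi|$ for $\xi\in E^u_{(x,\omega)}$ and $|Df_\omega(x)\eta|\le e^{-\lambda_0}|\eta|$ for $\eta\in E^s_{(x,\omega)}$. A Borel probability measure $\nu$ on $M$ is $f$-invariant if $\nu(f_\omega^{-1}(A))=\nu(A)$ for every Borel set $A\subset M$ and every $\omega\in\Omega$. Topological mixing on fibers: for any nonempty open sets $U,V\subset M$ there exists $N>0$ such that for all $n\ge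 N$ and all $\omega\in\Omega$, $\phi^n(U\times\{\omega\})\cap (V\times\{\theta^n\omega\})\ne\emptyset$. *)

theory Defs
  imports "HOL-Probability.Probability" "HOL-Library.Function_Algebras"
begin

section \<open>Functions of class \<open>C\<^sup>k\<close> on open subsets of a Euclidean space\<close>

primrec Ck_on :: "nat \<Rightarrow> 'a::real_normed_vector set \<Rightarrow> ('a \<Rightarrow> 'b::real_normed_vector) \<Rightarrow> bool" where
  "Ck_on 0 S h \<longleftrightarrow> continuous_on S h"
| "Ck_on (Suc k) S h \<longleftrightarrow>
     (\<forall>x\<in>S. h differentiable (at x)) \<and> (\<forall>v. Ck_on k S (\<lambda>x. frechet_derivative h (at x) v))"

definition smooth_on :: "'a::real_normed_vector set \<Rightarrow> ('a \<Rightarrow> 'b::real_normed_vector) \<Rightarrow> bool" where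
  "smooth_on S h \<longleftrightarrow> (\<forall>k. Ck_on k S h)"


section \<open>Smooth manifolds\<close>

text \<open>A manifold is a type \<open>'m\<close> together with an atlas of charts into \<open>'e\<close>, where
  \<open>DIM('e)\<close> is the dimension. A chart is a pair of its domain and its coordinate function, whose
  values outside the domain are irrelevant.\<close>

type_synonym ('m, 'e) chart = "'m set \<times> ('m \<Rightarrow> 'e)"

abbreviation chart_inv :: "('m, 'e) chart \<Rightarrow> 'e \<Rightarrow> 'm" where
  "chart_inv c \<equiv> inv_into (fst c) (snd c)"

definition is_chart :: "('m::topological_space, 'e::euclidean_space) chart \<Rightarrow> bool" where
  "is_chart c \<longleftrightarrow> open (fst c) \<and> open (snd c ` fst c) \<and>
     homeomorphism (fst c) (snd c ` fst c) (snd c) (chart_inv c)"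

definition coord_rep :: "('m, 'e) chart \<Rightarrow> ('m, 'e) chart \<Rightarrow> ('m \<Rightarrow> 'm) \<Rightarrow> 'e \<Rightarrow> 'e" where
  "coord_rep c c' h = snd c' \<circ> h \<circ> chart_inv c"

definition coord_diff ::
  "('m, 'e::euclidean_space) chart \<Rightarrow> ('m, 'e) chart \<Rightarrow> ('m \<Rightarrow> 'm) \<Rightarrow> 'm \<Rightarrow> 'e \<Rightarrow> 'e" where
  "coord_diff c c' h x = frechet_derivative (coord_rep c c' h) (at (snd c x))"

definition smooth_atlas :: "('m::topological_space, 'e::euclidean_space) chart set \<Rightarrow> bool" where
  "smooth_atlas A \<longleftrightarrow> (\<forall>c\<in>A. is_chart c) \<and> (\<Union>c\<in>A. fst c) = UNIV \<and>
     (\<forall>c\<in>A. \<forall>c'\<in>A. smooth_on (snd c ` (fst c \<inter> fst c')) (coord_rep c c' id))"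

definition Ck_map ::
  "nat \<Rightarrow> ('m::topological_space, 'e::euclidean_space) chart set \<Rightarrow> ('m \<Rightarrow> 'm) \<Rightarrow> bool" where
  "Ck_map k A h \<longleftrightarrow> continuous_on UNIV h \<and>
     (\<forall>c\<in>A. \<forall>c'\<in>A. Ck_on k (snd c ` (fst c \<inter> h -` fst c')) (coord_rep c c' h))"


section \<open>Tangent spaces and Riemannian metrics\<close>

instantiation "fun" :: (type, real_vector) real_vector
begin

definition scaleR_fun :: "real \<Rightarrow> ('a \<Rightarrow> 'b) \<Rightarrow> 'a \<Rightarrow> 'b" where
  "scaleR_fun r v = (\<lambda>i. r *\<^sub>R v i)"

instance
  by standard (auto simp: scaleR_fun_def fun_eq_iff algebra_simps)

end

text \<open>A tangent vector at \<open>x\<close> is the family of its coordinate representations \<open>v c\<close> in the charts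
  \<open>c\<close> around \<open>x\<close>, related by the derivatives of the coordinate changes; the components at all other
  indices are set to zero.\<close>

type_synonym ('m, 'e) tangent = "('m, 'e) chart \<Rightarrow> 'e"

definition charts_at :: "('m, 'e) chart set \<Rightarrow> 'm \<Rightarrow> ('m, 'e) chart set" where
  "charts_at A x = {c \<in> A. x \<in> fst c}"

definition tangent_space ::
  "('m, 'e::euclidean_space) chart set \<Rightarrow> 'm \<Rightarrow> ('m, 'e) tangent set" where
  "tangent_space A x = {v. (\<forall>c. c \<notin> charts_at A x \<longrightarrow> v c = 0) \<and>
     (\<forall>c\<in>charts_at A x. \<forall>c'\<in>charts_at A x. v c' = coord_diff c c' id x (v c))}"

text \<open>The tangent vector at \<open>x\<close> whose representation in the chart \<open>c\<close> is \<open>a\<close>.\<close>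

definition tangent_of ::
  "('m, 'e::euclidean_space) chart set \<Rightarrow> ('m, 'e) chart \<Rightarrow> 'm \<Rightarrow> 'e \<Rightarrow> ('m, 'e) tangent" where
  "tangent_of A c x a = (\<lambda>c'. if c' \<in> charts_at A x then coord_diff c c' id x a else 0)"

text \<open>The differential of a map at \<open>x\<close>. The chosen chart around \<open>x\<close> does not matter: see
  \<open>tangent_map_chart\<close> below.\<close>

definition tangent_map ::
  "('m, 'e::euclidean_space) chart set \<Rightarrow> ('m \<Rightarrow> 'm) \<Rightarrow> 'm \<Rightarrow> ('m, 'e) tangent \<Rightarrow> ('m, 'e) tangent" where
  "tangent_map A h x v = (\<lambda>c'. if c' \<in> charts_at A (h x)
     then let c = (SOME c. c \<in> charts_at A x) in coord_diff c c' h x (v c) else 0)"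

definition riemannian_metric ::
  "('m, 'e::euclidean_space) chart set \<Rightarrow> ('m \<Rightarrow> ('m, 'e) tangent \<Rightarrow> ('m, 'e) tangent \<Rightarrow> real) \<Rightarrow> bool" where
  "riemannian_metric A g \<longleftrightarrow>
     (\<forall>x. \<forall>v\<in>tangent_space A x. \<forall>w\<in>tangent_space A x.
        g x v w = g x w v \<and> (v \<noteq> 0 \<longrightarrow> g x v v > 0) \<and>
        (\<forall>r. g x (r *\<^sub>R v) w = r * g x v w) \<and>
        (\<forall>u\<in>tangent_space A x. g x (u + v) w = g x u w + g x v w)) \<and>
     (\<forall>c\<in>A. \<forall>a b. smooth_on (snd c ` fst c)
        (\<lambda>y. let x = chart_inv c y in g x (tangent_of A c x a) (tangent_of A c x b)))"

definition riemannian_norm ::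
  "('m \<Rightarrow> ('m, 'e) tangent \<Rightarrow> ('m, 'e) tangent \<Rightarrow> real) \<Rightarrow> 'm \<Rightarrow> ('m, 'e) tangent \<Rightarrow> real" where
  "riemannian_norm g x v = sqrt (g x v v)"


section \<open>The space of \<open>C\<^sup>2\<close> diffeomorphisms\<close>

definition Diff2 :: "('m::topological_space, 'e::euclidean_space) chart set \<Rightarrow> ('m \<Rightarrow> 'm) set" where
  "Diff2 A = {h. bij h \<and> Ck_map 2 A h \<and> Ck_map 2 A (inv h)}"

definition C2_close_on :: "'e::euclidean_space set \<Rightarrow> real \<Rightarrow> ('e \<Rightarrow> 'e) \<Rightarrow> ('e \<Rightarrow> 'e) \<Rightarrow> bool" where
  "C2_close_on S \<epsilon> p q \<longleftrightarrow> (\<forall>y\<in>S. norm (p y - q y) < \<epsilon> \<and>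
     (\<forall>a. norm a \<le> 1 \<longrightarrow>
        norm (frechet_derivative p (at y) a - frechet_derivative q (at y) a) < \<epsilon>) \<and>
     (\<forall>a b. norm a \<le> 1 \<longrightarrow> norm b \<le> 1 \<longrightarrow>
        norm (frechet_derivative (\<lambda>z. frechet_derivative p (at z) a) (at y) b
            - frechet_derivative (\<lambda>z. frechet_derivative q (at z) a) (at y) b) < \<epsilon>))"

text \<open>The subbasic neighbourhoods \<open>N\<^sup>2(h; c, c', K, \<epsilon>)\<close> of the (compact-open) \<open>C\<^sup>2\<close> topology.\<close>

definition C2_nbhd ::
  "('m::topological_space, 'e::euclidean_space) chart set \<Rightarrow> ('m \<Rightarrow> 'm) \<Rightarrow>
   ('m, 'e) chart \<Rightarrow> ('m, 'e) chart \<Rightarrow> 'm set \<Rightarrow> real \<Rightarrow> ('m \<Rightarrow> 'm) set" where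
  "C2_nbhd A h c c' K \<epsilon> = {k \<in> Diff2 A. k ` K \<subseteq> fst c' \<and>
     C2_close_on (snd c ` K) \<epsilon> (coord_rep c c' h) (coord_rep c c' k)}"

definition Diff2_topology ::
  "('m::topological_space, 'e::euclidean_space) chart set \<Rightarrow> ('m \<Rightarrow> 'm) topology" where
  "Diff2_topology A = topology_generated_by
     {C2_nbhd A h c c' K \<epsilon> | h c c' K \<epsilon>. h \<in> Diff2 A \<and> c \<in> A \<and> c' \<in> A \<and> \<epsilon> > 0 \<and>
        compact K \<and> K \<subseteq> fst c \<and> h ` K \<subseteq> fst c'}"


section \<open>Skew products over \<open>\<theta>\<close>\<close>

definition skew_product :: "('w \<Rightarrow> 'm \<Rightarrow> 'm) \<Rightarrow> ('w \<Rightarrow> 'w) \<Rightarrow> 'm \<times> 'w \<Rightarrow> 'm \<times> 'w" where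
  "skew_product f \<theta> = (\<lambda>(x, \<omega>). (f \<omega> x, \<theta> \<omega>))"

text \<open>\<open>E\<close> is a continuous subbundle of the bundle over \<open>M \<times> \<Omega>\<close> with fibre \<open>T\<^sub>x M\<^sub>\<omega> = T\<^sub>x M\<close> at
  \<open>(x, \<omega>)\<close>: locally it is spanned by a continuous frame.\<close>

definition continuous_subbundle ::
  "('m::topological_space, 'e::euclidean_space) chart set \<Rightarrow>
   ('m \<times> 'w::topological_space \<Rightarrow> ('m, 'e) tangent set) \<Rightarrow> bool" where
  "continuous_subbundle A E \<longleftrightarrow>
     (\<forall>p. subspace (E p) \<and> E p \<subseteq> tangent_space A (fst p)) \<and>
     (\<forall>p. \<exists>W k. \<exists>e :: nat \<Rightarrow> 'm \<times> 'w \<Rightarrow> ('m, 'e) tangent. open W \<and> p \<in> W \<and>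
        (\<forall>i<k. \<forall>c\<in>A. continuous_on {q \<in> W. fst q \<in> fst c} (\<lambda>q. e i q c)) \<and>
        (\<forall>q\<in>W. inj_on (\<lambda>i. e i q) {..<k} \<and> independent ((\<lambda>i. e i q) ` {..<k}) \<and>
           span ((\<lambda>i. e i q) ` {..<k}) = E q))"

definition anosov_on_fibers ::
  "('m::topological_space, 'e::euclidean_space) chart set \<Rightarrow>
   ('m \<Rightarrow> ('m, 'e) tangent \<Rightarrow> ('m, 'e) tangent \<Rightarrow> real) \<Rightarrow>
   ('w::topological_space \<Rightarrow> 'm \<Rightarrow> 'm) \<Rightarrow> ('w \<Rightarrow> 'w) \<Rightarrow> bool" where
  "anosov_on_fibers A g f \<theta> \<longleftrightarrow>
     (\<exists>(Eu :: 'm \<times> 'w \<Rightarrow> ('m, 'e) tangent set) (Es :: 'm \<times> 'w \<Rightarrow> ('m, 'e) tangent set) lam.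
        continuous_subbundle A Eu \<and> continuous_subbundle A Es \<and> lam > 0 \<and>
        (\<forall>x \<omega>.
           Eu (x, \<omega>) \<inter> Es (x, \<omega>) = {0} \<and>
           {\<xi> + \<eta> | \<xi> \<eta>. \<xi> \<in> Eu (x, \<omega>) \<and> \<eta> \<in> Es (x, \<omega>)} = tangent_space A x \<and>
           dim (Eu (x, \<omega>)) > 0 \<and> dim (Es (x, \<omega>)) > 0 \<and>
           tangent_map A (f \<omega>) x ` Eu (x, \<omega>) = Eu (skew_product f \<theta> (x, \<omega>)) \<and>
           tangent_map A (f \<omega>) x ` Es (x, \<omega>) = Es (skew_product f \<theta> (x, \<omega>)) \<and>
           (\<forall>\<xi>\<in>Eu (x, \<omega>). riemannian_norm g (f \<omega> x) (tangent_map A (f \<omega>) x \<xi>)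
                               \<ge> exp lam * riemannian_norm g x \<xi>) \<and>
           (\<forall>\<eta>\<in>Es (x, \<omega>). riemannian_norm g (f \<omega> x) (tangent_map A (f \<omega>) x \<eta>)
                               \<le> exp (- lam) * riemannian_norm g x \<eta>)))"

definition borel_probability :: "'m::topological_space measure \<Rightarrow> bool" where
  "borel_probability \<nu> \<longleftrightarrow> prob_space \<nu> \<and> sets \<nu> = sets borel"

definition invariant_measure :: "('w \<Rightarrow> 'm \<Rightarrow> 'm::topological_space) \<Rightarrow> 'm measure \<Rightarrow> bool" where
  "invariant_measure f \<nu> \<longleftrightarrow>
     (\<forall>\<omega>. \<forall>B\<in>sets borel. emeasure \<nu> (f \<omega> -` B) = emeasure \<nu> B)"

definition measure_support :: "'m::topological_space measure \<Rightarrow> 'm set" where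
  "measure_support \<nu> = {x. \<forall>U. open U \<longrightarrow> x \<in> U \<longrightarrow> emeasure \<nu> U > 0}"

definition mixing_on_fibers ::
  "('w \<Rightarrow> 'm::topological_space \<Rightarrow> 'm) \<Rightarrow> ('w \<Rightarrow> 'w) \<Rightarrow> bool" where
  "mixing_on_fibers f \<theta> \<longleftrightarrow>
     (\<forall>U V. open U \<longrightarrow> open V \<longrightarrow> U \<noteq> {} \<longrightarrow> V \<noteq> {} \<longrightarrow>
        (\<exists>N>0. \<forall>n\<ge>N. \<forall>\<omega>. (skew_product f \<theta> ^^ n) ` (U \<times> {\<omega>}) \<inter> V \<times> {(\<theta> ^^ n) \<omega>} \<noteq> {}))"


section \<open>Well-definedness of the differential and of the topology\<close>

lemma Diff2_topspace:
  assumes "smooth_atlas A"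
  shows "topspace (Diff2_topology A) = Diff2 A"
proof -
  obtain c where c: "c \<in> A"
    using assms unfolding smooth_atlas_def by blast
  let ?B = "{C2_nbhd A h c c' K \<epsilon> | h c c' K \<epsilon>. h \<in> Diff2 A \<and> c \<in> A \<and> c' \<in> A \<and> \<epsilon> > 0 \<and>
        compact K \<and> K \<subseteq> fst c \<and> h ` K \<subseteq> fst c'}"
  have "Diff2 A \<subseteq> \<Union> ?B"
  proof
    fix h assume h: "h \<in> Diff2 A"
    have "C2_nbhd A h c c {} 1 \<in> ?B"
      using h c by (intro CollectI exI[of _ h] exI[of _ c] exI[of _ "{}"] exI[of _ 1]) auto
    moreover have "h \<in> C2_nbhd A h c c {} 1"
      using h by (simp add: C2_nbhd_def C2_close_on_def)
    ultimately show "h \<in> \<Union> ?B" by (rule UnionI)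
  qed
  moreover have "\<Union> ?B \<subseteq> Diff2 A"
  proof (rule Union_least)
    fix X assume "X \<in> ?B"
    then show "X \<subseteq> Diff2 A"
      by (elim CollectE exE conjE) (simp add: C2_nbhd_def)
  qed
  ultimately have "Diff2 A = \<Union> ?B"
    by (rule equalityI)
  then show ?thesis
    by (simp only: Diff2_topology_def topology_generated_by_topspace)
qed

lemma open_chart_image:
  assumes "is_chart c" "open V"
  shows "open (snd c ` (fst c \<inter> V))"
proof -
  have hom: "homeomorphism (fst c) (snd c ` fst c) (snd c) (chart_inv c)"
    and opn: "open (fst c)" "open (snd c ` fst c)"
    using assms(1) by (auto simp: is_chart_def)
  have "openin (top_of_set (fst c)) (fst c \<inter> V)"
    using assms(2) by (simp add: openin_open_Int)
  then have "openin (top_of_set (snd c ` fst c)) (snd c ` (fst c \<inter> V))"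
    using hom by (metis homeomorphism_imp_open_map)
  then show ?thesis
    using opn(2) openin_open_trans by blast
qed

lemma coord_diff_comp:
  assumes c: "is_chart c" "is_chart c'" and x: "x \<in> fst c" "h x \<in> fst c'"
    and cont: "continuous_on UNIV h"
    and d: "coord_rep c c' h differentiable (at (snd c x))"
      "coord_rep c' c'' k differentiable (at (snd c' (h x)))"
  shows "coord_diff c c'' (k \<circ> h) x = coord_diff c' c'' k (h x) \<circ> coord_diff c c' h x"
proof -
  have inj: "inj_on (snd c) (fst c)" "inj_on (snd c') (fst c')"
    using c by (auto simp: is_chart_def homeomorphism_def intro: inj_on_inverseI)
  let ?S = "snd c ` (fst c \<inter> h -` fst c')"
  have "open (h -` fst c')"
    using cont c(2) by (auto simp: is_chart_def intro: open_vimage)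
  then have S: "open ?S" "snd c x \<in> ?S"
    using open_chart_image[OF c(1)] x by auto
  have eq: "(coord_rep c' c'' k \<circ> coord_rep c c' h) y = coord_rep c c'' (k \<circ> h) y" if "y \<in> ?S" for y
    using that inj by (auto simp: coord_rep_def inv_into_f_f)
  have hx: "coord_rep c c' h (snd c x) = snd c' (h x)"
    using x inj by (simp add: coord_rep_def inv_into_f_f)
  have "frechet_derivative (coord_rep c c'' (k \<circ> h)) (at (snd c x))
      = frechet_derivative (coord_rep c' c'' k \<circ> coord_rep c c' h) (at (snd c x))"
    using frechet_derivative_transform_within_open[OF _ S, of "coord_rep c' c'' k \<circ> coord_rep c c' h"]
      eq d hx by (metis differentiable_chain_at)
  also have "\<dots> = frechet_derivative (coord_rep c' c'' k) (at (snd c' (h x)))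
      \<circ> frechet_derivative (coord_rep c c' h) (at (snd c x))"
    using frechet_derivative_compose[OF d(1)] d(2) hx by metis
  finally show ?thesis
    by (simp add: coord_diff_def)
qed

lemma transition_differentiable:
  assumes "smooth_atlas A" "c \<in> charts_at A x" "c' \<in> charts_at A x"
  shows "coord_rep c c' id differentiable (at (snd c x))"
proof -
  have mem: "c \<in> A" "c' \<in> A" "snd c x \<in> snd c ` (fst c \<inter> fst c')"
    using assms(2,3) by (auto simp: charts_at_def)
  have "Ck_on (Suc 0) (snd c ` (fst c \<inter> fst c')) (coord_rep c c' id)"
    using assms(1) mem(1,2) unfolding smooth_atlas_def smooth_on_def by blast
  then show ?thesis
    using mem(3) unfolding Ck_on.simps by blast
qed

lemma Ck_map_differentiable:
  assumes "Ck_map (Suc n) A h" "c \<in> charts_at A x" "c' \<in> charts_at A (h x)"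
  shows "coord_rep c c' h differentiable (at (snd c x))"
  using assms by (auto simp: Ck_map_def charts_at_def)

lemma subspace_tangent_space:
  assumes "smooth_atlas A"
  shows "subspace (tangent_space A x)"
proof -
  have "linear (coord_diff c c' id x)" if "c \<in> charts_at A x" "c' \<in> charts_at A x" for c c'
    unfolding coord_diff_def
    by (intro linear_frechet_derivative transition_differentiable[OF assms that])
  note lin = linear_0[OF this] linear_add[OF this] linear_cmul[OF this]
  show ?thesis
  proof (rule subspaceI)
    show "0 \<in> tangent_space A x"
      unfolding tangent_space_def using lin by auto
  next
    fix v w assume vw: "v \<in> tangent_space A x" "w \<in> tangent_space A x"
    have "coord_diff c c' id x (v c + w c) = v c' + w c'"
      if c: "c \<in> charts_at A x" "c' \<in> charts_at A x" for c c'
    proof -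
      have "v c' = coord_diff c c' id x (v c)" "w c' = coord_diff c c' id x (w c)"
        using vw c unfolding tangent_space_def by blast+
      then show ?thesis by (simp only: lin(2)[OF c])
    qed
    then show "v + w \<in> tangent_space A x"
      using vw unfolding tangent_space_def mem_Collect_eq plus_fun_apply by (metis add.right_neutral)
  next
    fix r v assume v: "v \<in> tangent_space A x"
    have "coord_diff c c' id x (r *\<^sub>R v c) = r *\<^sub>R v c'"
      if c: "c \<in> charts_at A x" "c' \<in> charts_at A x" for c c'
    proof -
      have "v c' = coord_diff c c' id x (v c)"
        using v c unfolding tangent_space_def by blast
      then show ?thesis by (simp only: lin(3)[OF c])
    qed
    then show "r *\<^sub>R v \<in> tangent_space A x"
      using v unfolding tangent_space_def mem_Collect_eq scaleR_fun_def by (metis scaleR_zero_right)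
  qed
qed

lemma tangent_of_in_tangent_space:
  assumes A: "smooth_atlas A" and c: "c \<in> charts_at A x"
  shows "tangent_of A c x a \<in> tangent_space A x" "tangent_of A c x a c = a"
proof -
  have ch: "is_chart d" "x \<in> fst d" if "d \<in> charts_at A x" for d
    using A that by (auto simp: smooth_atlas_def charts_at_def)
  have key: "coord_diff c c'' id x a = coord_diff c' c'' id x (coord_diff c c' id x a)"
    if "c' \<in> charts_at A x" "c'' \<in> charts_at A x" for c' c''
    using coord_diff_comp[of c c' x id c'' id] ch[OF c] ch[OF that(1)] c that
      transition_differentiable[OF A] by (simp add: continuous_on_id)
  show "tangent_of A c x a \<in> tangent_space A x"
    unfolding tangent_space_def tangent_of_def
    by (intro CollectI conjI allI ballI impI) (simp, metis key)
  have "open (snd c ` fst c)" "inj_on (snd c) (fst c)"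
    using ch[OF c] by (auto simp: is_chart_def homeomorphism_def intro: inj_on_inverseI)
  then have "frechet_derivative (coord_rep c c id) (at (snd c x)) = frechet_derivative id (at (snd c x))"
    using ch[OF c]
    by (intro frechet_derivative_transform_within_open[of id, symmetric])
      (auto simp: coord_rep_def inv_into_f_f id_def)
  then show "tangent_of A c x a c = a"
    using c by (simp add: tangent_of_def coord_diff_def)
qed

lemma tangent_map_chart:
  assumes A: "smooth_atlas A" and h: "Ck_map (Suc n) A h" and v: "v \<in> tangent_space A x"
    and c: "c \<in> charts_at A x" "c' \<in> charts_at A (h x)"
  shows "tangent_map A h x v c' = coord_diff c c' h x (v c)"
proof -
  define d where "d = (SOME c. c \<in> charts_at A x)"
  have d: "d \<in> charts_at A x"
    unfolding d_def using c(1) by (rule someI)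
  have "is_chart c" "is_chart d" "x \<in> fst c" "x \<in> fst d"
    using A c d by (auto simp: smooth_atlas_def charts_at_def)
  then have "coord_diff c c' (h \<circ> id) x = coord_diff d c' h (id x) \<circ> coord_diff c d id x"
    using c d transition_differentiable[OF A] Ck_map_differentiable[OF h]
    by (intro coord_diff_comp) (auto simp: continuous_on_id)
  moreover have "v d = coord_diff c d id x (v c)"
    using v c d unfolding tangent_space_def by blast
  moreover have "tangent_map A h x v c' = coord_diff d c' h x (v d)"
    using c(2) by (simp add: tangent_map_def Let_def d_def)
  ultimately show ?thesis by simp
qed

lemma tangent_map_in_tangent_space:
  assumes A: "smooth_atlas A" and h: "Ck_map (Suc n) A h" and v: "v \<in> tangent_space A x"
  shows "tangent_map A h x v \<in> tangent_space A (h x)"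
proof -
  obtain c where c: "c \<in> charts_at A x"
    using A unfolding smooth_atlas_def charts_at_def by blast
  have ch: "is_chart c'" if "c' \<in> A" for c'
    using A that by (auto simp: smooth_atlas_def)
  have key: "coord_diff c c'' h x (v c) = coord_diff c' c'' id (h x) (coord_diff c c' h x (v c))"
    if "c' \<in> charts_at A (h x)" "c'' \<in> charts_at A (h x)" for c' c''
  proof -
    have "coord_diff c c'' (id \<circ> h) x = coord_diff c' c'' id (h x) \<circ> coord_diff c c' h x"
      using c that ch transition_differentiable[OF A] Ck_map_differentiable[OF h] h
      by (intro coord_diff_comp) (auto simp: charts_at_def Ck_map_def)
    then show ?thesis by simp
  qed
  have "tangent_map A h x v c' = 0" if "c' \<notin> charts_at A (h x)" for c'
    using that by (simp add: tangent_map_def)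
  moreover have "tangent_map A h x v c'' = coord_diff c' c'' id (h x) (tangent_map A h x v c')"
    if "c' \<in> charts_at A (h x)" "c'' \<in> charts_at A (h x)" for c' c''
    unfolding tangent_map_chart[OF A h v c that(1)] tangent_map_chart[OF A h v c that(2)]
    by (rule key[OF that])
  ultimately show ?thesis
    unfolding tangent_space_def by blast
qed

end

theory Submission
  imports Defs
begin

text \<open>The proof separates the measure from the hyperbolicity.

Fix a finite cover \<open>\<U>\<close> of \<open>M\<close> by open sets and call \<open>z\<^sub>0, z\<^sub>1, \<dots>\<close> a chain over \<open>\<omega>\<close> if
the fibre map over \<open>\<theta>\<^sup>i \<omega>\<close> sends \<open>z\<^sub>i\<close> into a member of \<open>\<U>\<close> that also contains \<open>z\<^bsub>i+1\<^esub>\<close>. The set of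
points reached by chains of length \<open>n > 0\<close> from a given point is a union of members of \<open>\<U>\<close>, so
only finitely many such sets occur. Passing to the next step does not decrease the measure, because the maps preserve \<open>\<nu>\<close> and the members of \<open>\<U>\<close>
meeting a set cover it. If the measure stays the same, then, \<open>\<nu>\<close> having full support, the new set
is the closure of the image of the old one, hence open and closed, hence all of \<open>M\<close>. So after a
number of steps bounded by the number of possible measures, every point is reached: this number
depends neither on \<open>\<omega>\<close> nor on the starting point (lemma \<open>chain_mixing\<close>).

It remains to replace a chain by a true orbit close to it. In charts around the points of the
chain, the maps are small perturbations of linear maps that respect the splitting into expanded and
contracted directions, and the adapted norms grow and shrink by a fixed factor in a single step. An
orbit close to the chain is a fixed point of a contraction on sequences of coordinate
vectors (lemma \<open>hyperbolic_shadowing\<close>).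

The estimates for a single step hold near every point of the graph
\<open>{((x, \<omega>), f\<^sub>\<omega> x)}\<close>: at the point itself they are the hypotheses on the derivative, and
they persist because the splitting, the metric and the derivative are continuous (lemma
\<open>local_good_step\<close>). The graph is compact, so finitely many such neighbourhoods suffice, and a cover
\<open>\<U>\<close> fine enough puts every step of every chain into one of them (lemma \<open>uniform_good\<close>). Then chains
between points of two open sets \<open>U\<close> and \<open>V\<close> are shadowed by orbits from \<open>U\<close> to \<open>V\<close>.\<close>

section \<open>Shadowing for sequences of hyperbolic maps\<close>

text \<open>The norms are box norms with respect to the splitting given by the projection \<open>P\<close>. Then the
expanding and the contracting part of a vector can be estimated separately, without a loss by a
constant that would destroy a contraction factor close to \<open>1\<close>.\<close>

definition adapted_norm :: "('e::real_normed_vector \<Rightarrow> real) \<Rightarrow> ('e \<Rightarrow> 'e) \<Rightarrow> bool" where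
  "adapted_norm M P \<longleftrightarrow> bounded_linear P \<and> (\<forall>d. P (P d) = P d) \<and>
     (\<forall>a b. M (a + b) \<le> M a + M b) \<and> (\<forall>d. M d = max (M (P d)) (M (d - P d)))"

text \<open>Think of \<open>R\<close> as the inverse of a linear map close to \<open>h\<close>: up to an error, \<open>h\<close> contracts along the
kernel of \<open>P\<close>, and \<open>R\<close> contracts along the range of \<open>P\<close>. At the cost of a slightly larger \<open>\<kappa>\<close> all
conditions survive a small change of the splittings; they are the estimates under which the
iteration in \<open>hyperbolic_shadowing\<close> contracts. The last one makes its fixed points orbits: the range of
\<open>P'\<close> is transversal to the kernel of \<open>P \<circ> R\<close>. A single parameter \<open>r\<close> serves as the radius of the domain
and as the inverse of all constants, so that making it smaller weakens the notion.\<close>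

definition hyperbolic_step :: "real \<Rightarrow> real \<Rightarrow> ('e::real_normed_vector \<Rightarrow> real) \<Rightarrow> ('e \<Rightarrow> 'e) \<Rightarrow>
   ('e \<Rightarrow> real) \<Rightarrow> ('e \<Rightarrow> 'e) \<Rightarrow> ('e \<Rightarrow> 'e) \<Rightarrow> ('e \<Rightarrow> 'e) \<Rightarrow> bool" where
  "hyperbolic_step \<kappa> r M P M' P' R h \<longleftrightarrow>
     bounded_linear R \<and> (\<forall>d. r * norm d \<le> M d) \<and>
     (\<forall>d. M (P (R d)) \<le> norm d / r) \<and> (\<forall>d. M' (d - P' d) \<le> norm d / r) \<and>
     (\<forall>a\<in>cball 0 r. \<forall>b\<in>cball 0 r. norm (h a - h b) \<le> norm (a - b) / r) \<and>
     (\<forall>a\<in>cball 0 r. \<forall>b\<in>cball 0 r. M' ((h a - h b) - P' (h a - h b)) \<le> \<kappa> * M (a - b)) \<and>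
     (\<forall>a\<in>cball 0 r. \<forall>b\<in>cball 0 r. \<forall>w.
        M (P (a - b + R (w - (h a - h b)))) \<le> \<kappa> * max (M' w) (M (a - b))) \<and>
     (\<forall>w. P (R w) = 0 \<longrightarrow> P' w = w \<longrightarrow> w = 0)"

lemma hyperbolic_stepD:
  assumes H: "hyperbolic_step \<kappa> r M P M' P' R h"
  shows "bounded_linear R"
    and "r * norm d \<le> M d"
    and "M (P (R d)) \<le> norm d / r"
    and "M' (d - P' d) \<le> norm d / r"
    and "a \<in> cball 0 r \<Longrightarrow> b \<in> cball 0 r \<Longrightarrow> norm (h a - h b) \<le> norm (a - b) / r"
    and "a \<in> cball 0 r \<Longrightarrow> b \<in> cball 0 r \<Longrightarrow>
       M' ((h a - h b) - P' (h a - h b)) \<le> \<kappa> * M (a - b)"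
    and "a \<in> cball 0 r \<Longrightarrow> b \<in> cball 0 r \<Longrightarrow>
       M (P (a - b + R (w - (h a - h b)))) \<le> \<kappa> * max (M' w) (M (a - b))"
    and "P (R w) = 0 \<Longrightarrow> P' w = w \<Longrightarrow> w = 0"
proof -
  note H0 = H[unfolded hyperbolic_step_def]
  note H1 = H0[THEN conjunct2]
  note H2 = H1[THEN conjunct2]
  note H3 = H2[THEN conjunct2]
  note H4 = H3[THEN conjunct2]
  note H5 = H4[THEN conjunct2]
  note H6 = H5[THEN conjunct2]
  note H7 = H6[THEN conjunct2]
  show "bounded_linear R" using H0 by (rule conjunct1)
  show "r * norm d \<le> M d" by (rule H1[THEN conjunct1, rule_format])
  show "M (P (R d)) \<le> norm d / r" by (rule H2[THEN conjunct1, rule_format])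
  show "M' (d - P' d) \<le> norm d / r" by (rule H3[THEN conjunct1, rule_format])
  show "a \<in> cball 0 r \<Longrightarrow> b \<in> cball 0 r \<Longrightarrow> norm (h a - h b) \<le> norm (a - b) / r"
    by (rule H4[THEN conjunct1, rule_format])
  show "a \<in> cball 0 r \<Longrightarrow> b \<in> cball 0 r \<Longrightarrow>
       M' ((h a - h b) - P' (h a - h b)) \<le> \<kappa> * M (a - b)"
    by (rule H5[THEN conjunct1, rule_format])
  show "a \<in> cball 0 r \<Longrightarrow> b \<in> cball 0 r \<Longrightarrow>
       M (P (a - b + R (w - (h a - h b)))) \<le> \<kappa> * max (M' w) (M (a - b))"
    by (rule H6[THEN conjunct1, rule_format])
  show "P (R w) = 0 \<Longrightarrow> P' w = w \<Longrightarrow> w = 0" by (rule H7[rule_format])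
qed

lemma hyperbolic_step_mono:
  fixes h :: "'e::real_normed_vector \<Rightarrow> 'e"
  assumes H: "hyperbolic_step \<kappa> r M P M' P' R h" and r: "0 < r'" "r' \<le> r"
  shows "hyperbolic_step \<kappa> r' M P M' P' R h"
proof -
  note D = hyperbolic_stepD[OF H]
  have b: "a \<in> cball 0 r" if "a \<in> cball 0 r'" for a :: 'e using that r by simp
  have q: "norm d / r \<le> norm d / r'" for d :: 'e using r by (intro divide_left_mono) auto
  show ?thesis
    unfolding hyperbolic_step_def
  proof (intro conjI allI ballI impI)
    show "bounded_linear R" by (rule D(1))
    show "r' * norm d \<le> M d" for d
      using D(2)[of d] mult_right_mono[OF r(2) norm_ge_zero[of d]] by linarith
    show "M (P (R d)) \<le> norm d / r'" for d using D(3)[of d] q[of d] by linarith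
    show "M' (d - P' d) \<le> norm d / r'" for d using D(4)[of d] q[of d] by linarith
    show "w = 0" if "P (R w) = 0" "P' w = w" for w by (rule D(8)[OF that])
    fix a b :: 'e assume ab: "a \<in> cball 0 r'" "b \<in> cball 0 r'"
    show "norm (h a - h b) \<le> norm (a - b) / r'"
      using D(5)[OF b b, OF ab] q[of "a - b"] by linarith
    show "M' ((h a - h b) - P' (h a - h b)) \<le> \<kappa> * M (a - b)"
      by (rule D(6)[OF b b, OF ab])
    show "M (P (a - b + R (w - (h a - h b)))) \<le> \<kappa> * max (M' w) (M (a - b))" for w
      by (rule D(7)[OF b b, OF ab])
  qed
qed

text \<open>A Newton-like iteration finds an orbit of the maps \<open>h\<^sub>i\<close>. A sequence \<open>v\<close> is changed to a sequence
whose stable component at \<open>i\<close> is that of the image of the preceding vector, and whose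
unstable component is corrected by pulling back the error \<open>v - h v\<close> at the next index. Both changes
are contractions in the adapted norms, uniformly in \<open>i\<close>, and a fixed point is an orbit by the
transversality condition. The iterates converge at each index, since the increments decay
geometrically in the adapted norms and these bound the given norm from above.\<close>

lemma hyperbolic_shadowing:
  fixes h :: "nat \<Rightarrow> 'e::banach \<Rightarrow> 'e"
  assumes ad: "\<And>i. adapted_norm (M i) (P i)"
    and st: "\<And>i. hyperbolic_step \<kappa> r (M i) (P i) (M (Suc i)) (P (Suc i)) (R i) (h i)"
    and k: "0 < \<kappa>" "\<kappa> < 1" and r: "0 < r" and rho: "0 < \<rho>" "\<rho> \<le> r * r"
    and h0: "\<And>i. norm (h i 0) \<le> (1 - \<kappa>) * \<rho> * r"
  shows "\<exists>v. \<forall>i. norm (v i) \<le> \<rho> / r \<and> v (Suc i) = h i (v i)"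
proof -
  have blP: "bounded_linear (P i)" and PP: "P i (P i d) = P i d" and sub: "M i (a + b) \<le> M i a + M i b"
    and mx: "M i d = max (M i (P i d)) (M i (d - P i d))" for i d a b
    using ad[of i] unfolding adapted_norm_def by blast+
  have blR: "bounded_linear (R i)" and lo: "r * norm d \<le> M i d"
    and PR: "M i (P i (R i d)) \<le> norm d / r"
    and Q: "M (Suc i) (d - P (Suc i) d) \<le> norm d / r"
    and lip: "a \<in> cball 0 r \<Longrightarrow> b \<in> cball 0 r \<Longrightarrow> norm (h i a - h i b) \<le> norm (a - b) / r"
    and e1: "a \<in> cball 0 r \<Longrightarrow> b \<in> cball 0 r \<Longrightarrow>
       M (Suc i) ((h i a - h i b) - P (Suc i) (h i a - h i b)) \<le> \<kappa> * M i (a - b)"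
    and e2: "a \<in> cball 0 r \<Longrightarrow> b \<in> cball 0 r \<Longrightarrow>
       M i (P i (a - b + R i (w - (h i a - h i b)))) \<le> \<kappa> * max (M (Suc i) w) (M i (a - b))"
    and e4: "P i (R i w) = 0 \<Longrightarrow> P (Suc i) w = w \<Longrightarrow> w = 0" for i d a b w
    by (fact hyperbolic_stepD[OF st])+
  have linP: "P i (a + b) = P i a + P i b" "P i (a - b) = P i a - P i b" "P i 0 = 0" for i a b
    using blP[of i] by (simp_all add: bounded_linear.linear linear_add linear_diff linear_0)
  have linR: "R i (a + b) = R i a + R i b" "R i (a - b) = R i a - R i b" "R i 0 = 0" for i a b
    using blR[of i] by (simp_all add: bounded_linear.linear linear_add linear_diff linear_0)
  have nn: "0 \<le> M i d" for i d
    using lo[where i = i and d = d] mult_nonneg_nonneg[OF less_imp_le[OF r] norm_ge_zero[of d]] by linarith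
  have M0: "M i 0 = 0" for i
  proof -
    have "M (Suc j) 0 = 0" for j using Q[of j 0] nn[of "Suc j" 0] linP(3) by simp
    moreover have "M 0 0 = 0" using PR[of 0 0] nn[of 0 0] linP(3) linR(3) by simp
    ultimately show ?thesis by (cases i) auto
  qed
  \<comment> \<open>The unstable correction \<open>Y\<close> and the stable component \<open>X\<close> of the iteration. At index \<open>0\<close> there is
     no preceding vector, and the stable component is put to \<open>0\<close>.\<close>
  define Y where "Y v i = v i + R i (v (Suc i) - h i (v i))" for v i
  define X where "X v i = (if i = 0 then 0 else h (i - 1) (v (i - 1)) - P i (h (i - 1) (v (i - 1))))"
    for v and i :: nat
  define T where "T v i = X v i + P i (Y v i)" for v i
  have PX: "P i (X v i) = 0" for v i
    by (simp add: X_def linP PP)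
  have split: "M i (T v i - T v' i) = max (M i (P i (Y v i - Y v' i))) (M i (X v i - X v' i))" for v v' i
    using mx[of i "T v i - T v' i"] by (simp add: T_def linP PP PX)
  have ball: "a \<in> cball 0 r" if "M i a \<le> \<rho>" for a i
  proof -
    have "r * norm a \<le> r * r" using lo[of a i] that rho(2) by linarith
    then show ?thesis using r by simp
  qed
  have contr: "M i (T v i - T v' i) \<le> \<kappa> * t"
    if v: "\<And>i. M i (v i) \<le> \<rho>" "\<And>i. M i (v' i) \<le> \<rho>" "\<And>i. M i (v i - v' i) \<le> t" for v v' t i
  proof -
    note b = ball[OF v(1)] ball[OF v(2)]
    have Yd: "Y v i - Y v' i = (v i - v' i) + R i ((v (Suc i) - v' (Suc i)) - (h i (v i) - h i (v' i)))"
      by (simp add: Y_def linR)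
    have "M i (P i (Y v i - Y v' i)) \<le> \<kappa> * max (M (Suc i) (v (Suc i) - v' (Suc i))) (M i (v i - v' i))"
      unfolding Yd by (rule e2[OF b])
    also have "\<dots> \<le> \<kappa> * t" using v(3) k by (intro mult_left_mono) auto
    finally have 1: "M i (P i (Y v i - Y v' i)) \<le> \<kappa> * t" .
    have 2: "M i (X v i - X v' i) \<le> \<kappa> * t"
    proof (cases i)
      case 0
      have "0 \<le> t" using nn v(3) order_trans by blast
      then show ?thesis using 0 k by (simp add: X_def M0)
    next
      case (Suc j)
      have "X v i - X v' i = (h j (v j) - h j (v' j)) - P (Suc j) (h j (v j) - h j (v' j))"
        by (simp add: X_def Suc linP)
      then have "M i (X v i - X v' i) \<le> \<kappa> * M j (v j - v' j)"
        using e1[OF b(1)[of j] b(2)[of j]] Suc by simp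
      also have "\<dots> \<le> \<kappa> * t" using v(3) k by (intro mult_left_mono) auto
      finally show ?thesis .
    qed
    show ?thesis using 1 2 split by simp
  qed
  have T0: "M i (T (\<lambda>_. 0) i) \<le> (1 - \<kappa>) * \<rho>" for i
  proof -
    have s: "norm (h i 0) / r \<le> (1 - \<kappa>) * \<rho>" for i
      using h0[of i] r by (simp add: pos_divide_le_eq)
    have P1: "M i (P i (Y (\<lambda>_. 0) i)) \<le> (1 - \<kappa>) * \<rho>"
      using PR[of i "- h i 0"] s[of i] by (simp add: Y_def)
    have X1: "M i (X (\<lambda>_. 0) i) \<le> (1 - \<kappa>) * \<rho>"
    proof (cases i)
      case 0
      then show ?thesis using k rho by (simp add: X_def M0)
    next
      case (Suc j)
      then show ?thesis using Q[of j "h j 0"] s[of j] by (simp add: X_def)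
    qed
    show ?thesis
      using mx[of i "T (\<lambda>_. 0) i"] P1 X1 by (simp add: T_def linP PP PX)
  qed
  have inv: "M i (T v i) \<le> \<rho>" if v: "\<And>i. M i (v i) \<le> \<rho>" for v i
  proof -
    have "M i (T v i) = M i ((T v i - T (\<lambda>_. 0) i) + T (\<lambda>_. 0) i)" by simp
    also have "\<dots> \<le> M i (T v i - T (\<lambda>_. 0) i) + M i (T (\<lambda>_. 0) i)" by (rule sub)
    also have "\<dots> \<le> \<kappa> * \<rho> + (1 - \<kappa>) * \<rho>"
      using contr[OF v, of "\<lambda>_. 0" \<rho> i] T0[of i] v rho M0 by (intro add_mono) auto
    finally show ?thesis by (simp add: algebra_simps)
  qed
  define V where "V n = (T ^^ n) (\<lambda>_. 0)" for n
  have V0: "V 0 = (\<lambda>_. 0)" and VS: "V (Suc n) = T (V n)" for n by (simp_all add: V_def)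
  have Vb: "M i (V n i) \<le> \<rho>" for n i
  proof (induction n arbitrary: i)
    case 0
    show ?case using M0 rho(1) by (simp add: V0)
  next
    case (Suc n)
    show ?case unfolding VS by (rule inv[OF Suc])
  qed
  have Vd: "M i (V (Suc n) i - V n i) \<le> \<kappa> ^ n * \<rho>" for n i
  proof (induction n arbitrary: i)
    case 0
    show ?case using Vb[of i 1] by (simp add: V0)
  next
    case (Suc n)
    show ?case using contr[OF Vb Vb Suc, of i] by (simp only: VS power_Suc mult.assoc)
  qed
  have "\<exists>l. (\<lambda>n. V n i) \<longlonglongrightarrow> l" for i
  proof -
    have b: "norm (V (Suc n) i - V n i) \<le> \<rho> / r * \<kappa> ^ n" for n
      using lo[of "V (Suc n) i - V n i" i] Vd[of i n] r by (simp add: field_simps)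
    have "summable (\<lambda>n. \<rho> / r * \<kappa> ^ n)"
      using k by (intro summable_mult summable_geometric) auto
    then have "summable (\<lambda>n. V (Suc n) i - V n i)"
      by (rule summable_comparison_test'[where N = 0]) (rule b)
    then have "(\<lambda>n. \<Sum>j<n. V (Suc j) i - V j i) \<longlonglongrightarrow> suminf (\<lambda>n. V (Suc n) i - V n i)"
      by (rule summable_LIMSEQ)
    then show ?thesis
      unfolding sum_lessThan_telescope[of "\<lambda>n. V n i"] V0 by auto
  qed
  then obtain v where v: "\<And>i. (\<lambda>n. V n i) \<longlonglongrightarrow> v i" by metis
  have vb: "norm (v i) \<le> \<rho> / r" for i
  proof (rule LIMSEQ_le_const2[OF tendsto_norm[OF v]])
    show "\<exists>N. \<forall>n\<ge>N. norm (V n i) \<le> \<rho> / r"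
    proof (intro exI allI impI)
      fix n show "norm (V n i) \<le> \<rho> / r"
        using lo[of "V n i" i] Vb[of i n] r by (simp add: pos_le_divide_eq mult.commute)
    qed
  qed
  have vc: "v i \<in> cball 0 r" for i
  proof -
    have "\<rho> / r \<le> r" using rho r by (simp add: pos_divide_le_eq)
    then show ?thesis using vb[of i] by simp
  qed
  have hl: "(\<lambda>n. h i (V n i)) \<longlonglongrightarrow> h i (v i)" for i
  proof (rule Lim_transform_bound[where g = "\<lambda>n. norm (V n i - v i) / r", THEN LIM_zero_cancel])
    show "\<forall>\<^sub>F n in sequentially. norm (h i (V n i) - h i (v i)) \<le> norm (norm (V n i - v i) / r)"
      using lip[OF ball[OF Vb] vc] r by simp
    show "(\<lambda>n. norm (V n i - v i) / r) \<longlonglongrightarrow> 0"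
      by (intro tendsto_divide_zero tendsto_norm_zero LIM_zero v)
  qed
  have Tl: "(\<lambda>n. T (V n) i) \<longlonglongrightarrow> T v i" for i
  proof -
    have "(\<lambda>n. P i (Y (V n) i)) \<longlonglongrightarrow> P i (Y v i)"
      unfolding Y_def
      by (intro bounded_linear.tendsto[OF blP] bounded_linear.tendsto[OF blR] tendsto_intros v hl)
    moreover have "(\<lambda>n. X (V n) i) \<longlonglongrightarrow> X v i"
      unfolding X_def
      by (cases i) (auto intro!: bounded_linear.tendsto[OF blP] tendsto_intros v hl)
    ultimately show ?thesis unfolding T_def by (rule tendsto_add[rotated])
  qed
  have fixp: "T v i = v i" for i
    using LIMSEQ_unique[OF Tl] LIMSEQ_Suc[OF v[of i]] by (simp add: VS)
  have Pv: "P i (v i) = P i (Y v i)" for i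
    using arg_cong[OF fixp[of i], of "P i"] by (simp add: T_def linP PP PX)
  have "v (Suc i) = h i (v i)" for i
  proof -
    define w where "w = v (Suc i) - h i (v i)"
    have 1: "P i (R i w) = 0" using Pv[of i] by (simp add: Y_def linP w_def)
    have "v (Suc i) - P (Suc i) (v (Suc i)) = X v (Suc i)"
      using fixp[of "Suc i"] by (simp only: T_def Pv) (simp add: algebra_simps)
    then have "P (Suc i) w = w"
      by (simp add: X_def w_def linP algebra_simps)
    then show ?thesis using e4[OF 1] by (simp add: w_def)
  qed
  then show ?thesis using vb by blast
qed

section \<open>Stability of hyperbolicity under perturbation\<close>

definition even_subadditive :: "('e::real_normed_vector \<Rightarrow> real) \<Rightarrow> bool" where
  "even_subadditive N \<longleftrightarrow> N 0 = 0 \<and> (\<forall>a b. N (a + b) \<le> N a + N b) \<and> (\<forall>a. N (- a) = N a)"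

definition split_norm :: "('e::real_normed_vector \<Rightarrow> real) \<Rightarrow> ('e \<Rightarrow> 'e) \<Rightarrow> 'e \<Rightarrow> real" where
  "split_norm N P d = max (N (P d)) (N (d - P d))"

lemma adapted_split_norm:
  assumes N: "even_subadditive N" and P: "bounded_linear P" "\<And>d. P (P d) = P d"
  shows "adapted_norm (split_norm N P) P"
proof -
  have lin: "P (a + b) = P a + P b" "P (- a) = - P a" "P (a - b) = P a - P b" "P 0 = 0" for a b
    using P(1) by (simp_all add: bounded_linear.linear linear_add linear_diff linear_0 linear_neg)
  have N0: "N 0 = 0" and sub: "N (a + b) \<le> N a + N b" and neg: "N (- a) = N a" for a b
    using N by (auto simp: even_subadditive_def)
  have nn: "0 \<le> N a" for a using sub[of a "- a"] neg[of a] N0 by simp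
  have "split_norm N P (a + b) \<le> split_norm N P a + split_norm N P b" for a b
  proof -
    have "N (P (a + b)) \<le> N (P a) + N (P b)" using sub lin by simp
    moreover have "N (a + b - P (a + b)) \<le> N (a - P a) + N (b - P b)"
      using sub[of "a - P a" "b - P b"] lin by (simp add: algebra_simps)
    ultimately show ?thesis unfolding split_norm_def by linarith
  qed
  moreover have "split_norm N P d = max (split_norm N P (P d)) (split_norm N P (d - P d))" for d
    using nn[of "P d"] nn[of "d - P d"] by (simp add: split_norm_def lin P(2) N0)
  ultimately show ?thesis
    unfolding adapted_norm_def using P by blast
qed

text \<open>All errors below are bounded in this way: norms and vectors are both perturbed by a relative
amount \<open>\<eta>\<close>, and the value changes by a multiple of \<open>\<eta>\<close> that depends on the bounds \<open>B\<close> and \<open>C\<close> only.\<close>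

lemma even_subadditive_perturb:
  fixes N N0 :: "'e::real_normed_vector \<Rightarrow> real"
  assumes N: "even_subadditive N" and near: "\<And>d. \<bar>N d - N0 d\<bar> \<le> \<eta> * norm d"
    and N0: "\<And>d. N0 d \<le> B * norm d" and B: "1 \<le> B" and e: "0 \<le> \<eta>" "\<eta> \<le> 1" and C: "0 \<le> C" "0 \<le> t"
    and u: "norm (u - u0) \<le> \<eta> * C * t" "norm u0 \<le> C * t"
  shows "\<bar>N u - N0 u0\<bar> \<le> 3 * B * C * \<eta> * t"
proof -
  have sub: "N (a + b) \<le> N a + N b" and neg: "N (- a) = N a" for a b
    using N by (auto simp: even_subadditive_def)
  have up: "N d \<le> (B + 1) * norm d" for d
  proof -
    have "\<eta> * norm d \<le> 1 * norm d" using e by (intro mult_right_mono) auto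
    then show ?thesis using near[of d] N0[of d] by (simp add: algebra_simps)
  qed
  have 1: "\<bar>N u - N u0\<bar> \<le> N (u - u0)"
    using sub[of "u - u0" u0] sub[of "u0 - u" u] neg[of "u - u0"] by simp
  have "N (u - u0) \<le> (B + 1) * (\<eta> * C * t)"
    using up[of "u - u0"] mult_left_mono[OF u(1), of "B + 1"] B by (auto intro: order_trans)
  moreover have "\<eta> * norm u0 \<le> \<eta> * (C * t)" using u(2) e by (intro mult_left_mono) auto
  moreover have "(B + 1) * (\<eta> * C * t) + \<eta> * (C * t) \<le> 3 * B * C * \<eta> * t"
  proof -
    have "0 \<le> (2 * B - 2) * (\<eta> * C * t)" using B e C by simp
    then show ?thesis by (simp add: algebra_simps)
  qed
  ultimately show ?thesis using 1 near[of u0] by linarith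
qed

text \<open>If the splittings at source and target correspond under the linear map \<open>D\<close>, then \<open>D\<close> is hyperbolic
with factor \<open>\<mu>\<close> for the norms \<open>N0\<close>, \<open>N0'\<close>. Projections, norms and the map may be moved by a small
relative amount at the cost of the slightly larger factor \<open>\<kappa>\<close>. The inverse \<open>R\<close> of the
unperturbed map serves for all perturbations, because \<open>P \<circ> R\<close> and \<open>R \<circ> P'\<close> still agree up to a small
relative error.\<close>

lemma hyperbolic_step_perturb:
  fixes D R P0 P0' :: "'e::real_normed_vector \<Rightarrow> 'e"
  assumes lin: "bounded_linear D" "bounded_linear R" "bounded_linear P0" "bounded_linear P0'"
    and RD: "\<And>d. R (D d) = d" "\<And>d. D (R d) = d" and comm: "\<And>d. P0' (D d) = D (P0 d)"
    and m: "0 < m" "m \<le> 1" and lo: "\<And>d. m * norm d \<le> N0 d" "\<And>d. m * norm d \<le> N0' d"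
    and up: "\<And>d. N0 d \<le> b * norm d" "\<And>d. N0' d \<le> b * norm d"
    and contr: "\<And>d. N0' (D (d - P0 d)) \<le> \<mu> * N0 (d - P0 d)"
    and expan: "\<And>w. N0 (R (P0' w)) \<le> \<mu> * N0' (P0' w)"
    and k: "0 < \<mu>" "\<mu> < \<kappa>" "\<kappa> < 1"
  obtains \<eta> where "0 < \<eta>" "\<And>P P' N N' h r. 
     \<lbrakk>bounded_linear P; \<And>d. P (P d) = P d; bounded_linear P'; \<And>d. P' (P' d) = P' d;
      even_subadditive N; even_subadditive N';
      \<And>d. norm (P d - P0 d) \<le> \<eta> * norm d; \<And>d. norm (P' d - P0' d) \<le> \<eta> * norm d;
      \<And>d. \<bar>N d - N0 d\<bar> \<le> \<eta> * norm d; \<And>d. \<bar>N' d - N0' d\<bar> \<le> \<eta> * norm d;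
      0 < r; r \<le> \<eta>;
      \<And>a b. a \<in> cball 0 r \<Longrightarrow> b \<in> cball 0 r \<Longrightarrow> norm (h a - h b - D (a - b)) \<le> \<eta> * norm (a - b)\<rbrakk>
     \<Longrightarrow> hyperbolic_step \<kappa> r (split_norm N P) P (split_norm N' P') P' R h"
proof -
  obtain BD BR BP BP' where bd: "\<And>d. norm (D d) \<le> norm d * BD" "\<And>d. norm (R d) \<le> norm d * BR"
     "\<And>d. norm (P0 d) \<le> norm d * BP" "\<And>d. norm (P0' d) \<le> norm d * BP'"
    using lin[THEN bounded_linear.bounded] by metis
  define B where "B = Max {1, BD, BR, BP, BP', b}"
  have B1: "1 \<le> B" and Bs: "BD \<le> B" "BR \<le> B" "BP \<le> B" "BP' \<le> B" "b \<le> B" by (simp_all add: B_def)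
  have B0: "0 \<le> B" using B1 by simp
  have bdB: "norm (X d) \<le> B * norm d" if "\<And>d. norm (X d) \<le> norm d * BX" "BX \<le> B" for X :: "'e \<Rightarrow> 'e" and BX d
    using that(1)[of d] mult_left_mono[OF that(2) norm_ge_zero[of d]] by (simp add: mult.commute)
  have nD: "norm (D d) \<le> B * norm d" and nR: "norm (R d) \<le> B * norm d"
    and nP: "norm (P0 d) \<le> B * norm d" and nP': "norm (P0' d) \<le> B * norm d" for d
    using bdB bd Bs by blast+
  have nN: "N0 d \<le> B * norm d" "N0' d \<le> B * norm d" for d
    using up[of d] mult_right_mono[OF Bs(5) norm_ge_zero[of d]] by linarith+
  have linD: "D (x + y) = D x + D y" "D (x - y) = D x - D y" "D 0 = 0"
   and linR: "R (x + y) = R x + R y" "R (x - y) = R x - R y" "R 0 = 0" for x y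
    using lin by (simp_all add: bounded_linear.linear linear_add linear_diff linear_0)
  have comm': "P0 (R w) = R (P0' w)" for w
    using comm[of "R w"] RD by metis
  \<comment> \<open>The errors below add up to at most \<open>18 * B ^ 3 * \<eta>\<close> times the norm, and the norm is at most
     \<open>4 / m\<close> times the box norm. This leaves a factor \<open>2\<close> to spare.\<close>
  define \<eta> where "\<eta> = m * (\<kappa> - \<mu>) / (144 * B ^ 3)"
  have B3: "1 \<le> B ^ 3" "B \<le> B ^ 3" "B\<^sup>2 \<le> B ^ 3" "B \<le> B\<^sup>2" "1 \<le> B\<^sup>2"
    using B1 power_increasing[of 1 3 B] power_increasing[of 2 3 B] power_increasing[of 1 2 B] by simp_all
  have e0: "0 < \<eta>" using m k B1 by (simp add: \<eta>_def)
  have eK: "\<eta> * (144 * B ^ 3) = m * (\<kappa> - \<mu>)" using B1 by (simp add: \<eta>_def)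
  have mk: "m * (\<kappa> - \<mu>) \<le> m" using m k mult_left_mono[of "\<kappa> - \<mu>" 1 m] by simp
  have eB: "\<eta> * (144 * B ^ 3) \<le> 1" using eK mk m by linarith
  have em: "\<eta> * 144 \<le> m"
    using eK mk B3(1) mult_left_mono[of 144 "144 * B ^ 3" \<eta>] e0 by auto
  have e1: "\<eta> \<le> 1" using em m by linarith
  show thesis
  proof (rule that[OF e0])
    fix P P' N N' h r
    assume P: "bounded_linear P" "\<And>d. P (P d) = P d" "bounded_linear P'" "\<And>d. P' (P' d) = P' d"
      and N: "even_subadditive N" "even_subadditive N'"
      and cP: "\<And>d. norm (P d - P0 d) \<le> \<eta> * norm d" and cP': "\<And>d. norm (P' d - P0' d) \<le> \<eta> * norm d"
      and cN: "\<And>d. \<bar>N d - N0 d\<bar> \<le> \<eta> * norm d" and cN': "\<And>d. \<bar>N' d - N0' d\<bar> \<le> \<eta> * norm d"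
      and r: "0 < r" "r \<le> \<eta>"
      and h: "\<And>a b. a \<in> cball 0 r \<Longrightarrow> b \<in> cball 0 r \<Longrightarrow> norm (h a - h b - D (a - b)) \<le> \<eta> * norm (a - b)"
    let ?M = "split_norm N P" and ?M' = "split_norm N' P'"
    have linP: "P (x + y) = P x + P y" "P (x - y) = P x - P y" "P 0 = 0"
     and linP': "P' (x + y) = P' x + P' y" "P' (x - y) = P' x - P' y" "P' 0 = 0" for x y
      using P by (simp_all add: bounded_linear.linear linear_add linear_diff linear_0)
    have Nz: "N 0 = 0" "N' 0 = 0" and subN: "N (x + y) \<le> N x + N y" "N' (x + y) \<le> N' x + N' y" for x y
      using N by (auto simp: even_subadditive_def)
    have ee: "\<eta> * norm d \<le> norm d" for d :: 'e
      using e1 mult_right_mono[of \<eta> 1 "norm d"] by simp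
    have nPP: "norm (P d) \<le> 2 * B * norm d" "norm (P' d) \<le> 2 * B * norm d" for d
    proof -
      have "norm d \<le> B * norm d" using B1 mult_right_mono[of 1 B "norm d"] by simp
      then show "norm (P d) \<le> 2 * B * norm d" "norm (P' d) \<le> 2 * B * norm d"
        using cP[of d] cP'[of d] nP[of d] nP'[of d] ee[of d]
          norm_triangle_sub[of "P d" "P0 d"] norm_triangle_sub[of "P' d" "P0' d"] by linarith+
    qed
    have nNN: "N d \<le> 2 * B * norm d" "N' d \<le> 2 * B * norm d" for d
    proof -
      have "norm d \<le> B * norm d" using B1 mult_right_mono[of 1 B "norm d"] by simp
      then show "N d \<le> 2 * B * norm d" "N' d \<le> 2 * B * norm d"
        using cN[of d] cN'[of d] nN[of d] ee[of d] by linarith+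
    qed
    have split_lo: "m / 4 * norm d \<le> split_norm X Y d" 
      if "\<And>x y. X (x + y) \<le> X x + X y" "\<And>d. \<bar>X d - X0 d\<bar> \<le> \<eta> * norm d" "\<And>d. m * norm d \<le> X0 d"
      for X X0 :: "'e \<Rightarrow> real" and Y and d
    proof -
      have "\<eta> * norm d \<le> m / 2 * norm d" using em e0 by (intro mult_right_mono) auto
      then have "m / 2 * norm d \<le> X d" using that(2)[of d] that(3)[of d] by linarith
      moreover have "X d \<le> X (Y d) + X (d - Y d)" using that(1)[of "Y d" "d - Y d"] by simp
      ultimately show ?thesis unfolding split_norm_def by (simp add: max_def)
    qed
    have lmB: "B * x \<le> B * y" "2 * B * x \<le> 2 * B * y" if "x \<le> y" for x y :: real
      using that B1 by (auto intro: mult_left_mono)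
    have lme: "\<eta> * x \<le> \<eta> * y" if "x \<le> y" for x y :: real
      using that e0 by (auto intro: mult_left_mono)
    have Mlo: "m / 4 * norm d \<le> ?M d" "m / 4 * norm d \<le> ?M' d" for d
      by (rule split_lo[OF subN(1) cN lo(1)], rule split_lo[OF subN(2) cN' lo(2)])
    have Mpos: "0 \<le> ?M d" "0 \<le> ?M' d" for d
    proof -
      have "0 \<le> m / 4 * norm d" using m by simp
      then show "0 \<le> ?M d" "0 \<le> ?M' d" using Mlo[of d] by linarith+
    qed
    have 1: "r * norm d \<le> ?M d" for d
    proof -
      have "r * norm d \<le> m / 4 * norm d" using r em m by (intro mult_right_mono) auto
      then show ?thesis using Mlo(1)[of d] by linarith
    qed
    have div: "c * norm d \<le> norm d / r" if "c \<le> 144 * B ^ 3" for c and d :: 'e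
    proof -
      have "r * c \<le> \<eta> * (144 * B ^ 3)"
        by (rule order_trans[OF mult_left_mono[OF that] mult_right_mono[OF r(2)]]) (use r B1 in auto)
      then have "r * c \<le> 1" using eB by linarith
      then have "c \<le> 1 / r" using r by (simp add: pos_le_divide_eq mult.commute)
      then show ?thesis using mult_right_mono[of c "1 / r" "norm d"] by simp
    qed
    have Npos: "0 \<le> N d" "0 \<le> N' d" for d
      using subN[of d "- d"] Nz N by (auto simp: even_subadditive_def)
    have Mker: "?M (P d) = N (P d)" "?M' (d - P' d) = N' (d - P' d)" for d
      by (simp_all add: split_norm_def P(2,4) linP linP' Nz Npos)
    have 2: "?M (P (R d)) \<le> norm d / r" for d
    proof -
      have "?M (P (R d)) \<le> 2 * B * norm (P (R d))" using nNN Mker by simp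
      also have "\<dots> \<le> 2 * B * (2 * B * (B * norm d))"
        using nPP(1)[of "R d"] lmB(2)[OF nR[of d]] by (intro lmB(2)) linarith
      also have "\<dots> = (4 * B ^ 3) * norm d" by (simp add: power3_eq_cube)
      also have "\<dots> \<le> norm d / r" using B3 by (intro div) linarith
      finally show ?thesis .
    qed
    have 3: "?M' (d - P' d) \<le> norm d / r" for d
    proof -
      have "?M' (d - P' d) \<le> N' d + N' (- P' d)" using subN(2)[of d "- P' d"] Mker by simp
      also have "\<dots> \<le> 2 * B * norm d + 2 * B * norm (P' d)" using nNN(2)[of d] nNN(2)[of "- P' d"] by simp
      also have "\<dots> \<le> 2 * B * norm d + 2 * B * (2 * B * norm d)"
        using nPP B1 by (intro add_mono mult_left_mono) auto
      also have "\<dots> = (2 * B + 4 * B\<^sup>2) * norm d" by (simp add: power2_eq_square algebra_simps)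
      also have "\<dots> \<le> norm d / r" using B3 by (intro div) linarith
      finally show ?thesis .
    qed
    show "hyperbolic_step \<kappa> r ?M P ?M' P' R h"
      unfolding hyperbolic_step_def
    proof (intro conjI ballI allI impI)
      show "bounded_linear R" by (rule lin)
      show "r * norm d \<le> ?M d" for d by (rule 1)
      show "?M (P (R d)) \<le> norm d / r" for d by (rule 2)
      show "?M' (d - P' d) \<le> norm d / r" for d by (rule 3)
    next
      fix a b :: 'e assume ab: "a \<in> cball 0 r" "b \<in> cball 0 r"
      define d where "d = a - b"
      define e where "e = h a - h b - D d"
      have hd: "h a - h b = D d + e" by (simp add: e_def)
      have e: "norm e \<le> \<eta> * norm d" using h[OF ab] by (simp add: e_def d_def)
      have "norm (h a - h b) \<le> (2 * B) * norm d"
        unfolding hd using norm_triangle_ineq[of "D d" e] e nD[of d] ee[of d]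
          mult_right_mono[OF B1 norm_ge_zero[of d]] by simp
      also have "\<dots> \<le> norm d / r" using B3 by (intro div) linarith
      finally show "norm (h a - h b) \<le> norm (a - b) / r" by (simp add: d_def)
      define C where "C = 4 * B\<^sup>2"
      have BB: "B * norm d \<le> B\<^sup>2 * norm d" "norm d \<le> B * norm d" "norm d \<le> B\<^sup>2 * norm d" "norm d \<le> 2 * B * norm d"
        using B3 B1 mult_right_mono[of B "B\<^sup>2" "norm d"] mult_right_mono[of 1 B "norm d"]
          mult_right_mono[of 1 "B\<^sup>2" "norm d"] mult_right_mono[of 1 "2 * B" "norm d"] by auto
      have c1: "\<bar>N' (h a - h b - P' (h a - h b)) - N0' (D (d - P0 d))\<bar> \<le> 3 * B * C * \<eta> * norm d"
      proof (rule even_subadditive_perturb[OF N(2) cN' nN(2) B1])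
        have "norm ((h a - h b - P' (h a - h b)) - D (d - P0 d)) = norm (e - P' e - (P' (D d) - P0' (D d)))"
          by (simp add: hd linP' linD comm algebra_simps)
        also have "\<dots> \<le> norm e + norm (P' e) + norm (P' (D d) - P0' (D d))"
          by (meson add_mono norm_triangle_ineq4 order_refl order_trans)
        also have "\<dots> \<le> \<eta> * norm d + 2 * B * (\<eta> * norm d) + \<eta> * (B * norm d)"
        proof (intro add_mono e)
          show "norm (P' e) \<le> 2 * B * (\<eta> * norm d)"
            using nPP(2)[of e] lmB(2)[OF e] by linarith
          show "norm (P' (D d) - P0' (D d)) \<le> \<eta> * (B * norm d)"
            using cP'[of "D d"] lme[OF nD[of d]] by linarith
        qed
        also have "\<dots> = \<eta> * (norm d + 3 * (B * norm d))" by (simp add: algebra_simps)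
        also have "\<dots> \<le> \<eta> * (4 * (B\<^sup>2 * norm d))" using e0 BB by (intro mult_left_mono) auto
        finally show "norm ((h a - h b - P' (h a - h b)) - D (d - P0 d)) \<le> \<eta> * C * norm d"
          by (simp add: C_def mult.assoc mult.left_commute)
        have "norm (D (d - P0 d)) \<le> B * norm (d - P0 d)" by (rule nD)
        also have "\<dots> \<le> B * (norm d + norm (P0 d))" using B1 norm_triangle_ineq4 by (intro mult_left_mono) auto
        also have "\<dots> \<le> B * (B * norm d + B * norm d)" using B1 nP[of d] BB by (intro mult_left_mono add_mono) auto
        also have "\<dots> \<le> C * norm d" using B0 by (simp add: C_def power2_eq_square algebra_simps)
        finally show "norm (D (d - P0 d)) \<le> C * norm d" .
      qed (use e0 e1 in \<open>auto simp: C_def\<close>)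
      have c2: "\<bar>N (d - P d) - N0 (d - P0 d)\<bar> \<le> 3 * B * (2 * B) * \<eta> * norm d"
      proof (rule even_subadditive_perturb[OF N(1) cN nN(1) B1])
        have "norm (d - P d - (d - P0 d)) \<le> \<eta> * norm d" using cP[of d] by (simp add: norm_minus_commute)
        also have "\<dots> \<le> \<eta> * (2 * B * norm d)" using e0 BB by (intro mult_left_mono) auto
        finally show "norm (d - P d - (d - P0 d)) \<le> \<eta> * (2 * B) * norm d" by (simp add: mult.assoc)
        show "norm (d - P0 d) \<le> 2 * B * norm d"
          using norm_triangle_ineq4[of d "P0 d"] nP[of d] BB by linarith
      qed (use e0 e1 B1 in auto)
      have "N0 (d - P0 d) \<le> ?M d + 6 * B\<^sup>2 * \<eta> * norm d"
        using c2 by (simp add: split_norm_def power2_eq_square)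
      then have "\<mu> * N0 (d - P0 d) \<le> \<mu> * ?M d + \<mu> * (6 * B\<^sup>2 * \<eta> * norm d)"
        using k mult_left_mono by (fastforce simp: distrib_left[symmetric])
      moreover have "\<mu> * (6 * B\<^sup>2 * \<eta> * norm d) \<le> 1 * (6 * B ^ 3 * \<eta> * norm d)"
        using k e0 B3 B1 by (intro mult_mono mult_right_mono mult_left_mono) auto
      moreover have "3 * B * C * \<eta> * norm d = 12 * B ^ 3 * \<eta> * norm d"
        by (simp add: C_def power2_eq_square power3_eq_cube)
      ultimately have "N' (h a - h b - P' (h a - h b)) \<le> \<mu> * ?M d + 18 * (B ^ 3 * \<eta> * norm d)"
        using c1 contr[of d] by linarith
      also have "18 * (B ^ 3 * \<eta> * norm d) = (\<kappa> - \<mu>) / 2 * (m / 4 * norm d)"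
        using arg_cong[OF eK, of "\<lambda>x. x * norm d / 8"] by (simp add: mult_ac)
      also have "\<dots> \<le> (\<kappa> - \<mu>) * ?M d"
        using k Mlo(1)[of d] Mpos(1)[of d] m by (intro mult_mono) auto
      finally have "N' (h a - h b - P' (h a - h b)) \<le> \<kappa> * ?M d"
        by (simp add: algebra_simps)
      then show "?M' (h a - h b - P' (h a - h b)) \<le> \<kappa> * ?M (a - b)"
        by (simp only: Mker d_def)
      fix w :: 'e
      define t where "t = norm w + norm d"
      have t0: "0 \<le> t" by (simp add: t_def)
      have wt: "norm w \<le> t" "norm d \<le> t" by (simp_all add: t_def)
      have c3: "\<bar>N (P (d + R (w - (h a - h b)))) - N0 (R (P0' w))\<bar> \<le> 3 * B * (2 * B\<^sup>2) * \<eta> * t"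
      proof (rule even_subadditive_perturb[OF N(1) cN nN(1) B1])
        have "norm (P (d + R (w - (h a - h b))) - R (P0' w)) = norm ((P (R w) - P0 (R w)) - P (R e))"
          by (simp add: hd linP linR RD comm' algebra_simps)
        also have "\<dots> \<le> norm (P (R w) - P0 (R w)) + norm (P (R e))" by (rule norm_triangle_ineq4)
        also have "\<dots> \<le> \<eta> * (B * norm w) + 2 * B * (B * (\<eta> * norm d))"
        proof (intro add_mono)
          show "norm (P (R w) - P0 (R w)) \<le> \<eta> * (B * norm w)"
            using cP[of "R w"] lme[OF nR[of w]] by linarith
          have "norm (R e) \<le> B * (\<eta> * norm d)"
            using nR[of e] lmB(1)[OF e] by linarith
          then show "norm (P (R e)) \<le> 2 * B * (B * (\<eta> * norm d))"
            using nPP(1)[of "R e"] lmB(2)[of "norm (R e)" "B * (\<eta> * norm d)"] by linarith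
        qed
        also have "\<dots> = \<eta> * (B * norm w + 2 * B\<^sup>2 * norm d)" by (simp add: power2_eq_square algebra_simps)
        also have "\<dots> \<le> \<eta> * (2 * B\<^sup>2 * t)"
        proof (intro mult_left_mono)
          have "B * norm w \<le> 2 * B\<^sup>2 * norm w" using B3 by (intro mult_right_mono) auto
          then show "B * norm w + 2 * B\<^sup>2 * norm d \<le> 2 * B\<^sup>2 * t"
            by (simp add: t_def distrib_left)
        qed (use e0 in simp)
        finally show "norm (P (d + R (w - (h a - h b))) - R (P0' w)) \<le> \<eta> * (2 * B\<^sup>2) * t"
          by (simp add: mult.assoc)
        have "norm (R (P0' w)) \<le> B * (B * norm w)"
          using nR[of "P0' w"] lmB(1)[OF nP'[of w]] by linarith
        also have "\<dots> \<le> B * (B * t)" using wt B1 by (intro mult_left_mono) auto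
        also have "\<dots> \<le> 2 * B\<^sup>2 * t" using t0 B0 by (simp add: power2_eq_square)
        finally show "norm (R (P0' w)) \<le> 2 * B\<^sup>2 * t" .
      qed (use e0 e1 B1 t0 in auto)
      have c4: "\<bar>N' (P' w) - N0' (P0' w)\<bar> \<le> 3 * B * B * \<eta> * t"
      proof (rule even_subadditive_perturb[OF N(2) cN' nN(2) B1])
        have "norm (P' w - P0' w) \<le> \<eta> * norm w" by (rule cP')
        also have "\<dots> \<le> \<eta> * (B * t)"
          using e0 B1 wt(1) mult_mono[of 1 B "norm w" t] by (intro mult_left_mono) auto
        finally show "norm (P' w - P0' w) \<le> \<eta> * B * t" by (simp add: mult.assoc)
        show "norm (P0' w) \<le> B * t" using nP'[of w] lmB(1)[OF wt(1)] by linarith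
      qed (use e0 e1 B1 t0 in auto)
      have "N0' (P0' w) \<le> ?M' w + 3 * B\<^sup>2 * \<eta> * t"
        using c4 by (simp add: split_norm_def power2_eq_square)
      then have "\<mu> * N0' (P0' w) \<le> \<mu> * ?M' w + \<mu> * (3 * B\<^sup>2 * \<eta> * t)"
        using k mult_left_mono by (fastforce simp: distrib_left[symmetric])
      moreover have "\<mu> * (3 * B\<^sup>2 * \<eta> * t) \<le> 1 * (3 * B ^ 3 * \<eta> * t)"
        using k e0 B3 B1 t0 by (intro mult_mono mult_right_mono mult_left_mono) auto
      moreover have "3 * B * (2 * B\<^sup>2) * \<eta> * t = 6 * B ^ 3 * \<eta> * t"
        by (simp add: power2_eq_square power3_eq_cube)
      ultimately have "N (P (d + R (w - (h a - h b)))) \<le> \<mu> * ?M' w + 9 * (B ^ 3 * \<eta> * t)"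
        using c3 expan[of w] by linarith
      also have "9 * (B ^ 3 * \<eta> * t) = (\<kappa> - \<mu>) / 4 * (m / 4 * norm w + m / 4 * norm d)"
        using arg_cong[OF eK, of "\<lambda>x. x * t / 16"]
        unfolding distrib_left[symmetric] t_def[symmetric] by (simp add: mult_ac)
      also have "\<dots> \<le> (\<kappa> - \<mu>) / 4 * (?M' w + ?M d)"
        using k Mlo by (intro mult_left_mono add_mono) auto
      also have "\<dots> \<le> (\<kappa> - \<mu>) / 4 * (4 * max (?M' w) (?M d))"
        using k Mpos[of w] Mpos[of d] by (intro mult_left_mono) auto
      also have "\<mu> * ?M' w + (\<kappa> - \<mu>) / 4 * (4 * max (?M' w) (?M d)) \<le>
          \<mu> * max (?M' w) (?M d) + (\<kappa> - \<mu>) * max (?M' w) (?M d)"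
        using k by (intro add_mono mult_left_mono) auto
      finally have "N (P (d + R (w - (h a - h b)))) \<le> \<kappa> * max (?M' w) (?M d)"
        by (simp add: left_diff_distrib)
      then show "?M (P (a - b + R (w - (h a - h b)))) \<le> \<kappa> * max (?M' w) (?M (a - b))"
        by (simp only: Mker d_def)
    next
      fix w :: 'e assume w: "P (R w) = 0" "P' w = w"
      have "R w = R (P' w - P0' w) - (P (R w) - P0 (R w))"
        by (simp add: w linR comm')
      then have "norm (R w) \<le> norm (R (P' w - P0' w)) + norm (P (R w) - P0 (R w))"
        using norm_triangle_ineq4 by metis
      also have "\<dots> \<le> B * (\<eta> * norm w) + \<eta> * (B * norm w)"
      proof (intro add_mono)
        show "norm (R (P' w - P0' w)) \<le> B * (\<eta> * norm w)"
          using nR[of "P' w - P0' w"] lmB(1)[OF cP'[of w]] by linarith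
        show "norm (P (R w) - P0 (R w)) \<le> \<eta> * (B * norm w)"
          using cP[of "R w"] lme[OF nR[of w]] by linarith
      qed
      finally have "norm w \<le> B * (2 * (B * (\<eta> * norm w)))"
        using nD[of "R w"] lmB(1)[of "norm (R w)" "2 * (B * (\<eta> * norm w))"]
        by (simp add: RD mult.left_commute)
      also have "\<dots> = (2 * B\<^sup>2 * \<eta>) * norm w" by (simp add: power2_eq_square)
      also have "\<dots> \<le> 1 / 2 * norm w"
      proof (intro mult_right_mono)
        have "2 * B\<^sup>2 * \<eta> \<le> 72 * B ^ 3 * \<eta>" using B3 e0 by (intro mult_right_mono) auto
        then show "2 * B\<^sup>2 * \<eta> \<le> 1 / 2" using eB by (simp add: mult_ac)
      qed simp
      finally show "w = 0" by simp
    qed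
  qed
qed

section \<open>Chains of a family of measure-preserving maps\<close>

text \<open>The star of a set with respect to a cover. It replaces metric neighbourhoods and, for a
finite cover, takes only finitely many values.\<close>

definition cover_nbhd :: "'m set set \<Rightarrow> 'm set \<Rightarrow> 'm set" where
  "cover_nbhd \<U> B = \<Union>{U \<in> \<U>. U \<inter> B \<noteq> {}}"

primrec reach :: "'m set set \<Rightarrow> (nat \<Rightarrow> 'm \<Rightarrow> 'm) \<Rightarrow> 'm \<Rightarrow> nat \<Rightarrow> 'm set" where
  "reach \<U> F x 0 = {x}"
| "reach \<U> F x (Suc n) = cover_nbhd \<U> (F n ` reach \<U> F x n)"

lemma reach_chain:
  assumes "y \<in> reach \<U> F x n"
  shows "\<exists>z. z 0 = x \<and> z n = y \<and> (\<forall>i<n. \<exists>U\<in>\<U>. F i (z i) \<in> U \<and> z (Suc i) \<in> U)"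
  using assms
proof (induction n arbitrary: y)
  case 0
  then show ?case by (intro exI[of _ "\<lambda>_. x"]) simp
next
  case (Suc n)
  then obtain U p where U: "U \<in> \<U>" "y \<in> U" "F n p \<in> U" "p \<in> reach \<U> F x n"
    unfolding reach.simps cover_nbhd_def by blast
  from Suc.IH[OF U(4)] obtain z where z: "z 0 = x" "z n = p"
    "\<forall>i<n. \<exists>U\<in>\<U>. F i (z i) \<in> U \<and> z (Suc i) \<in> U" by blast
  have "\<exists>U\<in>\<U>. F i ((z(Suc n := y)) i) \<in> U \<and> (z(Suc n := y)) (Suc i) \<in> U" if "i < Suc n" for i
    using that z(2,3) U by (cases "i = n") auto
  then show ?case
    using z(1) by (intro exI[of _ "z(Suc n := y)"]) simp
qed

text \<open>The star of the image contains the image, which has the same measure as \<open>S\<close>. If there is no gain,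
the part of the star outside the closure of the image is an open null set, hence empty; and the
closure is always contained in the star. So the star is open and closed.\<close>

lemma cover_nbhd_grows:
  fixes h :: "'m::topological_space \<Rightarrow> 'm"
  assumes conn: "connected (UNIV :: 'm set)"
    and \<nu>: "borel_probability \<nu>" "measure_support \<nu> = UNIV"
    and h: "inj h" "\<And>B. open B \<Longrightarrow> open (h ` B)"
    and inv: "\<And>B. B \<in> sets borel \<Longrightarrow> emeasure \<nu> (h -` B) = emeasure \<nu> B"
    and cov: "\<And>U. U \<in> \<U> \<Longrightarrow> open U" "\<Union>\<U> = UNIV"
    and S: "open S" "S \<noteq> {}"
  shows "measure \<nu> S < measure \<nu> (cover_nbhd \<U> (h ` S)) \<or> cover_nbhd \<U> (h ` S) = UNIV"
proof -
  interpret prob_space \<nu> using \<nu>(1) by (simp add: borel_probability_def)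
  have sets: "open B \<Longrightarrow> B \<in> sets \<nu>" for B
    using \<nu>(1) by (simp add: borel_probability_def)
  let ?T = "cover_nbhd \<U> (h ` S)"
  have T: "open ?T" "h ` S \<subseteq> ?T"
  proof -
    show "open ?T" using cov(1) unfolding cover_nbhd_def by (auto intro!: open_Union)
    show "h ` S \<subseteq> ?T"
    proof
      fix y assume y: "y \<in> h ` S"
      obtain U where "U \<in> \<U>" "y \<in> U" using cov(2) by blast
      then show "y \<in> ?T" using y unfolding cover_nbhd_def by blast
    qed
  qed
  have "h -` (h ` S) = S" using h(1) by (rule inj_vimage_image_eq)
  then have eq: "measure \<nu> S = measure \<nu> (h ` S)"
    using inv[of "h ` S"] h(2)[OF S(1)] by (simp add: measure_def)
  show ?thesis
  proof (cases "measure \<nu> S < measure \<nu> ?T")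
    case False
    have "measure \<nu> (?T - h ` S) = measure \<nu> ?T - measure \<nu> (h ` S)"
      by (intro finite_measure_Diff sets T h S)
    then have "measure \<nu> (?T - h ` S) \<le> 0" using False eq by simp
    moreover have "measure \<nu> (?T - closure (h ` S)) \<le> measure \<nu> (?T - h ` S)"
    proof (rule finite_measure_mono)
      show "?T - closure (h ` S) \<subseteq> ?T - h ` S" by (rule Diff_mono[OF order_refl closure_subset])
      show "?T - h ` S \<in> sets \<nu>" by (rule sets.Diff[OF sets[OF T(1)] sets[OF h(2)[OF S(1)]]])
    qed
    ultimately have "measure \<nu> (?T - closure (h ` S)) \<le> 0" by linarith
    then have z: "emeasure \<nu> (?T - closure (h ` S)) = 0"
      by (simp add: emeasure_eq_measure measure_le_0_iff)
    have "?T - closure (h ` S) = {}"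
    proof (rule ccontr)
      assume "?T - closure (h ` S) \<noteq> {}"
      then obtain x where "x \<in> ?T - closure (h ` S)" by blast
      moreover have "x \<in> measure_support \<nu>" using \<nu>(2) by simp
      moreover have "open (?T - closure (h ` S))" using T by (intro open_Diff closed_closure)
      ultimately show False using z unfolding measure_support_def by fastforce
    qed
    moreover have "closure (h ` S) \<subseteq> ?T"
    proof
      fix z assume z: "z \<in> closure (h ` S)"
      obtain U where U: "U \<in> \<U>" "z \<in> U" using cov(2) by blast
      have "U \<inter> h ` S \<noteq> {}" using open_Int_closure_eq_empty[OF cov(1)[OF U(1)]] z U by blast
      then show "z \<in> ?T" using U unfolding cover_nbhd_def by blast
    qed
    ultimately have "closed ?T" using closed_closure[of "h ` S"] by (simp add: subset_antisym)
    then have "?T = {} \<or> ?T = UNIV"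
      using connected_clopen[of "UNIV :: 'm set"] conn T(1) by simp
    then show ?thesis using T(2) S(2) by blast
  qed blast
qed

text \<open>Each step increases the measure of the reached set strictly or has already filled the space, and
there are at most as many strict increases as there are measures of unions of members of the
cover. This bound on the length is independent of \<open>\<omega>\<close> since the measure is the same on all fibres.\<close>

lemma chain_mixing:
  fixes f :: "'w \<Rightarrow> 'm::topological_space \<Rightarrow> 'm"
  assumes conn: "connected (UNIV :: 'm set)"
    and \<nu>: "borel_probability \<nu>" "invariant_measure f \<nu>" "measure_support \<nu> = UNIV"
    and f: "\<And>\<omega>. inj (f \<omega>)" "\<And>\<omega> B. open B \<Longrightarrow> open (f \<omega> ` B)"
    and cov: "finite \<U>" "\<And>U. U \<in> \<U> \<Longrightarrow> open U" "\<Union>\<U> = UNIV"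
  shows "\<exists>N>0. \<forall>n\<ge>N. \<forall>\<omega> x y. \<exists>z. z 0 = x \<and> z n = y \<and>
     (\<forall>i<n. \<exists>U\<in>\<U>. f ((\<theta> ^^ i) \<omega>) (z i) \<in> U \<and> z (Suc i) \<in> U)"
proof -
  define vals where "vals = (\<lambda>\<V>. measure \<nu> (\<Union>\<V>)) ` Pow \<U>"
  \<comment> \<open>The rank of a set is the number of admissible measures below its own; it increases with each
     strict gain of measure.\<close>
  define rank where "rank S = card {v \<in> vals. v < measure \<nu> S}" for S
  have fin: "finite vals" using cov(1) by (simp add: vals_def)
  have rank: "rank S \<le> card vals" for S
    unfolding rank_def by (intro card_mono fin) auto
  have vals: "measure \<nu> (cover_nbhd \<U> B) \<in> vals" for B
    unfolding vals_def cover_nbhd_def by (intro image_eqI[OF refl]) auto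
  have inv: "emeasure \<nu> (f \<omega> -` B) = emeasure \<nu> B" if "B \<in> sets borel" for \<omega> B
    using \<nu>(2) that by (simp add: invariant_measure_def)
  have main: "i \<le> rank (reach \<U> F x (Suc i)) \<or> reach \<U> F x (Suc i) = UNIV"
    if F: "F = (\<lambda>i. f ((\<theta> ^^ i) \<omega>))" for F x \<omega> i
  proof (induction i)
    case (Suc i)
    let ?S = "reach \<U> F x (Suc i)" and ?T = "reach \<U> F x (Suc (Suc i))"
    have ne: "B \<noteq> {} \<Longrightarrow> cover_nbhd \<U> B \<noteq> {}" for B
      using cov(3) unfolding cover_nbhd_def by blast
    have nonempty: "reach \<U> F x j \<noteq> {}" for j
      by (induction j) (auto simp: ne)
    have opn: "open ?S" using cov(2) by (auto simp: cover_nbhd_def)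
    have Fj: "inj (F j)" "\<And>B. open B \<Longrightarrow> open (F j ` B)"
      "\<And>B. B \<in> sets borel \<Longrightarrow> emeasure \<nu> (F j -` B) = emeasure \<nu> B" for j
      using f inv by (simp_all add: F)
    have *: "measure \<nu> ?S < measure \<nu> ?T \<or> ?T = UNIV"
      unfolding reach.simps(2)[of \<U> F x "Suc i"]
      by (rule cover_nbhd_grows[OF conn \<nu>(1,3) Fj cov(2,3) opn nonempty])
    show ?case
    proof (cases "?T = UNIV")
      case False
      then have lt: "measure \<nu> ?S < measure \<nu> ?T" using * by blast
      have "?S \<noteq> UNIV"
      proof
        assume "?S = UNIV"
        then have "measure \<nu> ?T \<le> measure \<nu> ?S"
          using \<nu>(1) unfolding borel_probability_def
          by (metis prob_space.prob_space prob_space.prob_le_1 sets_eq_imp_space_eq space_borel)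
        then show False using lt by simp
      qed
      then have "i \<le> rank ?S" using Suc by blast
      also have "rank ?S < rank ?T"
        unfolding rank_def
      proof (rule psubset_card_mono)
        have "measure \<nu> ?S \<in> vals" using vals by simp
        then show "{v \<in> vals. v < measure \<nu> ?S} \<subset> {v \<in> vals. v < measure \<nu> ?T}" using lt by auto
      qed (use fin in simp)
      finally show ?thesis by simp
    qed blast
  qed simp
  show ?thesis
  proof (intro exI[of _ "card vals + 2"] conjI allI impI)
    fix n \<omega> x y assume n: "card vals + 2 \<le> n"
    define F where "F = (\<lambda>i. f ((\<theta> ^^ i) \<omega>))"
    \<comment> \<open>The first reached set that is a union of members of the cover is the one at time \<open>1\<close>.\<close>
    obtain i where i: "n = Suc i" "card vals < i" using n by (cases n) auto
    then have "y \<in> reach \<U> F x n"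
      using main[OF F_def, of i x] rank[of "reach \<U> F x (Suc i)"] by auto
    from reach_chain[OF this]
    show "\<exists>z. z 0 = x \<and> z n = y \<and> (\<forall>i<n. \<exists>U\<in>\<U>. f ((\<theta> ^^ i) \<omega>) (z i) \<in> U \<and> z (Suc i) \<in> U)"
      by (simp add: F_def)
  qed simp
qed

section \<open>Splittings and positive forms near a point\<close>

definition complementary :: "'e::real_vector set \<Rightarrow> 'e set \<Rightarrow> bool" where
  "complementary U S \<longleftrightarrow> subspace U \<and> subspace S \<and> U \<inter> S = {0} \<and> (\<forall>a. \<exists>u\<in>U. a - u \<in> S)"

definition proj_along :: "'e::real_vector set \<Rightarrow> 'e set \<Rightarrow> 'e \<Rightarrow> 'e" where
  "proj_along U S a = (THE u. u \<in> U \<and> a - u \<in> S)"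

lemma proj_along_unique:
  assumes "complementary U S" "u \<in> U" "a - u \<in> S"
  shows "proj_along U S a = u"
  unfolding proj_along_def
proof (rule the_equality)
  fix u' assume u': "u' \<in> U \<and> a - u' \<in> S"
  have "u' - u \<in> U" "(a - u) - (a - u') \<in> S"
    using assms u' unfolding complementary_def by (blast intro: subspace_diff)+
  then have "u' - u \<in> U \<inter> S" by simp
  moreover have "U \<inter> S = {0}" using assms(1) by (simp add: complementary_def)
  ultimately show "u' = u" by (simp only: singleton_iff right_minus_eq)
qed (use assms in blast)

lemma proj_along_mem:
  assumes "complementary U S"
  shows "proj_along U S a \<in> U" "a - proj_along U S a \<in> S"
proof -
  obtain u where "u \<in> U" "a - u \<in> S" using assms unfolding complementary_def by blast
  then show "proj_along U S a \<in> U" "a - proj_along U S a \<in> S"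
    using proj_along_unique[OF assms] by auto
qed

lemma proj_along_fixes:
  assumes "complementary U S"
  shows "u \<in> U \<Longrightarrow> proj_along U S u = u" "s \<in> S \<Longrightarrow> proj_along U S s = 0"
  using assms by (auto intro!: proj_along_unique simp: complementary_def subspace_0)

lemma linear_proj_along:
  assumes "complementary U S"
  shows "linear (proj_along U S)"
proof -
  have sub: "subspace U" "subspace S" using assms by (auto simp: complementary_def)
  note mem = proj_along_mem[OF assms]
  show ?thesis
  proof (rule linearI)
    fix a b
    have "(a - proj_along U S a) + (b - proj_along U S b) \<in> S" by (intro subspace_add sub mem)
    then show "proj_along U S (a + b) = proj_along U S a + proj_along U S b"
      by (intro proj_along_unique[OF assms] subspace_add sub mem) (simp add: algebra_simps)
  next
    fix c a
    have "c *\<^sub>R (a - proj_along U S a) \<in> S" by (intro subspace_scale sub mem)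
    then show "proj_along U S (c *\<^sub>R a) = c *\<^sub>R proj_along U S a"
      by (intro proj_along_unique[OF assms] subspace_scale sub mem) (simp add: algebra_simps)
  qed
qed

lemma norm_linear_le_Basis:
  fixes L :: "'e::euclidean_space \<Rightarrow> 'b::real_normed_vector"
  assumes "linear L" "\<And>b. b \<in> Basis \<Longrightarrow> norm (L b) \<le> c"
  shows "norm (L d) \<le> real DIM('e) * c * norm d"
proof -
  have "L d = (\<Sum>b\<in>Basis. (d \<bullet> b) *\<^sub>R L b)"
    using arg_cong[OF euclidean_representation[of d], of L] by (simp add: linear_sum[OF assms(1)] linear_cmul[OF assms(1)])
  also have "norm \<dots> \<le> (\<Sum>b\<in>(Basis::'e set). norm d * c)"
  proof (rule sum_norm_le)
    fix b :: 'e assume b: "b \<in> Basis"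
    have "\<bar>d \<bullet> b\<bar> * norm (L b) \<le> norm d * c"
      using Basis_le_norm[OF b] assms(2)[OF b] by (intro mult_mono) auto
    then show "norm ((d \<bullet> b) *\<^sub>R L b) \<le> norm d * c" by simp
  qed
  finally show ?thesis by (simp add: mult_ac)
qed

text \<open>Lower semicontinuity of the two families of subspaces makes the projections continuous. Each basis vector splits up to a small error into vectors of the nearby subspaces, so the
nearby projection \<open>P\<close> differs from \<open>P0\<close> on it by the small error and its image under \<open>P\<close>. This bounds the norm \<open>K\<close> of
\<open>P\<close> by a constant plus \<open>K / 2\<close>, and hence uniformly; using the bound once more gives closeness.\<close>

lemma proj_along_eventually_close:
  fixes U S :: "'q \<Rightarrow> 'e::euclidean_space set"
  assumes c: "\<forall>\<^sub>F q in F. complementary (U q) (S q)" and c0: "complementary U0 S0"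
    and lU: "\<And>u. u \<in> U0 \<Longrightarrow> \<exists>\<sigma>. (\<sigma> \<longlongrightarrow> u) F \<and> (\<forall>\<^sub>F q in F. \<sigma> q \<in> U q)"
    and lS: "\<And>u. u \<in> S0 \<Longrightarrow> \<exists>\<sigma>. (\<sigma> \<longlongrightarrow> u) F \<and> (\<forall>\<^sub>F q in F. \<sigma> q \<in> S q)"
    and e: "0 < \<epsilon>"
  shows "\<forall>\<^sub>F q in F. \<forall>d. norm (proj_along (U q) (S q) d - proj_along U0 S0 d) \<le> \<epsilon> * norm d"
proof -
  define P0 where "P0 = proj_along U0 S0"
  have "\<forall>b. \<exists>\<sigma>. (\<sigma> \<longlongrightarrow> P0 b) F \<and> (\<forall>\<^sub>F q in F. \<sigma> q \<in> U q)"
    using lU[OF proj_along_mem(1)[OF c0]] unfolding P0_def by (rule allI)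
  from choice[OF this] obtain \<sigma>
    where \<sigma>: "\<And>b. (\<sigma> b \<longlongrightarrow> P0 b) F" "\<And>b. \<forall>\<^sub>F q in F. \<sigma> b q \<in> U q" by blast
  have "\<forall>b. \<exists>\<tau>. (\<tau> \<longlongrightarrow> b - P0 b) F \<and> (\<forall>\<^sub>F q in F. \<tau> q \<in> S q)"
    using lS[OF proj_along_mem(2)[OF c0]] unfolding P0_def by (rule allI)
  from choice[OF this] obtain \<tau>
    where \<tau>: "\<And>b. (\<tau> b \<longlongrightarrow> b - P0 b) F" "\<And>b. \<forall>\<^sub>F q in F. \<tau> b q \<in> S q" by blast
  have lin0: "linear P0" unfolding P0_def by (rule linear_proj_along[OF c0])
  define K0 where "K0 = onorm P0"
  define n where "n = real DIM('e)"
  have n: "1 \<le> n" by (simp add: n_def DIM_positive Suc_leI)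
  have K0: "0 \<le> K0" "norm (P0 d) \<le> K0 * norm d" for d
    using lin0 onorm_pos_le[of P0] onorm[of P0] by (simp_all add: K0_def linear_conv_bounded_linear)
  \<comment> \<open>The first bound makes the norm of the nearby projection at most \<open>2 * K0 + 1\<close>; the second
     then makes the difference at most \<open>\<epsilon>\<close>.\<close>
  define \<delta> where "\<delta> = min (1 / (2 * n)) (\<epsilon> / (n * (2 * K0 + 2)))"
  have d: "0 < \<delta>" "n * \<delta> \<le> 1 / 2" "n * \<delta> * (2 * K0 + 2) \<le> \<epsilon>"
  proof -
    have p: "0 < n * (2 * K0 + 2)" using n K0(1) by simp
    then show "0 < \<delta>" using n e by (simp add: \<delta>_def)
    have "\<delta> \<le> 1 / (2 * n)" "\<delta> \<le> \<epsilon> / (n * (2 * K0 + 2))" by (simp_all add: \<delta>_def)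
    then have "\<delta> * (2 * n) \<le> 1" "\<delta> * (n * (2 * K0 + 2)) \<le> \<epsilon>"
      using n p by (simp_all add: pos_le_divide_eq)
    then show "n * \<delta> \<le> 1 / 2" "n * \<delta> * (2 * K0 + 2) \<le> \<epsilon>" by (simp_all add: mult_ac)
  qed
  have "\<forall>\<^sub>F q in F. \<forall>b\<in>Basis. norm (\<sigma> b q - P0 b) \<le> \<delta> \<and> norm (b - \<sigma> b q - \<tau> b q) \<le> \<delta>
      \<and> \<sigma> b q \<in> U q \<and> \<tau> b q \<in> S q"
  proof (intro eventually_ball_finite ballI finite_Basis eventually_conj \<sigma> \<tau>)
    fix b
    have "((\<lambda>q. norm (\<sigma> b q - P0 b)) \<longlongrightarrow> 0) F"
      using \<sigma>(1)[of b] by (intro tendsto_norm_zero LIM_zero)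
    then show "\<forall>\<^sub>F q in F. norm (\<sigma> b q - P0 b) \<le> \<delta>"
      by (rule order_tendstoD(2)[OF _ d(1), THEN eventually_mono]) auto
    have "((\<lambda>q. b - \<sigma> b q - \<tau> b q) \<longlongrightarrow> b - P0 b - (b - P0 b)) F"
      by (intro tendsto_intros \<sigma> \<tau>)
    then have "((\<lambda>q. norm (b - \<sigma> b q - \<tau> b q)) \<longlongrightarrow> 0) F"
      by (intro tendsto_norm_zero) simp
    then show "\<forall>\<^sub>F q in F. norm (b - \<sigma> b q - \<tau> b q) \<le> \<delta>"
      by (rule order_tendstoD(2)[OF _ d(1), THEN eventually_mono]) auto
  qed
  then show ?thesis
    using c
  proof eventually_elim
    case (elim q)
    define P where "P = proj_along (U q) (S q)"
    have cq: "complementary (U q) (S q)" by (rule elim(2))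
    have lin: "linear P" unfolding P_def by (rule linear_proj_along[OF cq])
    define K where "K = onorm P"
    have K: "0 \<le> K" "norm (P d) \<le> K * norm d" for d
      using lin onorm_pos_le[of P] onorm[of P] by (simp_all add: K_def linear_conv_bounded_linear)
    have "norm (P b - P0 b) \<le> \<delta> + K * \<delta>" if b: "b \<in> Basis" for b
    proof -
      note el = elim(1)[THEN bspec, OF b]
      have "P b = P (\<sigma> b q + \<tau> b q + (b - \<sigma> b q - \<tau> b q))" by simp
      also have "\<dots> = \<sigma> b q + P (b - \<sigma> b q - \<tau> b q)"
        using el proj_along_fixes[OF cq] unfolding linear_add[OF lin] by (simp add: P_def)
      finally have "norm (P b - P0 b) \<le> norm (\<sigma> b q - P0 b) + norm (P (b - \<sigma> b q - \<tau> b q))"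
        using norm_triangle_ineq[of "\<sigma> b q - P0 b" "P (b - \<sigma> b q - \<tau> b q)"] by (simp add: algebra_simps)
      also have "\<dots> \<le> \<delta> + K * \<delta>"
        using el K(2)[of "b - \<sigma> b q - \<tau> b q"] mult_left_mono[OF _ K(1), of "norm (b - \<sigma> b q - \<tau> b q)" \<delta>]
        by fastforce
      finally show ?thesis .
    qed
    then have close: "norm (P d - P0 d) \<le> n * (\<delta> + K * \<delta>) * norm d" for d
      using norm_linear_le_Basis[OF linear_compose_sub[OF lin lin0]] unfolding n_def by blast
    have "K \<le> K0 + n * (\<delta> + K * \<delta>)"
      unfolding K_def[symmetric]
    proof (subst K_def, rule onorm_le)
      fix d
      show "norm (P d) \<le> (K0 + n * (\<delta> + K * \<delta>)) * norm d"
        using close[of d] K0(2)[of d] norm_triangle_sub[of "P d" "P0 d"] by (simp add: algebra_simps)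
    qed
    also have "\<dots> = K0 + n * \<delta> * (1 + K)" by (simp add: algebra_simps)
    also have "\<dots> \<le> K0 + 1 / 2 * (1 + K)"
      using d K(1) by (intro add_left_mono mult_right_mono) auto
    finally have "K \<le> 2 * K0 + 1" by (simp only: distrib_left)
    then have "n * \<delta> * (1 + K) \<le> n * \<delta> * (2 * K0 + 2)"
      using d(1) n by (intro mult_left_mono) auto
    then have "n * (\<delta> + K * \<delta>) \<le> \<epsilon>" using d(3) by (simp add: algebra_simps)
    then show ?case
      using close mult_right_mono[OF _ norm_ge_zero] order_trans unfolding P_def P0_def by blast
  qed
qed

lemma positive_form_Cauchy_Schwarz:
  fixes B :: "'e::real_vector \<Rightarrow> 'e \<Rightarrow> real"
  assumes B: "bilinear B" and sym: "\<And>a b. B a b = B b a" and pos: "\<And>a. 0 \<le> B a a"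
    and posd: "\<And>a. a \<noteq> 0 \<Longrightarrow> 0 < B a a"
  shows "B a b \<le> sqrt (B a a) * sqrt (B b b)"
proof (cases "b = 0")
  case True
  then show ?thesis using B by (simp add: bilinear_rzero)
next
  case False
  define s where "s = B a b / B b b"
  note lin = bilinear_lsub[OF B] bilinear_rsub[OF B] bilinear_lmul[OF B] bilinear_rmul[OF B]
  have "0 \<le> B (a - s *\<^sub>R b) (a - s *\<^sub>R b)" by (rule pos)
  also have "\<dots> = B a a - s * B a b - s * (B a b - s * B b b)"
    by (simp add: lin sym[of b a] algebra_simps)
  also have "s * B b b = B a b" using posd[OF False] by (simp add: s_def)
  finally have "s * B a b \<le> B a a" by simp
  then have "(B a b)\<^sup>2 \<le> B a a * B b b"
    using posd[OF False] by (simp add: s_def field_simps power2_eq_square)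
  then show ?thesis
    by (metis real_le_rsqrt real_sqrt_mult)
qed

lemma even_subadditive_sqrt_form:
  fixes B :: "'e::real_normed_vector \<Rightarrow> 'e \<Rightarrow> real"
  assumes B: "bilinear B" and sym: "\<And>a b. B a b = B b a" and posd: "\<And>a. a \<noteq> 0 \<Longrightarrow> 0 < B a a"
  shows "even_subadditive (\<lambda>a. sqrt (B a a))"
  unfolding even_subadditive_def
proof (intro conjI allI)
  have pos: "0 \<le> B a a" for a using posd[of a] bilinear_lzero[OF B, of 0] by (cases "a = 0") auto
  show "sqrt (B 0 0) = 0" using bilinear_lzero[OF B] by simp
  show "sqrt (B (- a) (- a)) = sqrt (B a a)" for a
    by (simp add: bilinear_lneg[OF B] bilinear_rneg[OF B])
  show "sqrt (B (a + b) (a + b)) \<le> sqrt (B a a) + sqrt (B b b)" for a b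
  proof (rule real_le_lsqrt)
    have "B (a + b) (a + b) = B a a + 2 * B a b + B b b"
      by (simp add: bilinear_ladd[OF B] bilinear_radd[OF B] sym[of b a])
    also have "\<dots> \<le> B a a + 2 * (sqrt (B a a) * sqrt (B b b)) + B b b"
      using positive_form_Cauchy_Schwarz[OF B sym pos posd] by simp
    also have "\<dots> = (sqrt (B a a) + sqrt (B b b))\<^sup>2"
      using pos[of a] pos[of b] by (simp add: power2_sum)
    finally show "B (a + b) (a + b) \<le> (sqrt (B a a) + sqrt (B b b))\<^sup>2" .
  qed (use pos in auto)
qed

lemma sqrt_form_bounds:
  fixes B :: "'e::euclidean_space \<Rightarrow> 'e \<Rightarrow> real"
  assumes B: "bilinear B" and posd: "\<And>a. a \<noteq> 0 \<Longrightarrow> 0 < B a a"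
  obtains m b where "0 < m" "\<And>a. m * norm a \<le> sqrt (B a a)" "\<And>a. sqrt (B a a) \<le> b * norm a"
proof -
  obtain k where k: "0 < k" "\<And>x y. norm (B x y) \<le> k * norm x * norm y"
    using bilinear_bounded_pos[OF B] by blast
  have bb: "bounded_bilinear B" using B by (simp add: bilinear_conv_bounded_bilinear)
  have cont: "continuous_on (sphere 0 1) (\<lambda>a. B a a)"
    by (intro bounded_bilinear.continuous_on[OF bb] continuous_intros)
  obtain b0 :: 'e where "b0 \<in> Basis" using nonempty_Basis by blast
  then have ne: "sphere (0::'e) 1 \<noteq> {}" by (metis norm_Basis mem_sphere_0 empty_iff)
  obtain a0 where a0: "a0 \<in> sphere 0 1" "\<And>a. a \<in> sphere 0 1 \<Longrightarrow> B a0 a0 \<le> B a a"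
    using continuous_attains_inf[OF compact_sphere ne cont] by blast
  have p0: "0 < B a0 a0" using a0(1) by (intro posd) auto
  have scale: "sqrt (B a a) = norm a * sqrt (B (sgn a) (sgn a))" for a
  proof -
    have a: "norm a *\<^sub>R sgn a = a" by (cases "a = 0") (simp_all add: sgn_div_norm)
    have "B (norm a *\<^sub>R sgn a) (norm a *\<^sub>R sgn a) = norm a * (norm a * B (sgn a) (sgn a))"
      by (simp only: bilinear_lmul[OF B] bilinear_rmul[OF B] real_scaleR_def)
    then have "B a a = norm a * (norm a * B (sgn a) (sgn a))" by (simp only: a)
    then show ?thesis by (simp add: real_sqrt_mult)
  qed
  show thesis
  proof
    show "0 < sqrt (B a0 a0)" using p0 by simp
    show "sqrt (B a0 a0) * norm a \<le> sqrt (B a a)" for a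
    proof (cases "a = 0")
      case False
      then have "B a0 a0 \<le> B (sgn a) (sgn a)" by (intro a0) (simp add: norm_sgn)
      then show ?thesis unfolding scale[of a] by (simp add: mult.commute[of "sqrt _"] mult_left_mono)
    qed (use scale[of a] in simp)
    show "sqrt (B a a) \<le> sqrt k * norm a" for a
    proof -
      have "B a a \<le> k * (norm a)\<^sup>2" using k(2)[of a a] by (simp add: power2_eq_square mult.assoc)
      then show ?thesis using real_sqrt_le_mono by (fastforce simp: real_sqrt_mult)
    qed
  qed
qed

text \<open>The square roots are close relative to the norm of the vector because
\<open>\<bar>sqrt x - sqrt y\<bar> \<le> sqrt \<bar>x - y\<bar>\<close> for nonnegative \<open>x\<close> and \<open>y\<close>, and the forms differ by at most
\<open>\<epsilon>\<^sup>2\<close> times the squared norm.\<close>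

lemma sqrt_form_eventually_close:
  fixes B :: "'q \<Rightarrow> 'e::euclidean_space \<Rightarrow> 'e \<Rightarrow> real"
  assumes B: "\<forall>\<^sub>F q in F. bilinear (B q) \<and> (\<forall>d. 0 \<le> B q d d)"
    and B0: "bilinear B0" "\<And>d. 0 \<le> B0 d d"
    and lim: "\<And>a b. ((\<lambda>q. B q a b) \<longlongrightarrow> B0 a b) F" and e: "0 < \<epsilon>"
  shows "\<forall>\<^sub>F q in F. \<forall>d. \<bar>sqrt (B q d d) - sqrt (B0 d d)\<bar> \<le> \<epsilon> * norm d"
proof -
  define n where "n = real DIM('e)"
  have n: "1 \<le> n" by (simp add: n_def DIM_positive Suc_leI)
  define \<delta> where "\<delta> = \<epsilon>\<^sup>2 / (n * n)"
  have d: "0 < \<delta>" using e n by (simp add: \<delta>_def)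
  have "\<forall>\<^sub>F q in F. \<forall>a\<in>Basis. \<forall>b\<in>Basis. \<bar>B q a b - B0 a b\<bar> \<le> \<delta>"
  proof (intro eventually_ball_finite ballI finite_Basis)
    fix a b :: 'e
    have "((\<lambda>q. \<bar>B q a b - B0 a b\<bar>) \<longlongrightarrow> 0) F"
      using lim[of a b] by (intro tendsto_rabs_zero LIM_zero)
    then show "\<forall>\<^sub>F q in F. \<bar>B q a b - B0 a b\<bar> \<le> \<delta>"
      by (rule order_tendstoD(2)[OF _ d, THEN eventually_mono]) auto
  qed
  then show ?thesis
    using B
  proof eventually_elim
    case (elim q)
    show ?case
    proof
      fix d :: 'e
      have lin: "linear (\<lambda>b. B q a b - B0 a b)" "linear (\<lambda>b. B q b a - B0 b a)" for a
        using elim(2) B0(1) unfolding bilinear_def by (auto intro: linear_compose_sub)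
      have 1: "norm (B q a d - B0 a d) \<le> n * \<delta> * norm d" if "a \<in> Basis" for a
        unfolding n_def using elim(1) that by (intro norm_linear_le_Basis[OF lin(1)]) auto
      have "norm (B q d d - B0 d d) \<le> n * (n * \<delta> * norm d) * norm d"
        unfolding n_def[symmetric] using norm_linear_le_Basis[OF lin(2) 1] unfolding n_def .
      also have "\<dots> = (\<epsilon> * norm d)\<^sup>2" using n by (simp add: \<delta>_def power2_eq_square)
      finally have le: "sqrt \<bar>B q d d - B0 d d\<bar> \<le> \<epsilon> * norm d"
        using e by (intro real_le_lsqrt) auto
      have sq: "\<bar>sqrt x - sqrt y\<bar> \<le> sqrt \<bar>x - y\<bar>" if "0 \<le> x" "0 \<le> y" for x y :: real
      proof -
        have "sqrt u \<le> sqrt v + sqrt (u - v)" if "0 \<le> v" "v \<le> u" for u v :: real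
          using sqrt_add_le_add_sqrt[of v "u - v"] that by simp
        from this[of x y] this[of y x] that show ?thesis
          by (cases "x \<le> y") auto
      qed
      show "\<bar>sqrt (B q d d) - sqrt (B0 d d)\<bar> \<le> \<epsilon> * norm d"
        by (rule order_trans[OF sq le]) (use elim(2) B0(2) in auto)
    qed
  qed
qed

section \<open>Bundles, metrics and maps in charts\<close>

text \<open>Reading tangent vectors in a single chart turns subspaces of the tangent space into subspaces of the
model space, which does not depend on the base point.\<close>

definition chart_part :: "('m, 'e) chart \<Rightarrow> ('m, 'e) tangent set \<Rightarrow> 'e set" where
  "chart_part c E = (\<lambda>v. v c) ` E"

lemma continuous_on_open_tendsto:
  assumes "continuous_on S h" "open S" "x \<in> S"
  shows "(h \<longlongrightarrow> h x) (nhds x)"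
proof -
  have "(h \<longlongrightarrow> h x) (at x)"
    using assms by (metis at_within_open continuous_on_def)
  then show ?thesis by (simp only: tendsto_at_iff_tendsto_nhds)
qed

lemma isCont_tendsto_nhds: "isCont h x \<Longrightarrow> (h \<longlongrightarrow> h x) (nhds x)"
  unfolding isCont_def by (simp only: tendsto_at_iff_tendsto_nhds)

lemma linear_chart_component: "linear (\<lambda>v :: ('m, 'e::euclidean_space) tangent. v c)"
  by (rule linearI) (simp_all add: scaleR_fun_def)

lemma tangent_of_chart_component:
  assumes "v \<in> tangent_space A x" "c \<in> charts_at A x"
  shows "tangent_of A c x (v c) = v"
proof
  fix c'
  show "tangent_of A c x (v c) c' = v c'"
  proof (cases "c' \<in> charts_at A x")
    case True
    then have "v c' = coord_diff c c' id x (v c)" using assms unfolding tangent_space_def by blast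
    then show ?thesis using True by (simp add: tangent_of_def)
  next
    case False
    then have "v c' = 0" using assms unfolding tangent_space_def by blast
    then show ?thesis using False by (simp add: tangent_of_def)
  qed
qed

lemma linear_tangent_of:
  assumes A: "smooth_atlas A" and c: "c \<in> charts_at A x"
  shows "linear (tangent_of A c x)"
proof -
  have lin: "linear (coord_diff c c' id x)" if "c' \<in> charts_at A x" for c'
    unfolding coord_diff_def
    by (intro linear_frechet_derivative transition_differentiable[OF A c that])
  show ?thesis
  proof (rule linearI)
    fix a b show "tangent_of A c x (a + b) = tangent_of A c x a + tangent_of A c x b"
      by (rule ext) (simp add: tangent_of_def linear_add[OF lin])
  next
    fix r a show "tangent_of A c x (r *\<^sub>R a) = r *\<^sub>R tangent_of A c x a"
      by (rule ext) (simp add: tangent_of_def scaleR_fun_def linear_cmul[OF lin])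
  qed
qed

lemma complementary_chart_part:
  assumes A: "smooth_atlas A" and c: "c \<in> charts_at A x"
    and sub: "subspace U" "U \<subseteq> tangent_space A x" "subspace S" "S \<subseteq> tangent_space A x"
    and dir: "U \<inter> S = {0}" "{\<xi> + \<eta> | \<xi> \<eta>. \<xi> \<in> U \<and> \<eta> \<in> S} = tangent_space A x"
  shows "complementary (chart_part c U) (chart_part c S)"
  unfolding complementary_def
proof (intro conjI allI)
  show ss: "subspace (chart_part c U)" "subspace (chart_part c S)"
    unfolding chart_part_def by (intro linear_subspace_image linear_chart_component sub)+
  have "w = 0" if w: "w \<in> chart_part c U" "w \<in> chart_part c S" for w
  proof -
    obtain u s where us: "u \<in> U" "s \<in> S" "w = u c" "w = s c"
      using w unfolding chart_part_def by auto
    then have "u = s"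
      using tangent_of_chart_component[OF _ c] sub(2,4) by (metis subsetD)
    then have "u \<in> U \<inter> S" using us by simp
    then have "u = 0" unfolding dir(1) by simp
    then show ?thesis using us(3) by simp
  qed
  then show "chart_part c U \<inter> chart_part c S = {0}"
    using ss by (auto simp: subspace_0)
  fix a
  have "tangent_of A c x a \<in> tangent_space A x" by (rule tangent_of_in_tangent_space(1)[OF A c])
  then obtain \<xi> \<eta> where d: "\<xi> \<in> U" "\<eta> \<in> S" "tangent_of A c x a = \<xi> + \<eta>"
    unfolding dir(2)[symmetric] by blast
  have "a = \<xi> c + \<eta> c"
    using arg_cong[OF d(3), of "\<lambda>v. v c"] tangent_of_in_tangent_space(2)[OF A c] by simp
  then have "a - \<xi> c = \<eta> c" by simp
  then show "\<exists>u\<in>chart_part c U. a - u \<in> chart_part c S"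
    using d(1,2) unfolding chart_part_def by (metis image_eqI)
qed

text \<open>The linear combination of a local frame with constant coefficients is a local section. The argument runs by
induction over the span of the frame, so that coefficients need not be named.\<close>

lemma subbundle_local_section:
  fixes E :: "'m::topological_space \<times> 'w::topological_space \<Rightarrow> ('m, 'e::euclidean_space) tangent set"
  assumes A: "smooth_atlas A" and E: "continuous_subbundle A E" and c: "c \<in> charts_at A (fst p)"
    and u: "u \<in> chart_part c (E p)"
  shows "\<exists>\<sigma>. (\<sigma> \<longlongrightarrow> u) (nhds p) \<and> (\<forall>\<^sub>F q in nhds p. \<sigma> q \<in> chart_part c (E q))"
proof -
  have sub: "subspace (E q)" for q using E unfolding continuous_subbundle_def by blast
  from E[unfolded continuous_subbundle_def, THEN conjunct2, THEN spec[of _ p]]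
  show ?thesis
  proof (elim exE)
    fix W k and e :: "nat \<Rightarrow> 'm \<times> 'w \<Rightarrow> ('m, 'e) tangent"
    assume frame: "open W \<and> p \<in> W \<and>
      (\<forall>i<k. \<forall>c\<in>A. continuous_on {q \<in> W. fst q \<in> fst c} (\<lambda>q. e i q c)) \<and>
      (\<forall>q\<in>W. inj_on (\<lambda>i. e i q) {..<k} \<and> independent ((\<lambda>i. e i q) ` {..<k}) \<and>
         span ((\<lambda>i. e i q) ` {..<k}) = E q)"
    have W: "open W" "p \<in> W"
      and ct: "\<And>i. i < k \<Longrightarrow> \<forall>c\<in>A. continuous_on {q \<in> W. fst q \<in> fst c} (\<lambda>q. e i q c)"
      and sp: "\<And>q. q \<in> W \<Longrightarrow> span ((\<lambda>i. e i q) ` {..<k}) = E q"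
      using frame by simp_all
    have cA: "c \<in> A" "fst p \<in> fst c" "open (fst c)"
      using c A by (auto simp: charts_at_def smooth_atlas_def is_chart_def)
    let ?W = "{q \<in> W. fst q \<in> fst c}"
    have "?W = W \<inter> fst -` fst c" by auto
    then have oW: "open ?W" using W(1) cA(3) by (auto intro!: open_Int open_vimage_fst)
    have pW: "p \<in> ?W" using W cA by simp
    let ?Q = "\<lambda>v. \<exists>\<sigma>. (\<forall>q\<in>W. \<sigma> q \<in> E q) \<and> ((\<lambda>q. \<sigma> q c) \<longlongrightarrow> v c) (nhds p)"
    obtain v where v: "v \<in> E p" "u = v c" using u unfolding chart_part_def by blast
    have "v \<in> span ((\<lambda>i. e i p) ` {..<k})" using v(1) sp[OF W(2)] by simp
    then have "?Q v"
    proof (induction rule: span_induct_alt)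
      case base
      show ?case using sub by (intro exI[of _ "\<lambda>_. 0"] conjI ballI subspace_0) (simp_all)
    next
      case (step r x y)
      obtain i where i: "i < k" "x = e i p" using step(1) by blast
      obtain \<sigma> where \<sigma>: "\<forall>q\<in>W. \<sigma> q \<in> E q" "((\<lambda>q. \<sigma> q c) \<longlongrightarrow> y c) (nhds p)" using step(2) by blast
      have ei: "e i q \<in> E q" if "q \<in> W" for q
        using sp[OF that] i(1) by (metis imageI lessThan_iff span_base)
      have "((\<lambda>q. e i q c) \<longlongrightarrow> x c) (nhds p)"
        using ct[OF i(1)] cA(1) oW pW unfolding i(2) by (intro continuous_on_open_tendsto) auto
      then have "((\<lambda>q. r *\<^sub>R e i q c + \<sigma> q c) \<longlongrightarrow> r *\<^sub>R x c + y c) (nhds p)"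
        by (intro tendsto_intros \<sigma>)
      moreover have m: "\<forall>q\<in>W. r *\<^sub>R e i q + \<sigma> q \<in> E q"
        using ei \<sigma>(1) sub by (intro ballI subspace_add subspace_scale) auto
      ultimately have l: "((\<lambda>q. (r *\<^sub>R e i q + \<sigma> q) c) \<longlongrightarrow> (r *\<^sub>R x + y) c) (nhds p)"
        by (simp add: scaleR_fun_def)
      show ?case by (intro exI[of _ "\<lambda>q. r *\<^sub>R e i q + \<sigma> q"] conjI m l)
    qed
    then obtain \<sigma> where \<sigma>: "\<forall>q\<in>W. \<sigma> q \<in> E q" "((\<lambda>q. \<sigma> q c) \<longlongrightarrow> u) (nhds p)" using v(2) by blast
    have "\<forall>\<^sub>F q in nhds p. q \<in> W" using W by (rule eventually_nhds_in_open)
    then have "\<forall>\<^sub>F q in nhds p. \<sigma> q c \<in> chart_part c (E q)"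
      by eventually_elim (use \<sigma>(1) in \<open>auto simp: chart_part_def\<close>)
    then show ?thesis using \<sigma>(2) by blast
  qed
qed

text \<open>The metric tensor in the coordinates of a chart.\<close>

definition chart_form ::
  "('m, 'e::euclidean_space) chart set \<Rightarrow> ('m \<Rightarrow> ('m, 'e) tangent \<Rightarrow> ('m, 'e) tangent \<Rightarrow> real) \<Rightarrow>
   ('m, 'e) chart \<Rightarrow> 'm \<Rightarrow> 'e \<Rightarrow> 'e \<Rightarrow> real" where
  "chart_form A g c x a b = g x (tangent_of A c x a) (tangent_of A c x b)"

lemma chart_form:
  assumes A: "smooth_atlas A" and g: "riemannian_metric A g" and c: "c \<in> charts_at A x"
  shows "bilinear (chart_form A g c x)"
    and "chart_form A g c x a b = chart_form A g c x b a"
    and "a \<noteq> 0 \<Longrightarrow> 0 < chart_form A g c x a a"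
proof -
  note T = tangent_of_in_tangent_space[OF A c]
  have G: "g x v w = g x w v" "v \<noteq> 0 \<Longrightarrow> g x v v > 0" "g x (r *\<^sub>R v) w = r * g x v w"
    "u \<in> tangent_space A x \<Longrightarrow> g x (u + v) w = g x u w + g x v w"
    if "v \<in> tangent_space A x" "w \<in> tangent_space A x" for u v w r
    using g that unfolding riemannian_metric_def by blast+
  note lin = linear_tangent_of[OF A c]
  show sym: "chart_form A g c x a b = chart_form A g c x b a" for a b
    unfolding chart_form_def by (rule G(1)[OF T(1) T(1)])
  have l: "linear (\<lambda>a. chart_form A g c x a b)" for b
    by (rule linearI)
      (simp_all add: chart_form_def linear_add[OF lin] linear_cmul[OF lin] G(3)[OF T(1) T(1)] G(4)[OF T(1) T(1) T(1)])
  moreover have "linear (\<lambda>b. chart_form A g c x a b)" for a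
    using l[of a] by (simp add: sym[of a])
  ultimately show "bilinear (chart_form A g c x)" by (simp add: bilinear_def)
  show "0 < chart_form A g c x a a" if "a \<noteq> 0"
  proof -
    have "tangent_of A c x a \<noteq> 0" using T(2)[of a] that by (metis zero_fun_apply)
    then show ?thesis unfolding chart_form_def by (rule G(2)[OF T(1) T(1)])
  qed
qed

lemma chart_form_tendsto:
  fixes A :: "('m::topological_space, 'e::euclidean_space) chart set"
  assumes A: "smooth_atlas A" and g: "riemannian_metric A g" and c: "c \<in> charts_at A x0"
  shows "((\<lambda>x. chart_form A g c x a b) \<longlongrightarrow> chart_form A g c x0 a b) (nhds x0)"
proof -
  have cA: "c \<in> A" "x0 \<in> fst c" "open (fst c)" "homeomorphism (fst c) (snd c ` fst c) (snd c) (chart_inv c)"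
    using c A by (auto simp: charts_at_def smooth_atlas_def is_chart_def)
  let ?h = "\<lambda>y. let x = chart_inv c y in g x (tangent_of A c x a) (tangent_of A c x b)"
  have "smooth_on (snd c ` fst c) ?h"
    using g cA(1) unfolding riemannian_metric_def by blast
  then have "Ck_on 0 (snd c ` fst c) ?h" unfolding smooth_on_def by blast
  then have "continuous_on (fst c) (?h \<circ> snd c)"
    using homeomorphism_cont1[OF cA(4)] by (intro continuous_on_compose) simp_all
  then have "continuous_on (fst c) (\<lambda>x. chart_form A g c x a b)"
    by (rule continuous_on_cong[THEN iffD1, rotated -1])
      (simp_all add: chart_form_def Let_def homeomorphism_apply1[OF cA(4)])
  then show ?thesis
    using cA(2,3) by (intro continuous_on_open_tendsto) auto
qed

text \<open>The mean value inequality for the difference of a map and a linear map to which all its derivatives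
are close.\<close>

lemma strict_differentiability:
  fixes F :: "'e::euclidean_space \<Rightarrow> 'e"
  assumes d: "\<And>y. y \<in> S \<Longrightarrow> F differentiable (at y)" and S: "convex S"
    and close: "\<And>y a. y \<in> S \<Longrightarrow> norm a \<le> 1 \<Longrightarrow> norm (frechet_derivative F (at y) a - D a) \<le> \<eta>"
    and D: "linear D" and y: "y1 \<in> S" "y2 \<in> S"
  shows "norm (F y1 - F y2 - D (y1 - y2)) \<le> \<eta> * norm (y1 - y2)"
proof -
  let ?G = "\<lambda>y. F y - D y"
  have bl: "bounded_linear D" using D by (simp add: linear_conv_bounded_linear)
  have "norm (?G y1 - ?G y2) \<le> \<eta> * norm (y1 - y2)"
  proof (rule differentiable_bound[OF S _ _ y])
    fix y assume yS: "y \<in> S"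
    let ?L = "\<lambda>a. frechet_derivative F (at y) a - D a"
    have "(F has_derivative frechet_derivative F (at y)) (at y)"
      using d[OF yS] frechet_derivative_works by blast
    then have "(F has_derivative frechet_derivative F (at y)) (at y within S)"
      by (rule has_derivative_at_withinI)
    then show hd: "(?G has_derivative ?L) (at y within S)"
      by (intro has_derivative_diff bounded_linear_imp_has_derivative[OF bl])
    have L: "linear ?L" using hd has_derivative_bounded_linear bounded_linear.linear by blast
    have "0 \<le> \<eta>" using order_trans[OF norm_ge_zero close[OF yS, of 0]] by simp
    show "onorm ?L \<le> \<eta>"
    proof (rule onorm_le)
      fix a
      show "norm (?L a) \<le> \<eta> * norm a"
      proof (cases "a = 0")
        case True
        then show ?thesis using linear_0[OF L] by simp
      next
        case False
        have a: "norm a *\<^sub>R sgn a = a" using False by (simp add: sgn_div_norm)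
        have "norm (?L (norm a *\<^sub>R sgn a)) = norm a * norm (?L (sgn a))"
          by (subst linear_cmul[OF L]) simp
        also have "\<dots> \<le> norm a * \<eta>"
          using close[OF yS, of "sgn a"] by (intro mult_left_mono) (simp_all add: norm_sgn)
        finally show ?thesis unfolding a by (simp add: mult.commute)
      qed
    qed
  qed
  then show ?thesis by (simp add: linear_diff[OF D] algebra_simps)
qed

text \<open>The derivative of \<open>f\<close> at \<open>\<omega>0\<close> is continuous, and by continuity of \<open>f\<close> into the \<open>C\<^sup>2\<close> topology the
derivatives at nearby \<open>\<omega>\<close> are uniformly close to it on a compact neighbourhood. So one linear map
approximates all differences of values near the point, for all \<open>\<omega>\<close> near \<open>\<omega>0\<close>.\<close>

lemma C2_family_strict_differentiability:
  fixes A :: "('m::topological_space, 'e::euclidean_space) chart set"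
    and f :: "'w::topological_space \<Rightarrow> 'm \<Rightarrow> 'm"
  assumes A: "smooth_atlas A" and f: "continuous_map euclidean (Diff2_topology A) f"
    and c: "c \<in> charts_at A x0" "c' \<in> charts_at A (f \<omega>0 x0)" and e: "0 < \<eta>"
  obtains \<rho> W where "0 < \<rho>" "open W" "\<omega>0 \<in> W" "cball (snd c x0) \<rho> \<subseteq> snd c ` fst c"
    "\<And>\<omega> y. \<omega> \<in> W \<Longrightarrow> y \<in> cball (snd c x0) \<rho> \<Longrightarrow> f \<omega> (chart_inv c y) \<in> fst c'"
    "\<And>\<omega> y. \<omega> \<in> W \<Longrightarrow> y \<in> cball (snd c x0) \<rho> \<Longrightarrow>
       norm (coord_rep c c' (f \<omega>) y - coord_rep c c' (f \<omega>0) (snd c x0)) \<le> \<eta>"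
    "\<And>\<omega> y1 y2. \<omega> \<in> W \<Longrightarrow> y1 \<in> cball (snd c x0) \<rho> \<Longrightarrow> y2 \<in> cball (snd c x0) \<rho> \<Longrightarrow>
       norm (coord_rep c c' (f \<omega>) y1 - coord_rep c c' (f \<omega>) y2 - coord_diff c c' (f \<omega>0) x0 (y1 - y2))
         \<le> \<eta> * norm (y1 - y2)"
proof -
  have cA: "c \<in> A" "x0 \<in> fst c" "open (fst c)" "homeomorphism (fst c) (snd c ` fst c) (snd c) (chart_inv c)" "is_chart c"
    and c'A: "c' \<in> A" "f \<omega>0 x0 \<in> fst c'" "open (fst c')"
    using c A by (auto simp: charts_at_def smooth_atlas_def is_chart_def)
  have diff2: "f \<omega> \<in> Diff2 A" for \<omega>
    using continuous_map_image_subset_topspace[OF f] Diff2_topspace[OF A] by auto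
  then have Ck: "Ck_map (Suc (Suc 0)) A (f \<omega>)" for \<omega>
    by (simp add: Diff2_def numeral_2_eq_2 del: Ck_map_def)
  define S where "S = snd c ` (fst c \<inter> f \<omega>0 -` fst c')"
  define y0 where "y0 = snd c x0"
  let ?F = "\<lambda>\<omega>. coord_rep c c' (f \<omega>)"
  have contf: "continuous_on UNIV (f \<omega>)" for \<omega> using Ck by (simp add: Ck_map_def)
  have "open S" "y0 \<in> S"
    unfolding S_def y0_def using open_chart_image[OF cA(5)] open_vimage[OF c'A(3) contf] cA(2) c'A(2) by auto
  have inv: "chart_inv c (snd c x) = x" if "x \<in> fst c" for x using homeomorphism_apply1[OF cA(4) that] .
  have mem: "chart_inv c y \<in> fst c" "snd c (chart_inv c y) = y" if "y \<in> snd c ` fst c" for y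
    using that inv by auto
  have CkS: "Ck_on (Suc (Suc 0)) (snd c ` (fst c \<inter> f \<omega> -` fst c')) (?F \<omega>)" for \<omega>
    using Ck cA(1) c'A(1) unfolding Ck_map_def by blast
  define D where "D = coord_diff c c' (f \<omega>0) x0"
  have dF: "?F \<omega> differentiable (at y)" if "y \<in> snd c ` (fst c \<inter> f \<omega> -` fst c')" for \<omega> y
    using CkS that unfolding Ck_on.simps by blast
  have linD: "linear D"
    unfolding D_def coord_diff_def using dF \<open>y0 \<in> S\<close> by (intro linear_frechet_derivative) (simp add: S_def y0_def)
  have cD: "isCont (\<lambda>y. frechet_derivative (?F \<omega>0) (at y) b) y0" for b
  proof -
    have "Ck_on (Suc 0) S (\<lambda>y. frechet_derivative (?F \<omega>0) (at y) b)"
      using CkS[of \<omega>0] unfolding S_def Ck_on.simps(2)[of "Suc 0"] by blast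
    then have "(\<lambda>y. frechet_derivative (?F \<omega>0) (at y) b) differentiable (at y0)"
      using \<open>y0 \<in> S\<close> unfolding Ck_on.simps by blast
    then show ?thesis by (rule differentiable_imp_continuous_within)
  qed
  define n where "n = real DIM('e)"
  have n: "1 \<le> n" by (simp add: n_def DIM_positive Suc_leI)
  define \<epsilon> where "\<epsilon> = \<eta> / 2"
  have e0: "0 < \<epsilon>" using e by (simp add: \<epsilon>_def)
  have en: "0 < \<epsilon> / n" using e0 n by simp
  have "\<forall>\<^sub>F y in nhds y0. \<forall>b\<in>Basis. dist (frechet_derivative (?F \<omega>0) (at y) b) (D b) < \<epsilon> / n"
  proof (intro eventually_ball_finite ballI finite_Basis)
    fix b
    have "((\<lambda>y. frechet_derivative (?F \<omega>0) (at y) b) \<longlongrightarrow> D b) (nhds y0)"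
      using isCont_tendsto_nhds[OF cD[of b]] by (simp add: D_def coord_diff_def y0_def)
    then show "\<forall>\<^sub>F y in nhds y0. dist (frechet_derivative (?F \<omega>0) (at y) b) (D b) < \<epsilon> / n"
      by (rule tendstoD[OF _ en])
  qed
  moreover have "\<forall>\<^sub>F y in nhds y0. y \<in> S" by (rule eventually_nhds_in_open) fact+
  moreover have "\<forall>\<^sub>F y in nhds y0. dist (?F \<omega>0 y) (?F \<omega>0 y0) < \<epsilon>"
  proof (rule tendstoD[OF _ e0])
    have "isCont (?F \<omega>0) y0"
      using dF \<open>y0 \<in> S\<close> unfolding S_def by (intro differentiable_imp_continuous_within) blast
    then show "(?F \<omega>0 \<longlongrightarrow> ?F \<omega>0 y0) (nhds y0)" by (rule isCont_tendsto_nhds)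
  qed
  ultimately have "\<forall>\<^sub>F y in nhds y0. y \<in> S \<and> dist (?F \<omega>0 y) (?F \<omega>0 y0) < \<epsilon> \<and>
      (\<forall>b\<in>Basis. dist (frechet_derivative (?F \<omega>0) (at y) b) (D b) < \<epsilon> / n)"
    by eventually_elim blast
  then obtain r where r: "0 < r" "\<And>y. dist y y0 < r \<Longrightarrow> y \<in> S \<and> dist (?F \<omega>0 y) (?F \<omega>0 y0) < \<epsilon> \<and>
      (\<forall>b\<in>Basis. dist (frechet_derivative (?F \<omega>0) (at y) b) (D b) < \<epsilon> / n)"
    unfolding eventually_nhds_metric by blast
  define \<rho> where "\<rho> = r / 2"
  have rho: "0 < \<rho>" using r(1) by (simp add: \<rho>_def)
  have ball: "y \<in> S" "dist (?F \<omega>0 y) (?F \<omega>0 y0) < \<epsilon>"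
      "\<And>b. b \<in> Basis \<Longrightarrow> dist (frechet_derivative (?F \<omega>0) (at y) b) (D b) < \<epsilon> / n"
    if "y \<in> cball y0 \<rho>" for y
    using r(2)[of y] that r(1) by (auto simp: \<rho>_def dist_commute)
  define K where "K = chart_inv c ` cball y0 \<rho>"
  have sub: "cball y0 \<rho> \<subseteq> snd c ` fst c" using ball(1) unfolding S_def by blast
  have K: "K \<subseteq> fst c" "f \<omega>0 ` K \<subseteq> fst c'" "snd c ` K = cball y0 \<rho>"
  proof -
    show "K \<subseteq> fst c" using sub mem(1) unfolding K_def by blast
    show "f \<omega>0 ` K \<subseteq> fst c'"
    proof
      fix z assume "z \<in> f \<omega>0 ` K"
      then obtain y where y: "y \<in> cball y0 \<rho>" "z = f \<omega>0 (chart_inv c y)" unfolding K_def by blast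
      then obtain x where "x \<in> fst c" "f \<omega>0 x \<in> fst c'" "y = snd c x" using ball(1)[OF y(1)] unfolding S_def by blast
      then show "z \<in> fst c'" using y(2) inv by simp
    qed
    show "snd c ` K = cball y0 \<rho>"
      unfolding K_def image_image using mem(2) sub by (simp cong: image_cong_simp add: subset_iff)
  qed
  have "compact K"
    unfolding K_def using homeomorphism_cont2[OF cA(4)] sub
    by (intro compact_continuous_image compact_cball) (rule continuous_on_subset)
  have 1: "openin (Diff2_topology A) (C2_nbhd A (f \<omega>0) c c' K \<epsilon>)"
    unfolding Diff2_topology_def
    by (rule topology_generated_by_Basis) (use diff2 cA c'A e0 K \<open>compact K\<close> in blast)
  define W where "W = {\<omega>. f \<omega> \<in> C2_nbhd A (f \<omega>0) c c' K \<epsilon>}"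
  have oW: "open W"
    using openin_continuous_map_preimage[OF f 1] by (simp add: W_def)
  have W0: "\<omega>0 \<in> W" using diff2 K e0 by (simp add: W_def C2_nbhd_def C2_close_on_def)
  have Wd: "f \<omega> (chart_inv c y) \<in> fst c'" "norm (?F \<omega>0 y - ?F \<omega> y) < \<epsilon>"
    "\<And>a. norm a \<le> 1 \<Longrightarrow> norm (frechet_derivative (?F \<omega>0) (at y) a - frechet_derivative (?F \<omega>) (at y) a) < \<epsilon>"
    if "\<omega> \<in> W" "y \<in> cball y0 \<rho>" for \<omega> y
  proof -
    have "f \<omega> ` K \<subseteq> fst c'" and cl: "C2_close_on (cball y0 \<rho>) \<epsilon> (?F \<omega>0) (?F \<omega>)"
      using that(1) unfolding W_def C2_nbhd_def K(3) by blast+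
    then show "f \<omega> (chart_inv c y) \<in> fst c'" using that(2) unfolding K_def by blast
    show "norm (?F \<omega>0 y - ?F \<omega> y) < \<epsilon>"
      "norm a \<le> 1 \<Longrightarrow> norm (frechet_derivative (?F \<omega>0) (at y) a - frechet_derivative (?F \<omega>) (at y) a) < \<epsilon>" for a
      using cl that(2) unfolding C2_close_on_def by blast+
  qed
  show thesis
  proof (rule that[of \<rho> W])
    show "0 < \<rho>" "open W" "\<omega>0 \<in> W" by fact+
    show "cball (snd c x0) \<rho> \<subseteq> snd c ` fst c" using sub by (simp add: y0_def)
    show "f \<omega> (chart_inv c y) \<in> fst c'" if "\<omega> \<in> W" "y \<in> cball (snd c x0) \<rho>" for \<omega> y
      using Wd(1) that by (simp add: y0_def)
    show "norm (?F \<omega> y - ?F \<omega>0 (snd c x0)) \<le> \<eta>" if w: "\<omega> \<in> W" and y: "y \<in> cball (snd c x0) \<rho>" for \<omega> y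
    proof -
      have "norm (?F \<omega> y - ?F \<omega>0 y0) \<le> norm (?F \<omega>0 y - ?F \<omega> y) + dist (?F \<omega>0 y) (?F \<omega>0 y0)"
        using norm_triangle_ineq4[of "?F \<omega>0 y - ?F \<omega>0 y0" "?F \<omega>0 y - ?F \<omega> y"] by (simp add: dist_norm)
      then show ?thesis using Wd(2)[OF w, of y] ball(2)[of y] y unfolding \<epsilon>_def y0_def[symmetric] by simp
    qed
    show "norm (?F \<omega> y1 - ?F \<omega> y2 - coord_diff c c' (f \<omega>0) x0 (y1 - y2)) \<le> \<eta> * norm (y1 - y2)"
      if w: "\<omega> \<in> W" and y: "y1 \<in> cball (snd c x0) \<rho>" "y2 \<in> cball (snd c x0) \<rho>" for \<omega> y1 y2
      unfolding D_def[symmetric]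
    proof (rule strict_differentiability[where F = "?F \<omega>" and S = "cball y0 \<rho>", OF _ convex_cball _ linD])
      fix y assume y: "y \<in> cball y0 \<rho>"
      have "y = snd c (chart_inv c y)" using mem(2) sub y by auto
      moreover have "chart_inv c y \<in> fst c \<inter> f \<omega> -` fst c'" using Wd(1)[OF w y] mem(1) sub y by auto
      ultimately show "?F \<omega> differentiable (at y)" by (intro dF) blast
      fix a :: 'e assume a: "norm a \<le> 1"
      have lin: "linear (frechet_derivative (?F \<omega>0) (at y))"
        using dF ball(1)[OF y] unfolding S_def by (intro linear_frechet_derivative) blast
      have "norm (frechet_derivative (?F \<omega>0) (at y) a - D a) \<le> n * (\<epsilon> / n) * norm a"
        unfolding n_def using ball(3)[OF y]
        by (intro norm_linear_le_Basis[OF linear_compose_sub[OF lin linD]]) (simp add: dist_norm n_def less_imp_le)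
      also have "\<dots> \<le> \<epsilon>" using n a e0 by (simp add: mult_left_le)
      finally show "norm (frechet_derivative (?F \<omega>) (at y) a - D a) \<le> \<eta>"
        using Wd(3)[OF w y a] norm_triangle_ineq4[of "frechet_derivative (?F \<omega>0) (at y) a - D a"
            "frechet_derivative (?F \<omega>0) (at y) a - frechet_derivative (?F \<omega>) (at y) a"]
        by (simp add: \<epsilon>_def)
    qed (use y in \<open>simp_all add: y0_def\<close>)
  qed
qed

section \<open>One step of a fibrewise Anosov family in charts\<close>

text \<open>A fibrewise Anosov family with a chosen splitting and rate.\<close>

locale anosov_fibres =
  fixes A :: "('m::{t2_space, second_countable_topology}, 'e::euclidean_space) chart set"
    and g :: "'m \<Rightarrow> ('m, 'e) tangent \<Rightarrow> ('m, 'e) tangent \<Rightarrow> real"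
    and f :: "'w::metric_space \<Rightarrow> 'm \<Rightarrow> 'm" and \<theta> :: "'w \<Rightarrow> 'w"
    and Eu Es :: "'m \<times> 'w \<Rightarrow> ('m, 'e) tangent set" and lam :: real
  assumes atlas: "smooth_atlas A" and metric: "riemannian_metric A g"
    and cont_f: "continuous_map euclidean (Diff2_topology A) f"
    and cont_theta: "continuous_on UNIV \<theta>"
    and subbundles: "continuous_subbundle A Eu" "continuous_subbundle A Es"
    and lam: "0 < lam"
    and splitting: "Eu (x, \<omega>) \<inter> Es (x, \<omega>) = {0}"
      "{\<xi> + \<eta> | \<xi> \<eta>. \<xi> \<in> Eu (x, \<omega>) \<and> \<eta> \<in> Es (x, \<omega>)} = tangent_space A x"
    and invariance: "tangent_map A (f \<omega>) x ` Eu (x, \<omega>) = Eu (f \<omega> x, \<theta> \<omega>)"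
      "tangent_map A (f \<omega>) x ` Es (x, \<omega>) = Es (f \<omega> x, \<theta> \<omega>)"
    and expansion: "\<xi> \<in> Eu (x, \<omega>) \<Longrightarrow>
        exp lam * riemannian_norm g x \<xi> \<le> riemannian_norm g (f \<omega> x) (tangent_map A (f \<omega>) x \<xi>)"
    and contraction: "\<eta> \<in> Es (x, \<omega>) \<Longrightarrow>
        riemannian_norm g (f \<omega> x) (tangent_map A (f \<omega>) x \<eta>) \<le> exp (- lam) * riemannian_norm g x \<eta>"
begin

definition chart_proj :: "('m, 'e) chart \<Rightarrow> 'm \<times> 'w \<Rightarrow> 'e \<Rightarrow> 'e" where
  "chart_proj c p = proj_along (chart_part c (Eu p)) (chart_part c (Es p))"

definition chart_norm :: "('m, 'e) chart \<Rightarrow> 'm \<Rightarrow> 'e \<Rightarrow> real" where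
  "chart_norm c x d = sqrt (chart_form A g c x d d)"

definition chart_adapted :: "('m, 'e) chart \<Rightarrow> 'm \<times> 'w \<Rightarrow> 'e \<Rightarrow> real" where
  "chart_adapted c p = split_norm (chart_norm c (fst p)) (chart_proj c p)"

text \<open>Any number strictly between \<open>exp (- lam)\<close> and \<open>1\<close> would do: the gap to the former absorbs the
perturbations, the gap to the latter gives the contraction.\<close>

definition rate :: real where "rate = (1 + exp (- lam)) / 2"

lemma rate: "exp (- lam) < rate" "0 < rate" "rate < 1"
  using lam by (auto simp: rate_def add_pos_pos)

text \<open>The map \<open>f\<^sub>\<omega>\<close> in coordinates centred at \<open>x\<close> in the source and at \<open>x'\<close> in the target. The value
at \<open>0\<close> is the jump of a chain that moves from \<open>x\<close> to \<open>x'\<close>.\<close>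

definition local_map :: "('m, 'e) chart \<Rightarrow> ('m, 'e) chart \<Rightarrow> 'w \<Rightarrow> 'm \<Rightarrow> 'm \<Rightarrow> 'e \<Rightarrow> 'e" where
  "local_map c c' \<omega> x x' a = coord_rep c c' (f \<omega>) (snd c x + a) - snd c' x'"

text \<open>The triple \<open>((x, \<omega>), x')\<close> stands for a step of a chain over \<open>\<omega>\<close> from \<open>x\<close> to \<open>x'\<close>, where \<open>x'\<close> need not be
\<open>f\<^sub>\<omega> x\<close>. The map in coordinates must be defined on the whole ball of radius \<open>r\<close> and
be hyperbolic there, with respect to the splittings over \<open>\<omega>\<close> at \<open>x\<close> and over \<open>\<theta> \<omega>\<close> at \<open>x'\<close>.\<close>

definition good_step :: "real \<Rightarrow> ('m, 'e) chart \<Rightarrow> ('m, 'e) chart \<Rightarrow> ('m \<times> 'w) \<times> 'm \<Rightarrow> bool" where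
  "good_step r c c' t \<longleftrightarrow> (case t of ((x, \<omega>), x') \<Rightarrow>
     (\<forall>a\<in>cball 0 r. snd c x + a \<in> snd c ` fst c \<and> f \<omega> (chart_inv c (snd c x + a)) \<in> fst c') \<and>
     (\<exists>R. hyperbolic_step rate r (chart_adapted c (x, \<omega>)) (chart_proj c (x, \<omega>))
        (chart_adapted c' (x', \<theta> \<omega>)) (chart_proj c' (x', \<theta> \<omega>)) R (local_map c c' \<omega> x x')))"

lemma chartD:
  assumes "c \<in> charts_at A x"
  shows "c \<in> A" "x \<in> fst c" "open (fst c)" "homeomorphism (fst c) (snd c ` fst c) (snd c) (chart_inv c)"
    "open (snd c ` fst c)"
  using assms atlas by (auto simp: charts_at_def smooth_atlas_def is_chart_def)

lemma diff2: "f \<omega> \<in> Diff2 A"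
  using continuous_map_image_subset_topspace[OF cont_f] Diff2_topspace[OF atlas] by auto

lemma Ck_f: "Ck_map (Suc 1) A (f \<omega>)"
  using diff2[of \<omega>] by (simp add: Diff2_def numeral_2_eq_2)

lemma bundle_sub: "subspace (Eu p)" "subspace (Es p)" "Eu p \<subseteq> tangent_space A (fst p)" "Es p \<subseteq> tangent_space A (fst p)"
  using subbundles unfolding continuous_subbundle_def by blast+

lemma complementary: "c \<in> charts_at A (fst p) \<Longrightarrow> complementary (chart_part c (Eu p)) (chart_part c (Es p))"
  by (rule complementary_chart_part[OF atlas _ bundle_sub(1,3,2,4)])
    (use splitting[of "fst p" "snd p"] in auto)

lemma chart_proj_eventually_close:
  assumes c: "c \<in> charts_at A (fst p)" and e: "0 < \<epsilon>"
  shows "\<forall>\<^sub>F q in nhds p. \<forall>d. norm (chart_proj c q d - chart_proj c p d) \<le> \<epsilon> * norm d"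
  unfolding chart_proj_def
proof (rule proj_along_eventually_close[OF _ complementary[OF c]
      subbundle_local_section[OF atlas subbundles(1) c] subbundle_local_section[OF atlas subbundles(2) c] e])
  have "open (fst -` fst c :: ('m \<times> 'w) set)" using chartD[OF c] by (intro open_vimage_fst)
  then have "\<forall>\<^sub>F q in nhds p. q \<in> fst -` fst c" by (rule eventually_nhds_in_open) (use chartD[OF c] in simp)
  then show "\<forall>\<^sub>F q in nhds p. complementary (chart_part c (Eu q)) (chart_part c (Es q))"
    by eventually_elim (rule complementary, use c in \<open>simp add: charts_at_def\<close>)
qed

lemma chart_form_nonneg: "c \<in> charts_at A x \<Longrightarrow> 0 \<le> chart_form A g c x d d"
  using chart_form(1,3)[OF atlas metric, of c x] bilinear_lzero[of "chart_form A g c x" 0]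
  by (cases "d = 0") (auto intro: less_imp_le)

lemma chart_norm_eventually_close:
  assumes c: "c \<in> charts_at A x" and e: "0 < \<epsilon>"
  shows "\<forall>\<^sub>F y in nhds x. \<forall>d. \<bar>chart_norm c y d - chart_norm c x d\<bar> \<le> \<epsilon> * norm d"
  unfolding chart_norm_def
proof (rule sqrt_form_eventually_close[OF _ chart_form(1)[OF atlas metric c] chart_form_nonneg[OF c]
      chart_form_tendsto[OF atlas metric c] e])
  have "\<forall>\<^sub>F y in nhds x. y \<in> fst c" by (rule eventually_nhds_in_open) (use chartD[OF c] in auto)
  then show "\<forall>\<^sub>F y in nhds x. bilinear (chart_form A g c y) \<and> (\<forall>d. 0 \<le> chart_form A g c y d d)"
  proof eventually_elim
    case (elim y)
    then have "c \<in> charts_at A y" using c by (simp add: charts_at_def)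
    then show ?case using chart_form(1)[OF atlas metric] chart_form_nonneg by blast
  qed
qed

lemma even_subadditive_chart_norm: "c \<in> charts_at A x \<Longrightarrow> even_subadditive (chart_norm c x)"
  unfolding chart_norm_def by (intro even_subadditive_sqrt_form chart_form[OF atlas metric])

lemma chart_norm_component:
  "c \<in> charts_at A x \<Longrightarrow> v \<in> tangent_space A x \<Longrightarrow> chart_norm c x (v c) = riemannian_norm g x v"
  by (simp add: chart_norm_def chart_form_def riemannian_norm_def tangent_of_chart_component)

lemma coord_diff_hyperbolic:
  assumes c: "c \<in> charts_at A x" "c' \<in> charts_at A (f \<omega> x)"
  defines "D \<equiv> coord_diff c c' (f \<omega>) x"
  shows "linear D"
    and "D ` chart_part c (Eu (x, \<omega>)) = chart_part c' (Eu (f \<omega> x, \<theta> \<omega>))"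
    and "D ` chart_part c (Es (x, \<omega>)) = chart_part c' (Es (f \<omega> x, \<theta> \<omega>))"
    and "a \<in> chart_part c (Eu (x, \<omega>)) \<Longrightarrow> exp lam * chart_norm c x a \<le> chart_norm c' (f \<omega> x) (D a)"
    and "a \<in> chart_part c (Es (x, \<omega>)) \<Longrightarrow> chart_norm c' (f \<omega> x) (D a) \<le> exp (- lam) * chart_norm c x a"
proof -
  show "linear D"
    unfolding D_def coord_diff_def by (intro linear_frechet_derivative Ck_map_differentiable[OF Ck_f c])
  have T: "tangent_map A (f \<omega>) x v c' = D (v c)" if "v \<in> tangent_space A x" for v
    unfolding D_def by (rule tangent_map_chart[OF atlas Ck_f that c])
  have T': "tangent_map A (f \<omega>) x v \<in> tangent_space A (f \<omega> x)" if "v \<in> tangent_space A x" for v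
    by (rule tangent_map_in_tangent_space[OF atlas Ck_f that])
  have sub: "Eu (x, \<omega>) \<subseteq> tangent_space A x" "Es (x, \<omega>) \<subseteq> tangent_space A x"
    using bundle_sub[of "(x, \<omega>)"] by simp_all
  have im: "D ` chart_part c E = chart_part c' (tangent_map A (f \<omega>) x ` E)" if "E \<subseteq> tangent_space A x" for E
    unfolding chart_part_def image_image using T that by (intro image_cong) auto
  show "D ` chart_part c (Eu (x, \<omega>)) = chart_part c' (Eu (f \<omega> x, \<theta> \<omega>))"
    "D ` chart_part c (Es (x, \<omega>)) = chart_part c' (Es (f \<omega> x, \<theta> \<omega>))"
    using im[OF sub(1)] im[OF sub(2)] invariance by simp_all
  have N: "chart_norm c' (f \<omega> x) (D (v c)) = riemannian_norm g (f \<omega> x) (tangent_map A (f \<omega>) x v)"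
    if "v \<in> tangent_space A x" for v
    using chart_norm_component[OF c(2) T'[OF that]] T[OF that] by simp
  show "exp lam * chart_norm c x a \<le> chart_norm c' (f \<omega> x) (D a)" if a: "a \<in> chart_part c (Eu (x, \<omega>))"
  proof -
    obtain v where v: "v \<in> Eu (x, \<omega>)" "a = v c" using a unfolding chart_part_def by blast
    then have "v \<in> tangent_space A x" using sub by blast
    then show ?thesis using expansion[OF v(1)] N chart_norm_component[OF c(1)] v(2) by simp
  qed
  show "chart_norm c' (f \<omega> x) (D a) \<le> exp (- lam) * chart_norm c x a" if a: "a \<in> chart_part c (Es (x, \<omega>))"
  proof -
    obtain v where v: "v \<in> Es (x, \<omega>)" "a = v c" using a unfolding chart_part_def by blast
    then have "v \<in> tangent_space A x" using sub by blast
    then show ?thesis using contraction[OF v(1)] N chart_norm_component[OF c(1)] v(2) by simp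
  qed
qed

text \<open>Invariance of the splitting says that the derivative intertwines the two projections.\<close>

lemma coord_diff_proj:
  assumes c: "c \<in> charts_at A x" "c' \<in> charts_at A (f \<omega> x)"
  shows "chart_proj c' (f \<omega> x, \<theta> \<omega>) (coord_diff c c' (f \<omega>) x d) = coord_diff c c' (f \<omega>) x (chart_proj c (x, \<omega>) d)"
proof -
  note H = coord_diff_hyperbolic[OF c]
  let ?D = "coord_diff c c' (f \<omega>) x" and ?P = "chart_proj c (x, \<omega>)"
  have comp: "complementary (chart_part c (Eu (x, \<omega>))) (chart_part c (Es (x, \<omega>)))"
    "complementary (chart_part c' (Eu (f \<omega> x, \<theta> \<omega>))) (chart_part c' (Es (f \<omega> x, \<theta> \<omega>)))"
    using complementary[of c "(x, \<omega>)"] complementary[of c' "(f \<omega> x, \<theta> \<omega>)"] c by simp_all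
  note mem = proj_along_mem[OF comp(1), of d, folded chart_proj_def]
  have "?D (?P d) \<in> chart_part c' (Eu (f \<omega> x, \<theta> \<omega>))" using imageI[OF mem(1), of ?D] H(2) by simp
  moreover have "?D d - ?D (?P d) \<in> chart_part c' (Es (f \<omega> x, \<theta> \<omega>))"
    using imageI[OF mem(2), of ?D] H(3) linear_diff[OF H(1)] by simp
  ultimately show ?thesis
    unfolding chart_proj_def by (rule proj_along_unique[OF comp(2)])
qed

text \<open>The derivative is surjective because it maps the two bundles onto the two bundles; equality of
dimensions does the rest.\<close>

lemma coord_diff_inverse:
  assumes c: "c \<in> charts_at A x" "c' \<in> charts_at A (f \<omega> x)"
  obtains R where "linear R" "\<And>d. R (coord_diff c c' (f \<omega>) x d) = d" "\<And>d. coord_diff c c' (f \<omega>) x (R d) = d"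
proof -
  note H = coord_diff_hyperbolic[OF c]
  let ?D = "coord_diff c c' (f \<omega>) x"
  have comp: "complementary (chart_part c' (Eu (f \<omega> x, \<theta> \<omega>))) (chart_part c' (Es (f \<omega> x, \<theta> \<omega>)))"
    using complementary[of c' "(f \<omega> x, \<theta> \<omega>)"] c by simp
  have "surj ?D"
    unfolding surj_def
  proof (rule allI)
    fix y
    obtain u where u: "u \<in> chart_part c' (Eu (f \<omega> x, \<theta> \<omega>))" "y - u \<in> chart_part c' (Es (f \<omega> x, \<theta> \<omega>))"
      using comp unfolding complementary_def by blast
    then obtain a b where "u = ?D a" "y - u = ?D b" unfolding H(2,3)[symmetric] by blast
    then have "y = ?D (a + b)" using linear_add[OF H(1)] by (metis add_diff_cancel_left' diff_add_cancel add.commute)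
    then show "\<exists>x. y = ?D x" by blast
  qed
  then obtain R where "linear R" "\<forall>d. R (?D d) = d" "\<forall>d. ?D (R d) = d"
    using linear_surjective_isomorphism[OF H(1)] by blast
  then show thesis by (intro that) auto
qed

text \<open>In charts this is the \<open>C\<^sup>0\<close> part of the continuity of \<open>f\<close> into the \<open>C\<^sup>2\<close> topology.\<close>

lemma joint_continuity: "continuous_on UNIV (\<lambda>p. f (snd p) (fst p))"
  unfolding continuous_on_def
proof (intro ballI)
  fix p0 :: "'m \<times> 'w"
  obtain x0 \<omega>0 where p0: "p0 = (x0, \<omega>0)" by fastforce
  obtain c c' where c: "c \<in> charts_at A x0" "c' \<in> charts_at A (f \<omega>0 x0)"
    using atlas unfolding smooth_atlas_def charts_at_def by blast
  note C = chartD[OF c(1)] and C' = chartD[OF c(2)]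
  have snd_tendsto: "(snd c \<longlongrightarrow> snd c x0) (nhds x0)"
    using C(2,3) homeomorphism_cont1[OF C(4)] by (intro continuous_on_open_tendsto)
  let ?F = "\<lambda>p. coord_rep c c' (f (snd p)) (snd c (fst p))"
  have ev: "\<exists>\<rho> W. 0 < \<rho> \<and> open W \<and> \<omega>0 \<in> W \<and> (\<forall>x\<in>fst c. dist (snd c x) (snd c x0) < \<rho> \<longrightarrow> (\<forall>\<omega>\<in>W. 
      f \<omega> x \<in> fst c' \<and> dist (?F (x, \<omega>)) (?F p0) \<le> \<eta>))" if "0 < \<eta>" for \<eta>
  proof -
    obtain \<rho> W where *: "0 < \<rho>" "open W" "\<omega>0 \<in> W" 
      "\<And>\<omega> y. \<omega> \<in> W \<Longrightarrow> y \<in> cball (snd c x0) \<rho> \<Longrightarrow> f \<omega> (chart_inv c y) \<in> fst c'"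
      "\<And>\<omega> y. \<omega> \<in> W \<Longrightarrow> y \<in> cball (snd c x0) \<rho> \<Longrightarrow>
       norm (coord_rep c c' (f \<omega>) y - coord_rep c c' (f \<omega>0) (snd c x0)) \<le> \<eta>"
      by (rule C2_family_strict_differentiability[OF atlas cont_f c \<open>0 < \<eta>\<close>]) (rule that)
    show ?thesis
    proof (intro exI[of _ \<rho>] exI[of _ W] conjI ballI impI *)
      fix x \<omega> assume x: "x \<in> fst c" "dist (snd c x) (snd c x0) < \<rho>" "\<omega> \<in> W"
      then have b: "snd c x \<in> cball (snd c x0) \<rho>" by (simp add: dist_commute)
      show "f \<omega> x \<in> fst c'" using *(4)[OF x(3) b] homeomorphism_apply1[OF C(4) x(1)] by simp
      show "dist (?F (x, \<omega>)) (?F p0) \<le> \<eta>" using *(5)[OF x(3) b] by (simp add: p0 dist_norm)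
    qed
  qed
  have near: "\<forall>\<^sub>F p in nhds p0. f (snd p) (fst p) \<in> fst c' \<and> fst p \<in> fst c \<and> dist (?F p) (?F p0) \<le> \<eta>" if e: "0 < \<eta>" for \<eta>
  proof -
    from ev[OF e] obtain \<rho> W where *: "0 < \<rho>" "open W" "\<omega>0 \<in> W"
      "\<And>x \<omega>. x \<in> fst c \<Longrightarrow> dist (snd c x) (snd c x0) < \<rho> \<Longrightarrow> \<omega> \<in> W \<Longrightarrow>
        f \<omega> x \<in> fst c' \<and> dist (?F (x, \<omega>)) (?F p0) \<le> \<eta>" by blast
    have 1: "\<forall>\<^sub>F x in nhds x0. dist (snd c x) (snd c x0) < \<rho> \<and> x \<in> fst c"
      using C(2,3) by (intro eventually_conj tendstoD[OF snd_tendsto *(1)] eventually_nhds_in_open) auto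
    have 2: "\<forall>\<^sub>F \<omega> in nhds \<omega>0. \<omega> \<in> W" using * by (intro eventually_nhds_in_open)
    have "\<forall>\<^sub>F p in nhds p0. (dist (snd c (fst p)) (snd c x0) < \<rho> \<and> fst p \<in> fst c) \<and> snd p \<in> W"
      unfolding p0 nhds_prod by (rule eventually_prodI[OF 1 2])
    then show ?thesis
      by eventually_elim (use *(4) in \<open>auto simp: prod.collapse\<close>)
  qed
  have F: "(?F \<longlongrightarrow> ?F p0) (nhds p0)"
  proof (rule tendstoI)
    fix e :: real assume "0 < e"
    then have "\<forall>\<^sub>F p in nhds p0. dist (?F p) (?F p0) \<le> e / 2"
      using near[of "e / 2"] by (auto elim: eventually_mono)
    then show "\<forall>\<^sub>F p in nhds p0. dist (?F p) (?F p0) < e"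
      by eventually_elim (use \<open>0 < e\<close> in simp)
  qed
  have Fp0: "?F p0 = snd c' (f \<omega>0 x0)" using homeomorphism_apply1[OF C(4) C(2)] by (simp add: p0 coord_rep_def)
  have "(chart_inv c' \<longlongrightarrow> chart_inv c' (?F p0)) (nhds (?F p0))"
    unfolding Fp0 using C' homeomorphism_cont2[OF C'(4)] by (intro continuous_on_open_tendsto) auto
  then have lim: "((\<lambda>p. chart_inv c' (?F p)) \<longlongrightarrow> chart_inv c' (?F p0)) (nhds p0)"
    by (rule filterlim_compose[OF _ F])
  have eqv: "\<forall>\<^sub>F p in nhds p0. chart_inv c' (?F p) = f (snd p) (fst p)"
    using near[OF zero_less_one]
    by eventually_elim (simp add: coord_rep_def homeomorphism_apply1[OF C(4)] homeomorphism_apply1[OF C'(4)])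
  have "chart_inv c' (?F p0) = f (snd p0) (fst p0)"
    using homeomorphism_apply1[OF C'(4) C'(2)] by (simp add: Fp0) (simp add: p0)
  then have "((\<lambda>p. f (snd p) (fst p)) \<longlongrightarrow> f (snd p0) (fst p0)) (nhds p0)"
    using tendsto_cong[OF eqv] lim by simp
  then show "((\<lambda>p. f (snd p) (fst p)) \<longlongrightarrow> f (snd p0) (fst p0)) (at p0 within UNIV)"
    using tendsto_at_iff_tendsto_nhds[of "\<lambda>p. f (snd p) (fst p)" p0] by simp
qed

text \<open>At the base point, with \<open>x' = f\<^sub>\<omega> x\<close>, the derivative carries the splitting to the splitting and
expands and contracts by \<open>exp lam\<close> in one step. Everything that enters depends continuously on \<open>x\<close>,
\<open>\<omega>\<close> and \<open>x'\<close>, so the perturbation lemma applies to all nearby triples with the derivative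
at the base point as the common linear map.\<close>

lemma local_good_step:
  assumes c: "c \<in> charts_at A x0" "c' \<in> charts_at A (f \<omega>0 x0)"
  shows "\<exists>r>0. \<forall>\<^sub>F t in nhds ((x0, \<omega>0), f \<omega>0 x0). good_step r c c' t"
proof -
  define z0 where "z0 = f \<omega>0 x0"
  define D where "D = coord_diff c c' (f \<omega>0) x0"
  have c': "c' \<in> charts_at A z0" using c(2) by (simp add: z0_def)
  note H = coord_diff_hyperbolic[OF c, folded D_def z0_def]
  note C = chartD[OF c(1)] and C' = chartD[OF c']
  obtain R where R: "linear R" "\<And>d. R (D d) = d" "\<And>d. D (R d) = d"
    using coord_diff_inverse[OF c] unfolding D_def by blast
  let ?P0 = "chart_proj c (x0, \<omega>0)" and ?P0' = "chart_proj c' (z0, \<theta> \<omega>0)"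
  have comp: "complementary (chart_part d (Eu q)) (chart_part d (Es q))" if "d \<in> charts_at A (fst q)" for d q
    using complementary that .
  have linP: "bounded_linear (chart_proj d q)" and idP: "chart_proj d q (chart_proj d q a) = chart_proj d q a"
    if "d \<in> charts_at A (fst q)" for d q a
    unfolding chart_proj_def linear_conv_bounded_linear[symmetric]
    using linear_proj_along[OF comp[OF that]] proj_along_fixes(1)[OF comp[OF that] proj_along_mem(1)[OF comp[OF that]]] by auto
  have c0: "c \<in> charts_at A (fst (x0, \<omega>0))" "c' \<in> charts_at A (fst (z0, \<theta> \<omega>0))" using c(1) c' by simp_all
  obtain m1 b1 where b1: "0 < m1" "\<And>a. m1 * norm a \<le> chart_norm c x0 a" "\<And>a. chart_norm c x0 a \<le> b1 * norm a"
    using sqrt_form_bounds[OF chart_form(1,3)[OF atlas metric c(1)]] unfolding chart_norm_def by blast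
  obtain m2 b2 where b2: "0 < m2" "\<And>a. m2 * norm a \<le> chart_norm c' z0 a" "\<And>a. chart_norm c' z0 a \<le> b2 * norm a"
    using sqrt_form_bounds[OF chart_form(1,3)[OF atlas metric c']] unfolding chart_norm_def by blast
  define m where "m = min 1 (min m1 m2)"
  define b where "b = max b1 b2"
  have mb: "m \<le> m1" "m \<le> m2" "b1 \<le> b" "b2 \<le> b" by (simp_all add: m_def b_def)
  have lo: "m * norm d \<le> chart_norm c x0 d" "m * norm d \<le> chart_norm c' z0 d" for d
    using b1(2)[of d] b2(2)[of d] mult_right_mono[OF mb(1), of "norm d"] mult_right_mono[OF mb(2), of "norm d"]
    by simp_all
  have up: "chart_norm c x0 d \<le> b * norm d" "chart_norm c' z0 d \<le> b * norm d" for d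
    using b1(3)[of d] b2(3)[of d] mult_right_mono[OF mb(3), of "norm d"] mult_right_mono[OF mb(4), of "norm d"]
    by simp_all
  have comm: "?P0' (D d) = D (?P0 d)" for d
    using coord_diff_proj[OF c] by (simp add: D_def z0_def)
  have contr: "chart_norm c' z0 (D (d - ?P0 d)) \<le> exp (- lam) * chart_norm c x0 (d - ?P0 d)" for d
    unfolding chart_proj_def by (intro H(5) proj_along_mem(2) comp c0)
  have expan: "chart_norm c x0 (R (?P0' w)) \<le> exp (- lam) * chart_norm c' z0 (?P0' w)" for w
  proof -
    have "?P0' w \<in> chart_part c' (Eu (z0, \<theta> \<omega>0))"
      unfolding chart_proj_def by (intro proj_along_mem(1) comp c0)
    then obtain a where a: "a \<in> chart_part c (Eu (x0, \<omega>0))" "?P0' w = D a"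
      unfolding H(2)[symmetric] by blast
    have "exp (- lam) * (exp lam * chart_norm c x0 a) \<le> exp (- lam) * chart_norm c' z0 (D a)"
      using H(4)[OF a(1)] by (intro mult_left_mono) auto
    then show ?thesis unfolding a(2) R(2) by (simp add: mult.assoc[symmetric] exp_minus_inverse mult.commute[of "exp (- lam)"])
  qed
  have m: "0 < m" "m \<le> 1" using b1 b2 by (simp_all add: m_def)
  have bl: "bounded_linear D" "bounded_linear R"
    using H(1) R(1) by (simp_all add: linear_conv_bounded_linear)
  show ?thesis
  proof (rule hyperbolic_step_perturb[where D = D and R = R and ?P0.0 = ?P0 and P0' = ?P0'
        and ?N0.0 = "chart_norm c x0" and N0' = "chart_norm c' z0" and \<mu> = "exp (- lam)" and \<kappa> = rate,
        OF bl linP[OF c0(1)] linP[OF c0(2)] R(2,3) comm m lo up contr expan exp_gt_zero rate(1,3)])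
    fix \<eta> :: real
    assume eta: "0 < \<eta>" and step: "\<And>P P' N N' h r. 
     \<lbrakk>bounded_linear P; \<And>d. P (P d) = P d; bounded_linear P'; \<And>d. P' (P' d) = P' d;
      even_subadditive N; even_subadditive N';
      \<And>d. norm (P d - ?P0 d) \<le> \<eta> * norm d; \<And>d. norm (P' d - ?P0' d) \<le> \<eta> * norm d;
      \<And>d. \<bar>N d - chart_norm c x0 d\<bar> \<le> \<eta> * norm d; \<And>d. \<bar>N' d - chart_norm c' z0 d\<bar> \<le> \<eta> * norm d;
      0 < r; r \<le> \<eta>;
      \<And>a b. a \<in> cball 0 r \<Longrightarrow> b \<in> cball 0 r \<Longrightarrow> norm (h a - h b - D (a - b)) \<le> \<eta> * norm (a - b)\<rbrakk>
     \<Longrightarrow> hyperbolic_step rate r (split_norm N P) P (split_norm N' P') P' R h"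
    obtain \<rho> W where F: "0 < \<rho>" "open W" "\<omega>0 \<in> W" "cball (snd c x0) \<rho> \<subseteq> snd c ` fst c"
      "\<And>\<omega> y. \<omega> \<in> W \<Longrightarrow> y \<in> cball (snd c x0) \<rho> \<Longrightarrow> f \<omega> (chart_inv c y) \<in> fst c'"
      "\<And>\<omega> y1 y2. \<omega> \<in> W \<Longrightarrow> y1 \<in> cball (snd c x0) \<rho> \<Longrightarrow> y2 \<in> cball (snd c x0) \<rho> \<Longrightarrow>
         norm (coord_rep c c' (f \<omega>) y1 - coord_rep c c' (f \<omega>) y2 - D (y1 - y2)) \<le> \<eta> * norm (y1 - y2)"
      by (rule C2_family_strict_differentiability[OF atlas cont_f c eta, folded D_def]) (rule that)
    define r where "r = min \<eta> (\<rho> / 2)"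
    have r: "0 < r" "r \<le> \<eta>" "r \<le> \<rho> / 2" using eta F(1) by (auto simp: r_def)
    let ?F = "nhds ((x0, \<omega>0), z0)"
    have l1: "((\<lambda>t. fst t) \<longlongrightarrow> (x0, \<omega>0)) ?F" "((\<lambda>t. snd t) \<longlongrightarrow> z0) ?F"
      "((\<lambda>t. fst (fst t)) \<longlongrightarrow> x0) ?F" "((\<lambda>t. snd (fst t)) \<longlongrightarrow> \<omega>0) ?F"
      using tendsto_fst[of "\<lambda>t. t" "((x0, \<omega>0), z0)" ?F] tendsto_snd[of "\<lambda>t. t" "((x0, \<omega>0), z0)" ?F]
        tendsto_fst[OF tendsto_fst[of "\<lambda>t. t" "((x0, \<omega>0), z0)" ?F]]
        tendsto_snd[OF tendsto_fst[of "\<lambda>t. t" "((x0, \<omega>0), z0)" ?F]]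
      by (simp_all add: filterlim_ident)
    have "(\<theta> \<longlongrightarrow> \<theta> \<omega>0) (nhds \<omega>0)"
      using cont_theta by (intro continuous_on_open_tendsto) auto
    then have l2: "((\<lambda>t. (snd t, \<theta> (snd (fst t)))) \<longlongrightarrow> (z0, \<theta> \<omega>0)) ?F"
      by (intro tendsto_Pair l1 filterlim_compose[OF _ l1(4)])
    have l3: "((\<lambda>t. snd c (fst (fst t))) \<longlongrightarrow> snd c x0) ?F"
      using C(2,3) homeomorphism_cont1[OF C(4)]
      by (intro filterlim_compose[OF continuous_on_open_tendsto l1(3)])
    have ev: "\<forall>\<^sub>F t in ?F. \<forall>d. norm (chart_proj c (fst t) d - ?P0 d) \<le> \<eta> * norm d"
      "\<forall>\<^sub>F t in ?F. \<forall>d. norm (chart_proj c' (snd t, \<theta> (snd (fst t))) d - ?P0' d) \<le> \<eta> * norm d"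
      "\<forall>\<^sub>F t in ?F. \<forall>d. \<bar>chart_norm c (fst (fst t)) d - chart_norm c x0 d\<bar> \<le> \<eta> * norm d"
      "\<forall>\<^sub>F t in ?F. \<forall>d. \<bar>chart_norm c' (snd t) d - chart_norm c' z0 d\<bar> \<le> \<eta> * norm d"
      by (intro eventually_compose_filterlim[OF chart_proj_eventually_close[OF c0(1) eta] l1(1)]
          eventually_compose_filterlim[OF chart_proj_eventually_close[OF c0(2) eta] l2]
          eventually_compose_filterlim[OF chart_norm_eventually_close[OF c(1) eta] l1(3)]
          eventually_compose_filterlim[OF chart_norm_eventually_close[OF c' eta] l1(2)])+
    have ev2: "\<forall>\<^sub>F t in ?F. fst (fst t) \<in> fst c" "\<forall>\<^sub>F t in ?F. snd t \<in> fst c'" "\<forall>\<^sub>F t in ?F. snd (fst t) \<in> W"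
      using topological_tendstoD[OF l1(3) C(3,2)] topological_tendstoD[OF l1(2) C'(3,2)]
        topological_tendstoD[OF l1(4) F(2,3)] by auto
    have ev3: "\<forall>\<^sub>F t in ?F. dist (snd c (fst (fst t))) (snd c x0) < \<rho> / 2"
      using F(1) by (intro tendstoD[OF l3]) simp
    have "\<forall>\<^sub>F t in ?F. good_step r c c' t"
      using ev ev2 ev3
    proof eventually_elim
      case (elim t)
      obtain x \<omega> x' where t: "t = ((x, \<omega>), x')" by (metis prod.collapse)
      have ch: "c \<in> charts_at A x" "c' \<in> charts_at A x'"
        using elim(5,6) C(1) C'(1) by (simp_all add: t charts_at_def)
      then have ch': "c \<in> charts_at A (fst (x, \<omega>))" "c' \<in> charts_at A (fst (x', \<theta> \<omega>))" by simp_all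
      have w: "\<omega> \<in> W" using elim(7) by (simp add: t)
      have ball: "snd c x + a \<in> cball (snd c x0) \<rho>" if "a \<in> cball 0 r" for a
      proof -
        have "dist (snd c x0) (snd c x + a) \<le> dist (snd c x) (snd c x0) + norm a"
          using norm_triangle_ineq4[of "snd c x0 - snd c x" a] by (simp add: dist_norm norm_minus_commute algebra_simps)
        then show ?thesis using elim(8) that r(3) by (simp add: t)
      qed
      have "hyperbolic_step rate r (chart_adapted c (x, \<omega>)) (chart_proj c (x, \<omega>))
        (chart_adapted c' (x', \<theta> \<omega>)) (chart_proj c' (x', \<theta> \<omega>)) R (local_map c c' \<omega> x x')"
        unfolding chart_adapted_def fst_conv
      proof (rule step[OF linP[OF ch'(1)] idP[OF ch'(1)] linP[OF ch'(2)] idP[OF ch'(2)]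
            even_subadditive_chart_norm[OF ch(1)] even_subadditive_chart_norm[OF ch(2)] _ _ _ _ r(1,2)])
        fix a b :: 'e assume ab: "a \<in> cball 0 r" "b \<in> cball 0 r"
        show "norm (local_map c c' \<omega> x x' a - local_map c c' \<omega> x x' b - D (a - b)) \<le> \<eta> * norm (a - b)"
          using F(6)[OF w ball[OF ab(1)] ball[OF ab(2)]] by (simp add: local_map_def)
      qed (use elim in \<open>simp_all add: t\<close>)
      moreover have "\<forall>a\<in>cball 0 r. snd c x + a \<in> snd c ` fst c \<and> f \<omega> (chart_inv c (snd c x + a)) \<in> fst c'"
        using ball F(4) F(5)[OF w] by blast
      ultimately show ?case unfolding good_step_def t by auto
    qed
    then show ?thesis using r(1) by (auto simp: z0_def)
  qed
qed

section \<open>Uniformity by compactness, and mixing\<close>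

lemma good_step_mono:
  assumes "good_step r c c' t" "0 < r'" "r' \<le> r"
  shows "good_step r' c c' t"
proof -
  obtain x \<omega> x' where t: "t = ((x, \<omega>), x')" by (metis prod.collapse)
  have "cball 0 r' \<subseteq> cball (0::'e) r" using assms(3) by (rule subset_cball)
  then show ?thesis
    using assms hyperbolic_step_mono unfolding good_step_def t prod.case by blast
qed

text \<open>Finitely many charts, each with a closed subset of its domain, such that the subsets cover the
manifold. A point of a chain is read in a chart only if it lies in the closed subset, hence well inside
the domain; this is what makes the step estimates uniform.\<close>

definition closed_charts :: "(('m, 'e) chart \<times> 'm set) set \<Rightarrow> bool" where
  "closed_charts Q \<longleftrightarrow> finite Q \<and> (\<forall>q\<in>Q. fst q \<in> A \<and> closed (snd q) \<and> snd q \<subseteq> fst (fst q)) \<and>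
     (\<forall>x. \<exists>q\<in>Q. x \<in> snd q)"

lemma closed_chartsD:
  assumes "closed_charts Q" "q \<in> Q"
  shows "fst q \<in> A" "closed (snd q)" "snd q \<subseteq> fst (fst q)" "x \<in> snd q \<Longrightarrow> fst q \<in> charts_at A x"
  using assms unfolding closed_charts_def charts_at_def by auto

lemma closed_charts_exist:
  assumes cpt: "compact (UNIV :: 'm set)"
  obtains Q where "closed_charts Q"
proof -
  have "\<forall>x. \<exists>q. fst q \<in> A \<and> closed (snd q) \<and> snd q \<subseteq> fst (fst q) \<and> x \<in> interior (snd q)"
  proof
    fix x
    obtain c where c: "c \<in> charts_at A x" using atlas unfolding smooth_atlas_def charts_at_def by blast
    note C = chartD[OF c]
    obtain \<rho> where rho: "0 < \<rho>" "cball (snd c x) \<rho> \<subseteq> snd c ` fst c"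
      using C(2,5) open_contains_cball by blast
    define K where "K = chart_inv c ` cball (snd c x) \<rho>"
    define V where "V = fst c \<inter> snd c -` ball (snd c x) \<rho>"
    have "compact K"
      unfolding K_def using homeomorphism_cont2[OF C(4)] rho(2)
      by (intro compact_continuous_image compact_cball) (rule continuous_on_subset)
    then have "closed K" by (rule compact_imp_closed)
    have "K \<subseteq> fst c"
      unfolding K_def using rho(2) homeomorphism_apply1[OF C(4)] by fastforce
    have "open V"
      unfolding V_def using homeomorphism_cont1[OF C(4)] C(3) by (intro continuous_open_preimage) auto
    moreover have "x \<in> V" using C(2) rho(1) by (simp add: V_def)
    moreover have "V \<subseteq> K"
    proof
      fix y assume "y \<in> V"
      then have "y = chart_inv c (snd c y)" "snd c y \<in> cball (snd c x) \<rho>"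
        using homeomorphism_apply1[OF C(4)] by (auto simp: V_def)
      then show "y \<in> K" unfolding K_def by blast
    qed
    ultimately have "x \<in> interior K" by (intro interiorI)
    then show "\<exists>q. fst q \<in> A \<and> closed (snd q) \<and> snd q \<subseteq> fst (fst q) \<and> x \<in> interior (snd q)"
      using C(1) \<open>closed K\<close> \<open>K \<subseteq> fst c\<close> by (intro exI[of _ "(c, K)"]) simp
  qed
  from choice[OF this] obtain q where
    "\<forall>x. fst (q x) \<in> A \<and> closed (snd (q x)) \<and> snd (q x) \<subseteq> fst (fst (q x)) \<and> x \<in> interior (snd (q x))" ..
  then have q: "fst (q x) \<in> A" "closed (snd (q x))" "snd (q x) \<subseteq> fst (fst (q x))" "x \<in> interior (snd (q x))" for x
    by simp_all
  obtain T where T: "finite T" "UNIV \<subseteq> (\<Union>x\<in>T. interior (snd (q x)))"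
  proof (rule compactE_image[OF cpt, of UNIV "\<lambda>x. interior (snd (q x))"])
    show "UNIV \<subseteq> (\<Union>x. interior (snd (q x)))" using q(4) by blast
  qed (simp_all)
  show thesis
  proof (rule that)
    show "closed_charts (q ` T)"
      unfolding closed_charts_def
    proof (intro conjI allI)
      show "finite (q ` T)" using T(1) by simp
      show "\<forall>p\<in>q ` T. fst p \<in> A \<and> closed (snd p) \<and> snd p \<subseteq> fst (fst p)" using q(1-3) by blast
      fix x
      obtain t where t: "t \<in> T" "x \<in> interior (snd (q t))" using T(2) by blast
      have "x \<in> snd (q t)" using t(2) interior_subset by blast
      then show "\<exists>p\<in>q ` T. x \<in> snd p" using t(1) by blast
    qed
  qed
qed

text \<open>Away from the closed subsets the requirement is void in a neighbourhood; on them, the local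
estimate is available.\<close>

lemma eventually_good_step:
  assumes q: "closed_charts Q" "(c, K) \<in> Q" "(c', K') \<in> Q"
  shows "\<exists>r>0. \<forall>\<^sub>F t in nhds ((x0, \<omega>0), f \<omega>0 x0). fst (fst t) \<in> K \<longrightarrow> snd t \<in> K' \<longrightarrow> good_step r c c' t"
proof (cases "x0 \<in> K \<and> f \<omega>0 x0 \<in> K'")
  case True
  then have "c \<in> charts_at A x0" "c' \<in> charts_at A (f \<omega>0 x0)"
    using closed_chartsD(4)[OF q(1,2), of x0] closed_chartsD(4)[OF q(1,3), of "f \<omega>0 x0"] by simp_all
  from local_good_step[OF this] show ?thesis by (auto elim: eventually_mono)
next
  case False
  let ?F = "nhds ((x0, \<omega>0), f \<omega>0 x0)"
  have cl: "open (- K)" "open (- K')" using closed_chartsD(2)[OF q(1,2)] closed_chartsD(2)[OF q(1,3)] by auto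
  have l: "((\<lambda>t. fst (fst t)) \<longlongrightarrow> x0) ?F" "((\<lambda>t. snd t) \<longlongrightarrow> f \<omega>0 x0) ?F"
    using tendsto_snd[of "\<lambda>t. t" "((x0, \<omega>0), f \<omega>0 x0)" ?F]
      tendsto_fst[OF tendsto_fst[of "\<lambda>t. t" "((x0, \<omega>0), f \<omega>0 x0)" ?F]] by (simp_all add: filterlim_ident)
  have "\<forall>\<^sub>F t in ?F. fst (fst t) \<in> - K \<or> snd t \<in> - K'"
  proof (cases "x0 \<in> K")
    case True
    then have "f \<omega>0 x0 \<in> - K'" using False by simp
    from topological_tendstoD[OF l(2) cl(2) this] show ?thesis by (rule eventually_mono) simp
  next
    case False
    then have "x0 \<in> - K" by simp
    from topological_tendstoD[OF l(1) cl(1) this] show ?thesis by (rule eventually_mono) simp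
  qed
  then show ?thesis by (intro exI[of _ 1]) (auto elim: eventually_mono)
qed

definition good_in_charts :: "(('m, 'e) chart \<times> 'm set) set \<Rightarrow> real \<Rightarrow> ('m \<times> 'w) \<times> 'm \<Rightarrow> bool" where
  "good_in_charts Q r t \<longleftrightarrow> (\<forall>q\<in>Q. \<forall>q'\<in>Q. fst (fst t) \<in> snd q \<longrightarrow> snd t \<in> snd q' \<longrightarrow> good_step r (fst q) (fst q') t)"

lemma eventually_good:
  assumes Q: "closed_charts Q"
  shows "\<exists>r>0. \<forall>\<^sub>F t in nhds (p, f (snd p) (fst p)). good_in_charts Q r t"
proof -
  let ?F = "nhds (p, f (snd p) (fst p))"
  let ?S = "\<lambda>r q q' t. fst (fst t) \<in> snd q \<longrightarrow> snd t \<in> snd q' \<longrightarrow> good_step r (fst q) (fst q') t"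
  have fin: "finite Q" using Q by (simp add: closed_charts_def)
  have "\<forall>w\<in>Q \<times> Q. \<exists>r>0. \<forall>\<^sub>F t in ?F. ?S r (fst w) (snd w) t"
    using eventually_good_step[OF Q, of _ _ _ _ "fst p" "snd p"] by auto
  from bchoice[OF this] obtain r
    where "\<forall>w\<in>Q \<times> Q. 0 < r w \<and> (\<forall>\<^sub>F t in ?F. ?S (r w) (fst w) (snd w) t)" ..
  note rr = this[THEN bspec]
  have r: "\<And>w. w \<in> Q \<times> Q \<Longrightarrow> 0 < r w" "\<And>w. w \<in> Q \<times> Q \<Longrightarrow> \<forall>\<^sub>F t in ?F. ?S (r w) (fst w) (snd w) t"
    by (fact rr[THEN conjunct1], fact rr[THEN conjunct2])
  define r0 where "r0 = Min (insert 1 (r ` (Q \<times> Q)))"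
  have r0: "0 < r0" "\<And>w. w \<in> Q \<times> Q \<Longrightarrow> r0 \<le> r w"
    using fin r(1) by (auto simp: r0_def)
  have "\<forall>\<^sub>F t in ?F. \<forall>w\<in>Q \<times> Q. ?S (r w) (fst w) (snd w) t"
    using fin r(2) by (intro eventually_ball_finite) auto
  then have "\<forall>\<^sub>F t in ?F. good_in_charts Q r0 t"
  proof (rule eventually_mono)
    fix t assume t: "\<forall>w\<in>Q \<times> Q. ?S (r w) (fst w) (snd w) t"
    show "good_in_charts Q r0 t"
      unfolding good_in_charts_def
    proof (intro ballI impI)
      fix q q' assume q: "q \<in> Q" "q' \<in> Q" "fst (fst t) \<in> snd q" "snd t \<in> snd q'"
      then have m: "(q, q') \<in> Q \<times> Q" by simp
      have "good_step (r (q, q')) (fst q) (fst q') t" using t[THEN bspec, OF m] q by simp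
      then show "good_step r0 (fst q) (fst q') t" by (rule good_step_mono[OF _ r0(1) r0(2)[OF m]])
    qed
  qed
  then show ?thesis using r0(1) by blast
qed

text \<open>By compactness of the graph a single radius works on an open neighbourhood \<open>G\<close> of it. The
pairs \<open>(f\<^sub>\<omega> x, x')\<close> with \<open>((x, \<omega>), x')\<close> outside \<open>G\<close> form a compact set which misses the diagonal, so around each
diagonal point there is a square that misses it as well.\<close>

lemma uniform_good:
  assumes cpt: "compact (UNIV :: 'm set)" "compact (UNIV :: 'w set)" and Q: "closed_charts Q"
  shows "\<exists>r>0. \<forall>z. \<exists>U. open U \<and> z \<in> U \<and> (\<forall>x \<omega> x'. f \<omega> x \<in> U \<longrightarrow> x' \<in> U \<longrightarrow> good_in_charts Q r ((x, \<omega>), x'))"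
proof -
  let ?f = "\<lambda>p. f (snd p) (fst p)"
  have cptP: "compact (UNIV :: ('m \<times> 'w) set)" "compact (UNIV :: (('m \<times> 'w) \<times> 'm) set)"
    using compact_Times[OF cpt] compact_Times[OF compact_Times[OF cpt] cpt(1)] by simp_all
  have "\<exists>r S. 0 < r \<and> open S \<and> (p, ?f p) \<in> S \<and> (\<forall>t\<in>S. good_in_charts Q r t)" for p
    using eventually_good[OF Q] unfolding eventually_nhds by blast
  then obtain r S where S: "\<And>p. 0 < r p" "\<And>p. open (S p)" "\<And>p. (p, ?f p) \<in> S p"
    "\<And>p t. t \<in> S p \<Longrightarrow> good_in_charts Q (r p) t" by metis
  have "compact ((\<lambda>p. (p, ?f p)) ` UNIV)"
    by (intro compact_continuous_image cptP continuous_on_Pair continuous_on_id joint_continuity)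
  then obtain T where T: "finite T" "(\<lambda>p. (p, ?f p)) ` UNIV \<subseteq> (\<Union>p\<in>T. S p)"
  proof (rule compactE_image[of _ UNIV S])
    show "(\<lambda>p. (p, ?f p)) ` UNIV \<subseteq> (\<Union>p. S p)" using S(3) by blast
  qed (simp_all add: S(2))
  define G where "G = (\<Union>p\<in>T. S p)"
  define r0 where "r0 = Min (insert 1 (r ` T))"
  have r0: "0 < r0" "\<And>p. p \<in> T \<Longrightarrow> r0 \<le> r p" using T(1) S(1) by (auto simp: r0_def)
  have near_graph: "good_in_charts Q r0 t" if "t \<in> G" for t
  proof -
    from that obtain p where p: "p \<in> T" "t \<in> S p" unfolding G_def by blast
    show ?thesis
      using S(4)[OF p(2)] good_step_mono[OF _ r0(1) r0(2)[OF p(1)]] unfolding good_in_charts_def by blast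
  qed
  have oO: "open G" using S(2) by (auto simp: G_def)
  let ?h = "\<lambda>t. (?f (fst t), snd t)"
  have "compact (- G)" using oO cptP(2) by (metis Compl_eq_Diff_UNIV compact_diff)
  moreover have "continuous_on UNIV ?h"
    by (intro continuous_on_Pair continuous_on_snd continuous_on_id
        continuous_on_compose2[OF joint_continuity] continuous_on_fst) auto
  ultimately have "closed (?h ` (- G))"
    by (intro compact_imp_closed compact_continuous_image) (auto intro: continuous_on_subset)
  then have oN: "open (- (?h ` (- G)))" by (rule open_Compl)
  have diag: "(z, z) \<in> - (?h ` (- G))" for z
  proof
    assume "(z, z) \<in> ?h ` (- G)"
    then obtain t where t: "t \<notin> G" "?f (fst t) = z" "snd t = z" by auto
    then have "t = (fst t, ?f (fst t))" by (metis prod.collapse)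
    then show False using T(2) t(1) unfolding G_def by blast
  qed
  have "\<exists>U. open U \<and> z \<in> U \<and> (\<forall>x \<omega> x'. f \<omega> x \<in> U \<longrightarrow> x' \<in> U \<longrightarrow> good_in_charts Q r0 ((x, \<omega>), x'))" for z
  proof -
    obtain B C where BC: "open B" "open C" "(z, z) \<in> B \<times> C" "B \<times> C \<subseteq> - (?h ` (- G))"
      using open_prod_elim[OF oN diag] by blast
    have "good_in_charts Q r0 ((x, \<omega>), x')" if "f \<omega> x \<in> B \<inter> C" "x' \<in> B \<inter> C" for x \<omega> x'
    proof (rule near_graph, rule ccontr)
      assume "((x, \<omega>), x') \<notin> G"
      then have "?h ((x, \<omega>), x') \<in> ?h ` (- G)" by blast
      then show False using BC(4) that by auto
    qed
    then show ?thesis using BC by (intro exI[of _ "B \<inter> C"]) auto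
  qed
  then show ?thesis using r0(1) by blast
qed

lemma uniform_chart_close:
  assumes Q: "closed_charts Q" and s: "0 < s"
  shows "\<exists>U. open U \<and> z \<in> U \<and> (\<forall>q\<in>Q. \<forall>w\<in>U. \<forall>x'\<in>U. x' \<in> snd q \<longrightarrow> dist (snd (fst q) w) (snd (fst q) x') \<le> s)"
proof -
  have fin: "finite Q" using Q by (simp add: closed_charts_def)
  let ?S = "\<lambda>q w. (z \<in> snd q \<longrightarrow> dist (snd (fst q) w) (snd (fst q) z) < s / 2) \<and> (z \<notin> snd q \<longrightarrow> w \<notin> snd q)"
  have "\<forall>\<^sub>F w in nhds z. \<forall>q\<in>Q. ?S q w"
  proof (intro eventually_ball_finite fin ballI)
    fix q assume q: "q \<in> Q"
    note qq = closed_chartsD[OF Q q]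
    show "\<forall>\<^sub>F w in nhds z. ?S q w"
    proof (cases "z \<in> snd q")
      case True
      note C = chartD[OF qq(4)[OF True]]
      have "(snd (fst q) \<longlongrightarrow> snd (fst q) z) (nhds z)"
        using C(2,3) homeomorphism_cont1[OF C(4)] by (intro continuous_on_open_tendsto)
      from tendstoD[OF this half_gt_zero[OF s]] show ?thesis
        by (rule eventually_mono) (use True in simp)
    next
      case False
      then have "\<forall>\<^sub>F w in nhds z. w \<in> - snd q" using qq(2) by (intro eventually_nhds_in_open) auto
      then show ?thesis by (rule eventually_mono) (use False in simp)
    qed
  qed
  then obtain U where U: "open U" "z \<in> U" "\<And>w q. w \<in> U \<Longrightarrow> q \<in> Q \<Longrightarrow> ?S q w"
    unfolding eventually_nhds by blast
  have "dist (snd (fst q) w) (snd (fst q) x') \<le> s" if "q \<in> Q" "w \<in> U" "x' \<in> U" "x' \<in> snd q" for q w x'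
  proof -
    have "z \<in> snd q" using U(3)[OF that(3,1)] that(4) by blast
    then have "dist (snd (fst q) w) (snd (fst q) z) < s / 2" "dist (snd (fst q) x') (snd (fst q) z) < s / 2"
      using U(3)[OF that(2,1)] U(3)[OF that(3,1)] by blast+
    then show ?thesis by (rule dist_triangle_half_l[THEN less_imp_le])
  qed
  then show ?thesis using U(1,2) by blast
qed

lemma adapted_chart: "c \<in> charts_at A (fst p) \<Longrightarrow> adapted_norm (chart_adapted c p) (chart_proj c p)"
  unfolding chart_adapted_def chart_proj_def
  using linear_proj_along[OF complementary] proj_along_fixes(1)[OF complementary proj_along_mem(1)[OF complementary]]
  by (intro adapted_split_norm even_subadditive_chart_norm) (simp_all add: linear_conv_bounded_linear)

lemma chart_radius:
  assumes c: "c \<in> charts_at A x" and U: "open U" "x \<in> U"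
  obtains e where "0 < e" "\<And>a. norm a \<le> e \<Longrightarrow> chart_inv c (snd c x + a) \<in> U"
proof -
  note C = chartD[OF c]
  have "is_chart c" using atlas C(1) by (simp add: smooth_atlas_def)
  then have "open (snd c ` (fst c \<inter> U))" by (rule open_chart_image[OF _ U(1)])
  then obtain e where e: "0 < e" "cball (snd c x) e \<subseteq> snd c ` (fst c \<inter> U)"
    using C(2) U(2) open_contains_cball by blast
  show thesis
  proof (rule that[OF e(1)])
    fix a :: 'e assume "norm a \<le> e"
    then have "snd c x + a \<in> cball (snd c x) e" by (simp add: dist_norm)
    then obtain y where "y \<in> fst c" "y \<in> U" "snd c x + a = snd c y" using e(2) by blast
    then show "chart_inv c (snd c x + a) \<in> U" using homeomorphism_apply1[OF C(4)] by simp
  qed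
qed

text \<open>In coordinates centred at the points of the chain the fibre maps form a hyperbolic sequence, and a
small orbit of this sequence is a true orbit near the chain. The radius \<open>r\<close> of the step estimates is
fixed first, then the distance \<open>\<rho> / r\<close> of the orbit, and the size of the jumps is chosen last.\<close>

lemma chain_shadowing:
  fixes X :: "nat \<Rightarrow> 'm"
  assumes ch: "\<And>i. c i \<in> charts_at A (X i)"
    and steps: "\<And>i. good_step r (c i) (c (Suc i)) ((X i, (\<theta> ^^ i) \<omega>), X (Suc i))"
    and r: "0 < r" and rho: "0 < \<rho>" "\<rho> \<le> r * r"
    and jump: "\<And>i. dist (snd (c (Suc i)) (f ((\<theta> ^^ i) \<omega>) (X i))) (snd (c (Suc i)) (X (Suc i))) \<le> (1 - rate) * \<rho> * r"
  shows "\<exists>v. \<forall>i. norm (v i) \<le> \<rho> / r \<and>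
    chart_inv (c (Suc i)) (snd (c (Suc i)) (X (Suc i)) + v (Suc i)) =
      f ((\<theta> ^^ i) \<omega>) (chart_inv (c i) (snd (c i) (X i) + v i))"
proof -
  let ?w = "\<lambda>i. (\<theta> ^^ i) \<omega>"
  let ?h = "\<lambda>i. local_map (c i) (c (Suc i)) (?w i) (X i) (X (Suc i))"
  let ?P = "\<lambda>i. chart_proj (c i) (X i, ?w i)" and ?M = "\<lambda>i. chart_adapted (c i) (X i, ?w i)"
  have dom: "f (?w i) (chart_inv (c i) (snd (c i) (X i) + a)) \<in> fst (c (Suc i))" if "a \<in> cball 0 r" for i a
    using steps[of i] that by (simp add: good_step_def)
  have "\<forall>i. \<exists>R. hyperbolic_step rate r (?M i) (?P i) (?M (Suc i)) (?P (Suc i)) R (?h i)"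
    using steps by (simp add: good_step_def)
  from choice[OF this] obtain R where "\<forall>i. hyperbolic_step rate r (?M i) (?P i) (?M (Suc i)) (?P (Suc i)) (R i) (?h i)" ..
  then have R: "\<And>i. hyperbolic_step rate r (?M i) (?P i) (?M (Suc i)) (?P (Suc i)) (R i) (?h i)" by (rule spec)
  have h0: "norm (?h i 0) \<le> (1 - rate) * \<rho> * r" for i
    using jump[of i] homeomorphism_apply1[OF chartD(4)[OF ch] chartD(2)[OF ch], of i]
    by (simp add: local_map_def coord_rep_def dist_norm)
  have ad: "adapted_norm (?M i) (?P i)" for i using ch[of i] by (intro adapted_chart) simp
  obtain v where v: "\<And>i. norm (v i) \<le> \<rho> / r" "\<And>i. v (Suc i) = ?h i (v i)"
    using hyperbolic_shadowing[of ?M ?P rate r R ?h \<rho>, OF ad R rate(2,3) r rho h0] by blast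
  show ?thesis
  proof (intro exI[of _ v] allI conjI v(1))
    fix i
    have "\<rho> / r \<le> r" using rho r by (simp add: pos_divide_le_eq)
    then have "v i \<in> cball 0 r" using v(1)[of i] by simp
    from dom[OF this] show "chart_inv (c (Suc i)) (snd (c (Suc i)) (X (Suc i)) + v (Suc i)) =
      f (?w i) (chart_inv (c i) (snd (c i) (X i) + v i))"
      using homeomorphism_apply1[OF chartD(4)[OF ch[of "Suc i"]]]
      by (simp add: v(2) local_map_def coord_rep_def)
  qed
qed

lemma skew_product_orbit:
  assumes "\<And>i. y (Suc i) = f ((\<theta> ^^ i) \<omega>) (y i)"
  shows "(skew_product f \<theta> ^^ n) (y 0, \<omega>) = (y n, (\<theta> ^^ n) \<omega>)"
  by (induction n) (simp_all add: skew_product_def assms)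

text \<open>Shadowing is stated for infinite chains, which spares a boundary condition at the end. A finite
chain is continued by the orbit of its last point.\<close>

lemma chain_extend:
  assumes cov: "\<Union>\<U> = UNIV" and z: "\<forall>i<n. \<exists>U\<in>\<U>. F i (z i) \<in> U \<and> z (Suc i) \<in> U"
  shows "\<exists>X. (\<forall>i\<le>n. X i = z i) \<and> (\<forall>i. \<exists>U\<in>\<U>. F i (X i) \<in> U \<and> X (Suc i) \<in> U)"
proof -
  define G where "G = rec_nat (z n) (\<lambda>k. F (n + k))"
  define X where "X i = (if i \<le> n then z i else G (i - n))" for i
  have "\<exists>U\<in>\<U>. F i (X i) \<in> U \<and> X (Suc i) \<in> U" for i
  proof (cases "i < n")
    case True
    then show ?thesis using z by (simp add: X_def)
  next
    case False
    have G: "G 0 = z n" "G (Suc k) = F (n + k) (G k)" for k by (simp_all add: G_def)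
    have "X i = G (i - n)" "X (Suc i) = G (Suc (i - n))" using False G(1) by (auto simp: X_def Suc_diff_le)
    then have "X (Suc i) = F i (X i)" using False G(2)[of "i - n"] by simp
    then show ?thesis using cov by auto
  qed
  then show ?thesis by (intro exI[of _ X]) (simp add: X_def)
qed

theorem mixing:
  assumes cpt: "compact (UNIV :: 'm set)" "compact (UNIV :: 'w set)" and conn: "connected (UNIV :: 'm set)"
    and \<nu>: "borel_probability \<nu>" "invariant_measure f \<nu>" "measure_support \<nu> = UNIV"
  shows "mixing_on_fibers f \<theta>"
  unfolding mixing_on_fibers_def
proof (intro allI impI)
  fix U V :: "'m set" assume UV: "open U" "open V" "U \<noteq> {}" "V \<noteq> {}"
  obtain x y where xy: "x \<in> U" "y \<in> V" using UV by blast
  obtain Q where Q: "closed_charts Q" by (rule closed_charts_exist[OF cpt(1)])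
  have "\<forall>p. \<exists>q. q \<in> Q \<and> p \<in> snd q" using Q unfolding closed_charts_def by blast
  then obtain q where q: "\<And>p. q p \<in> Q" "\<And>p. p \<in> snd (q p)" by metis
  define c where "c p = fst (q p)" for p
  have c: "c p \<in> charts_at A p" for p
    unfolding c_def by (rule closed_chartsD(4)[OF Q q])
  obtain r where r: "0 < r"
    "\<And>z. \<exists>U. open U \<and> z \<in> U \<and> (\<forall>x \<omega> x'. f \<omega> x \<in> U \<longrightarrow> x' \<in> U \<longrightarrow> good_in_charts Q r ((x, \<omega>), x'))"
    using uniform_good[OF cpt Q] by blast
  obtain e1 where e1: "0 < e1" "\<And>a. norm a \<le> e1 \<Longrightarrow> chart_inv (c x) (snd (c x) x + a) \<in> U"
    using chart_radius[OF c UV(1) xy(1)] by blast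
  obtain e2 where e2: "0 < e2" "\<And>a. norm a \<le> e2 \<Longrightarrow> chart_inv (c y) (snd (c y) y + a) \<in> V"
    using chart_radius[OF c UV(2) xy(2)] by blast
  \<comment> \<open>Shadowing needs \<open>\<rho> \<le> r\<^sup>2\<close> and gives orbits at distance \<open>\<rho> / r\<close>, which must not
     exceed \<open>e1\<close> and \<open>e2\<close>.\<close>
  define \<rho> where "\<rho> = min (r * r) (r * min e1 e2)"
  have rho: "0 < \<rho>" "\<rho> \<le> r * r" using r(1) e1(1) e2(1) by (auto simp: \<rho>_def)
  have "\<rho> / r \<le> min e1 e2" using r(1) by (simp only: pos_divide_le_eq) (simp add: \<rho>_def mult.commute)
  then have rho': "\<rho> / r \<le> e1" "\<rho> / r \<le> e2" by simp_all
  \<comment> \<open>The largest jump for which shadowing at the scale \<open>\<rho>\<close> is available.\<close>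
  define s where "s = (1 - rate) * \<rho> * r"
  have s: "0 < s" using rate rho r(1) by (simp add: s_def)
  have "\<forall>z. \<exists>B. open B \<and> z \<in> B \<and> (\<forall>x \<omega> x'. f \<omega> x \<in> B \<longrightarrow> x' \<in> B \<longrightarrow> good_in_charts Q r ((x, \<omega>), x')) \<and>
      (\<forall>q\<in>Q. \<forall>w\<in>B. \<forall>x'\<in>B. x' \<in> snd q \<longrightarrow> dist (snd (fst q) w) (snd (fst q) x') \<le> s)"
  proof
    fix z
    obtain B1 where B1: "open B1" "z \<in> B1" "\<And>x \<omega> x'. f \<omega> x \<in> B1 \<Longrightarrow> x' \<in> B1 \<Longrightarrow> good_in_charts Q r ((x, \<omega>), x')"
      using r(2)[of z] by blast
    obtain B2 where B2: "open B2" "z \<in> B2"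
      "\<And>q w x'. q \<in> Q \<Longrightarrow> w \<in> B2 \<Longrightarrow> x' \<in> B2 \<Longrightarrow> x' \<in> snd q \<Longrightarrow> dist (snd (fst q) w) (snd (fst q) x') \<le> s"
      using uniform_chart_close[OF Q s, of z] by blast
    show "\<exists>B. open B \<and> z \<in> B \<and> (\<forall>x \<omega> x'. f \<omega> x \<in> B \<longrightarrow> x' \<in> B \<longrightarrow> good_in_charts Q r ((x, \<omega>), x')) \<and>
      (\<forall>q\<in>Q. \<forall>w\<in>B. \<forall>x'\<in>B. x' \<in> snd q \<longrightarrow> dist (snd (fst q) w) (snd (fst q) x') \<le> s)"
      using B1 B2 by (intro exI[of _ "B1 \<inter> B2"]) auto
  qed
  from choice[OF this] obtain B where BB: "\<forall>z. open (B z) \<and> z \<in> B z \<and>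
      (\<forall>x \<omega> x'. f \<omega> x \<in> B z \<longrightarrow> x' \<in> B z \<longrightarrow> good_in_charts Q r ((x, \<omega>), x')) \<and>
      (\<forall>q\<in>Q. \<forall>w\<in>B z. \<forall>x'\<in>B z. x' \<in> snd q \<longrightarrow> dist (snd (fst q) w) (snd (fst q) x') \<le> s)" ..
  have B: "open (B z)" "z \<in> B z" "f \<omega> x \<in> B z \<Longrightarrow> x' \<in> B z \<Longrightarrow> good_in_charts Q r ((x, \<omega>), x')"
    "q \<in> Q \<Longrightarrow> w \<in> B z \<Longrightarrow> x' \<in> B z \<Longrightarrow> x' \<in> snd q \<Longrightarrow> dist (snd (fst q) w) (snd (fst q) x') \<le> s"
    for z x \<omega> x' q w
    using BB[THEN spec[of _ z]] by simp_all
  obtain T where T: "finite T" "UNIV \<subseteq> (\<Union>z\<in>T. B z)"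
  proof (rule compactE_image[OF cpt(1), of UNIV B])
    show "UNIV \<subseteq> (\<Union>z. B z)" using B(2) by blast
  qed (simp_all add: B(1))
  define \<U> where "\<U> = B ` T"
  have cov: "finite \<U>" "\<And>W. W \<in> \<U> \<Longrightarrow> open W" "\<Union>\<U> = UNIV" using T B(1) by (auto simp: \<U>_def)
  have bij: "bij (f \<omega>)" and cont_inv: "continuous_on UNIV (inv (f \<omega>))" for \<omega>
    using diff2[of \<omega>] by (auto simp: Diff2_def Ck_map_def)
  have inj: "inj (f \<omega>)" for \<omega> using bij by (rule bij_is_inj)
  have opn: "open (f \<omega> ` S)" if "open S" for \<omega> S
    using open_vimage[OF that cont_inv[of \<omega>]] bij_vimage_eq_inv_image[OF bij_imp_bij_inv[OF bij[of \<omega>]], of S]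
    by (simp add: inv_inv_eq[OF bij])
  have "\<exists>N>0. \<forall>n\<ge>N. \<forall>\<omega> x y. \<exists>z. z 0 = x \<and> z n = y \<and>
     (\<forall>i<n. \<exists>U\<in>\<U>. f ((\<theta> ^^ i) \<omega>) (z i) \<in> U \<and> z (Suc i) \<in> U)"
    by (rule chain_mixing[OF conn \<nu>]) (fact inj opn cov)+
  then obtain N where N: "0 < N" "\<forall>n\<ge>N. \<forall>\<omega> x y. \<exists>z. z 0 = x \<and> z n = y \<and>
     (\<forall>i<n. \<exists>U\<in>\<U>. f ((\<theta> ^^ i) \<omega>) (z i) \<in> U \<and> z (Suc i) \<in> U)" by (elim exE conjE)
  show "\<exists>N>0. \<forall>n\<ge>N. \<forall>\<omega>. (skew_product f \<theta> ^^ n) ` (U \<times> {\<omega>}) \<inter> V \<times> {(\<theta> ^^ n) \<omega>} \<noteq> {}"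
  proof (intro exI[of _ N] conjI allI impI N(1))
    fix n \<omega> assume n: "N \<le> n"
    let ?w = "\<lambda>i. (\<theta> ^^ i) \<omega>"
    obtain z where z: "z 0 = x" "z n = y" "\<forall>i<n. \<exists>U\<in>\<U>. f (?w i) (z i) \<in> U \<and> z (Suc i) \<in> U"
      using N(2)[rule_format, OF n, of x y \<omega>] by blast
    obtain X where X: "\<forall>i\<le>n. X i = z i" "\<forall>i. \<exists>U\<in>\<U>. f (?w i) (X i) \<in> U \<and> X (Suc i) \<in> U"
      using chain_extend[OF cov(3), of n "\<lambda>i. f (?w i)", OF z(3)] by blast
    have X0: "X 0 = x" "X n = y" using X(1) z by auto
    have step: "\<exists>b. f (?w i) (X i) \<in> B b \<and> X (Suc i) \<in> B b" for i using X(2) unfolding \<U>_def by blast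
    have "\<exists>v. \<forall>i. norm (v i) \<le> \<rho> / r \<and>
      chart_inv (c (X (Suc i))) (snd (c (X (Suc i))) (X (Suc i)) + v (Suc i)) =
        f (?w i) (chart_inv (c (X i)) (snd (c (X i)) (X i) + v i))"
    proof (rule chain_shadowing[where c = "\<lambda>i. c (X i)", OF c _ r(1) rho])
      fix i
      obtain b where b: "f (?w i) (X i) \<in> B b" "X (Suc i) \<in> B b" using step by blast
      show "good_step r (c (X i)) (c (X (Suc i))) ((X i, ?w i), X (Suc i))"
        using B(3)[OF b] q unfolding good_in_charts_def c_def by fastforce
      show "dist (snd (c (X (Suc i))) (f (?w i) (X i))) (snd (c (X (Suc i))) (X (Suc i))) \<le> (1 - rate) * \<rho> * r"
        using B(4)[OF q(1) b q(2)] unfolding c_def s_def .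
    qed
    then obtain v where v: "\<And>i. norm (v i) \<le> \<rho> / r"
      "\<And>i. chart_inv (c (X (Suc i))) (snd (c (X (Suc i))) (X (Suc i)) + v (Suc i)) =
        f (?w i) (chart_inv (c (X i)) (snd (c (X i)) (X i) + v i))" by blast
    define p where "p i = chart_inv (c (X i)) (snd (c (X i)) (X i) + v i)" for i
    have "(skew_product f \<theta> ^^ n) (p 0, \<omega>) = (p n, ?w n)"
      by (rule skew_product_orbit) (simp add: p_def v(2))
    moreover have "p 0 \<in> U" using e1(2)[of "v 0"] v(1)[of 0] rho'(1) by (simp add: p_def X0)
    moreover have "p n \<in> V" using e2(2)[of "v n"] v(1)[of n] rho'(2) by (simp add: p_def X0)
    ultimately show "(skew_product f \<theta> ^^ n) ` (U \<times> {\<omega>}) \<inter> V \<times> {?w n} \<noteq> {}"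
      by (metis (no_types, lifting) IntI SigmaI empty_iff image_eqI singletonI)
  qed
qed

end

theorem theorem8p2:
  fixes A :: "('m::{t2_space, second_countable_topology}, 'e::euclidean_space) chart set"
    and g :: "'m \<Rightarrow> ('m, 'e) tangent \<Rightarrow> ('m, 'e) tangent \<Rightarrow> real"
    and \<theta> :: "'w::metric_space \<Rightarrow> 'w"
    and f :: "'w \<Rightarrow> 'm \<Rightarrow> 'm"
  assumes "smooth_atlas A" and "riemannian_metric A g"
    and "compact (UNIV :: 'm set)" and "connected (UNIV :: 'm set)"
    and "compact (UNIV :: 'w set)"
    and "homeomorphism UNIV UNIV \<theta> (inv \<theta>)"
    and "continuous_map euclidean (Diff2_topology A) f"
    and "anosov_on_fibers A g f \<theta>"
    and "\<exists>\<nu>. borel_probability \<nu> \<and> invariant_measure f \<nu> \<and> measure_support \<nu> = UNIV"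
  shows "mixing_on_fibers f \<theta>"
proof -
  from assms(8)[unfolded anosov_on_fibers_def] show ?thesis
  proof (elim exE)
    fix Eu Es :: "'m \<times> 'w \<Rightarrow> ('m, 'e) tangent set" and lam
    assume a: "continuous_subbundle A Eu \<and> continuous_subbundle A Es \<and> lam > 0 \<and>
        (\<forall>x \<omega>.
           Eu (x, \<omega>) \<inter> Es (x, \<omega>) = {0} \<and>
           {\<xi> + \<eta> | \<xi> \<eta>. \<xi> \<in> Eu (x, \<omega>) \<and> \<eta> \<in> Es (x, \<omega>)} = tangent_space A x \<and>
           dim (Eu (x, \<omega>)) > 0 \<and> dim (Es (x, \<omega>)) > 0 \<and>
           tangent_map A (f \<omega>) x ` Eu (x, \<omega>) = Eu (skew_product f \<theta> (x, \<omega>)) \<and>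
           tangent_map A (f \<omega>) x ` Es (x, \<omega>) = Es (skew_product f \<theta> (x, \<omega>)) \<and>
           (\<forall>\<xi>\<in>Eu (x, \<omega>). riemannian_norm g (f \<omega> x) (tangent_map A (f \<omega>) x \<xi>)
                               \<ge> exp lam * riemannian_norm g x \<xi>) \<and>
           (\<forall>\<eta>\<in>Es (x, \<omega>). riemannian_norm g (f \<omega> x) (tangent_map A (f \<omega>) x \<eta>)
                               \<le> exp (- lam) * riemannian_norm g x \<eta>))"
    note b = a[THEN conjunct2, THEN conjunct2, THEN conjunct2, rule_format]
    interpret anosov_fibres A g f \<theta> Eu Es lam
    proof
      show "continuous_on UNIV \<theta>" using assms(6) by (rule homeomorphism_cont1)
      fix x \<omega>
      note b' = b[of x \<omega>]
      show "Eu (x, \<omega>) \<inter> Es (x, \<omega>) = {0}"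
        "{\<xi> + \<eta> | \<xi> \<eta>. \<xi> \<in> Eu (x, \<omega>) \<and> \<eta> \<in> Es (x, \<omega>)} = tangent_space A x"
        using b' by blast+
      show "tangent_map A (f \<omega>) x ` Eu (x, \<omega>) = Eu (f \<omega> x, \<theta> \<omega>)"
        "tangent_map A (f \<omega>) x ` Es (x, \<omega>) = Es (f \<omega> x, \<theta> \<omega>)"
        using b' by (simp_all add: skew_product_def)
      show "exp lam * riemannian_norm g x \<xi> \<le> riemannian_norm g (f \<omega> x) (tangent_map A (f \<omega>) x \<xi>)"
        if "\<xi> \<in> Eu (x, \<omega>)" for \<xi> using b' that by blast
      show "riemannian_norm g (f \<omega> x) (tangent_map A (f \<omega>) x \<eta>) \<le> exp (- lam) * riemannian_norm g x \<eta>"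
        if "\<eta> \<in> Es (x, \<omega>)" for \<eta> using b' that by blast
    qed (use assms a in blast)+
    from assms(9) show ?thesis using mixing[OF assms(3,5,4)] by blast
  qed
qed

end
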